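(* Let $\alpha\ge\beta\ge-1/2$ with $\alpha>-1/2$. Let $\nu$ be a probability measure on $[0,\infty[$ with $\nu\ne\delta_0$ and finite second moment, and let $(S_n^{(\alpha,\beta,1)})_{n\ge0}$ be the Jacobi random walk on $[0,\infty[$ of index $(\alpha,\beta)$ with law $\nu$. For $k\in\mathbb N$ let $M_k:=\int_0^\infty m_k\,d\nu$ be the modified moments of $\nu$, where $0<M_1,M_2<\infty$ by the assumption on $\nu$. Then $$\bigl(S_n^{(\alpha,\beta,1)}-nM_1\bigr)/\sqrt n$$ tends in distribution, as $n\to\infty$, to $N(0,M_2-M_1^2)$. Moreover, if $\nu$ in addition has a finite third moment, then the distribution functions of $(S_n^{(\alpha,\beta,1)}-nM_1)/\sqrt n$ tend uniformly to the distribution function of $N(0,M_2-M_1^2)$ with order $n^{-1/3}$, i.e. the supremum over $\mathbb R$ of the absolute difference of the distribution functions is $O(n^{-1/3})$.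
   Context: For $\alpha\ge\beta\ge-1/2$ with $\alpha>-1/2$ let $m_{\alpha,\beta}$ be the probability measure on $[0,1]\times[0,\pi]$ given by $$dm_{\alpha,\beta}(r,\phi)=\frac{2\Gamma(\alpha+1)}{\Gamma(1/2)\Gamma(\alpha-\beta)\Gamma(\beta+1/2)}(1-r^2)^{\alpha-\beta-1}(r\sin\phi)^{2\beta}\,r\,dr\,d\phi\quad(\alpha>\beta>-1/2),$$ $$dm_{\alpha,-1/2}(r,\phi)=\frac{2\Gamma(\alpha+1)}{\Gamma(1/2)\Gamma(\alpha+1/2)}(1-r^2)^{\alpha-1/2}\,dr\cdot\tfrac12\,d(\delta_0+\delta_\pi)(\phi)\quad(\alpha>\beta=-1/2),$$ $$dm_{\alpha,\alpha}(r,\phi)=\frac{\Gamma(\alpha+1)}{\Gamma(1/2)\Gamma(\alpha+1/2)}\sin^{2\alpha}\phi\,d\phi\cdot d\delta_1(r)\quad(\alpha=\beta>-1/2).$$ The Jacobi convolution $*_{(\alpha,\beta)}$ of point measures on $[0,\infty[$ is $$(\delta_s*_{(\alpha,\beta)}\delta_t)(f)=\int_0^1\int_0^\pi f\bigl(\operatorname{arcosh}|\cosh s\cosh t+re^{i\phi}\sinh s\sinh t|\bigr)\,dm_{\alpha,\beta}(r,\phi),\quad f\in C_b([0,\infty[),$$ extended bilinearly and weakly continuously to bounded measures on $[0,\infty[$. The Jacobi random walk of index $(\alpha,\beta)$ with law $\nu$ is the time-homogeneous Markov chain $(S_n)_{n\ge0}$ on $[0,\infty[$ started at $0$ with $P(S_{n+1}\in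 A\mid S_n=x)=(\delta_x*_{(\alpha,\beta)}\nu)(A)$ for $x\ge0$ and Borel sets $A\subset[0,\infty[$. The notation $S_n^{(\alpha,\beta,1)}$ means that the law is $\nu$ itself (no compression). Moment functions: for $k\in\mathbb N$ and $t\ge0$, $$m_k(t):=\int_0^1\int_0^\pi\bigl(\ln|\cosh t+re^{i\phi}\sinh t|\bigr)^k\,dm_{\alpha,\beta}(r,\phi).$$ *)

theory Defs
  imports "HOL-Probability.Probability" "HOL-Library.Landau_Symbols"
begin

abbreviation half_line :: "real measure" where
  "half_line \<equiv> restrict_space borel {0..}"

text \<open>
  The probability measure on $[0,1] \times [0,\pi]$. It is only meaningful for
  \<open>\<alpha> \<ge> \<beta> \<ge> -1/2\<close> and \<open>\<alpha> > -1/2\<close>, where the three branches are \<open>\<alpha> = \<beta> > -1/2\<close>,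
  \<open>\<alpha> > \<beta> = -1/2\<close> and \<open>\<alpha> > \<beta> > -1/2\<close>. All bases of \<open>powr\<close> are nonnegative on the underlying space,
  and the convention \<open>0 powr a = 0\<close> matters on null sets only.
\<close>

definition jacobi_measure :: "real \<Rightarrow> real \<Rightarrow> (real \<times> real) measure" where
  "jacobi_measure \<alpha> \<beta> =
    (if \<alpha> = \<beta> then
       return (restrict_space borel {0..1}) 1 \<Otimes>\<^sub>M
       density (restrict_space lborel {0..pi})
         (\<lambda>\<phi>. ennreal (Gamma (\<alpha> + 1) / (Gamma (1/2) * Gamma (\<alpha> + 1/2)) * sin \<phi> powr (2 * \<alpha>)))
     else if \<beta> = -1/2 then
       density (restrict_space lborel {0..1})
         (\<lambda>r. ennreal (2 * Gamma (\<alpha> + 1) / (Gamma (1/2) * Gamma (\<alpha> + 1/2))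
                        * (1 - r\<^sup>2) powr (\<alpha> - 1/2))) \<Otimes>\<^sub>M
       distr (uniform_count_measure {0, pi}) (restrict_space borel {0..pi}) (\<lambda>\<phi>. \<phi>)
     else
       density (restrict_space lborel {0..1} \<Otimes>\<^sub>M restrict_space lborel {0..pi})
         (\<lambda>(r, \<phi>). ennreal
            (2 * Gamma (\<alpha> + 1) / (Gamma (1/2) * Gamma (\<alpha> - \<beta>) * Gamma (\<beta> + 1/2))
              * (1 - r\<^sup>2) powr (\<alpha> - \<beta> - 1) * (r * sin \<phi>) powr (2 * \<beta>) * r)))"

definition jacobi_point_map :: "real \<Rightarrow> real \<Rightarrow> real \<times> real \<Rightarrow> real" where
  "jacobi_point_map s t = (\<lambda>(r, \<phi>).
     arcosh (cmod (complex_of_real (cosh s * cosh t)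
       + complex_of_real r * exp (\<i> * complex_of_real \<phi>) * complex_of_real (sinh s * sinh t))))"

text \<open>
  The convolution of two point measures, given in the literature by its action on bounded continuous
  functions (see \<open>integral_jacobi_conv_point\<close> below), is an image measure.
  The convolution of general measures is its bilinear, weakly continuous extension
  $(\mu * \nu)(A) = \int\!\int (\delta_s * \delta_t)(A)\, d\nu(t)\, d\mu(s)$.
\<close>

definition jacobi_conv_point :: "real \<Rightarrow> real \<Rightarrow> real \<Rightarrow> real \<Rightarrow> real measure" where
  "jacobi_conv_point \<alpha> \<beta> s t = distr (jacobi_measure \<alpha> \<beta>) half_line (jacobi_point_map s t)"

definition jacobi_conv :: "real \<Rightarrow> real \<Rightarrow> real measure \<Rightarrow> real measure \<Rightarrow> real measure" where
  "jacobi_conv \<alpha> \<beta> \<mu> \<nu> = bind \<mu> (\<lambda>s. bind \<nu> (\<lambda>t. jacobi_conv_point \<alpha> \<beta> s t))"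

definition history_algebra :: "'a measure \<Rightarrow> 'b measure \<Rightarrow> (nat \<Rightarrow> 'a \<Rightarrow> 'b) \<Rightarrow> nat \<Rightarrow> 'a measure" where
  "history_algebra P N S n = sigma (space P) (\<Union>i\<le>n. {S i -` A \<inter> space P | A. A \<in> sets N})"

definition markov_chain ::
  "'a measure \<Rightarrow> 'b measure \<Rightarrow> ('b \<Rightarrow> 'b measure) \<Rightarrow> 'b \<Rightarrow> (nat \<Rightarrow> 'a \<Rightarrow> 'b) \<Rightarrow> bool" where
  "markov_chain P N K x0 S \<longleftrightarrow>
     prob_space P \<and> (\<forall>n. S n \<in> measurable P N) \<and> (AE \<omega> in P. S 0 \<omega> = x0) \<and>
     (\<forall>n. \<forall>A\<in>sets N. AE \<omega> in P.
        real_cond_exp P (history_algebra P N S n) (indicator (S (Suc n) -` A \<inter> space P)) \<omega>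
          = measure (K (S n \<omega>)) A)"

definition jacobi_random_walk ::
  "real \<Rightarrow> real \<Rightarrow> real measure \<Rightarrow> 'a measure \<Rightarrow> (nat \<Rightarrow> 'a \<Rightarrow> real) \<Rightarrow> bool" where
  "jacobi_random_walk \<alpha> \<beta> \<nu> P S \<longleftrightarrow>
     markov_chain P half_line (\<lambda>x. jacobi_conv \<alpha> \<beta> (return half_line x) \<nu>) 0 S"

definition jacobi_moment_fun :: "real \<Rightarrow> real \<Rightarrow> nat \<Rightarrow> real \<Rightarrow> real" where
  "jacobi_moment_fun \<alpha> \<beta> k t =
     (LINT (r, \<phi>)|jacobi_measure \<alpha> \<beta>.
        (ln (cmod (complex_of_real (cosh t)
           + complex_of_real r * exp (\<i> * complex_of_real \<phi>) * complex_of_real (sinh t)))) ^ k)"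

definition jacobi_modified_moment :: "real \<Rightarrow> real \<Rightarrow> real measure \<Rightarrow> nat \<Rightarrow> real" where
  "jacobi_modified_moment \<alpha> \<beta> \<nu> k = (LINT t|\<nu>. jacobi_moment_fun \<alpha> \<beta> k t)"

lemma space_jacobi_measure: "space (jacobi_measure \<alpha> \<beta>) = {0..1} \<times> {0..pi}"
  by (simp add: jacobi_measure_def space_pair_measure space_restrict_space)

lemma sets_jacobi_measure:
  "sets (jacobi_measure \<alpha> \<beta>) = sets (restrict_space borel {0..1} \<Otimes>\<^sub>M restrict_space borel {0..pi})"
proof -
  have eq: "sets (restrict_space lborel A) = sets (restrict_space (borel :: real measure) A)" for A
    by (simp add: sets_restrict_space)
  show ?thesis
    by (auto simp: jacobi_measure_def eq intro!: sets_pair_measure_cong)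
qed

lemma jacobi_point_map_arg_ge_1:
  assumes "0 \<le> s" "0 \<le> t" "r \<in> {0..1}"
  shows "1 \<le> cmod (complex_of_real (cosh s * cosh t)
       + complex_of_real r * exp (\<i> * complex_of_real \<phi>) * complex_of_real (sinh s * sinh t))"
    (is "1 \<le> cmod (?a + ?b)")
proof -
  have pos: "0 \<le> sinh s * sinh t" "0 \<le> cosh s * cosh t" using assms by auto
  have "cmod ?b = r * (sinh s * sinh t)"
    using assms pos by (simp add: norm_mult abs_mult)
  also have "\<dots> \<le> 1 * (sinh s * sinh t)"
    using assms pos by (intro mult_right_mono) auto
  finally have b: "cmod ?b \<le> sinh s * sinh t" by simp
  have a: "cmod ?a = cosh s * cosh t" using pos by (simp only: norm_of_real abs_of_nonneg)
  have "1 \<le> cosh (s - t)" by (rule cosh_real_ge_1)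
  also have "\<dots> = cosh s * cosh t - sinh s * sinh t" by (simp add: cosh_diff)
  also have "\<dots> \<le> cmod ?a - cmod ?b" using a b by linarith
  also have "\<dots> \<le> cmod (?a + ?b)" by (rule norm_diff_ineq)
  finally show ?thesis .
qed

lemma jacobi_point_map_measurable:
  assumes "0 \<le> s" "0 \<le> t"
  shows "jacobi_point_map s t \<in> measurable (jacobi_measure \<alpha> \<beta>) half_line"
proof (rule measurable_restrict_space2)
  show "jacobi_point_map s t \<in> space (jacobi_measure \<alpha> \<beta>) \<rightarrow> {0..}"
    using jacobi_point_map_arg_ge_1[OF assms]
    by (auto simp: space_jacobi_measure jacobi_point_map_def)
  let ?R = "restrict_space (borel :: real measure) {0..1} \<Otimes>\<^sub>M
            restrict_space (borel :: real measure) {0..pi}"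
  have [measurable]: "fst \<in> borel_measurable ?R" "snd \<in> borel_measurable ?R"
    by (rule measurable_compose[OF measurable_fst measurable_restrict_space1], simp)
       (rule measurable_compose[OF measurable_snd measurable_restrict_space1], simp)
  have "jacobi_point_map s t \<in> borel_measurable ?R"
    unfolding jacobi_point_map_def arcosh_def case_prod_beta cis_conv_exp[symmetric] cis.code Complex_eq
    by measurable
  then show "jacobi_point_map s t \<in> borel_measurable (jacobi_measure \<alpha> \<beta>)"
    by (simp add: measurable_cong_sets[OF sets_jacobi_measure refl])
qed

lemma integral_jacobi_conv_point:
  fixes f :: "real \<Rightarrow> real"
  assumes "0 \<le> s" "0 \<le> t" "continuous_on {0..} f"
  shows "(LINT x|jacobi_conv_point \<alpha> \<beta> s t. f x) =
    (LINT p|jacobi_measure \<alpha> \<beta>. f (jacobi_point_map s t p))"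
  unfolding jacobi_conv_point_def
  by (intro integral_distr jacobi_point_map_measurable assms borel_measurable_continuous_on_restrict)

end

theory Submission
  imports Defs
begin

text \<open>
  Write \<open>X(t, p) = ln |cosh t + r e^(i phi) sinh t|\<close> for a point \<open>p = (r, phi)\<close> of the half disc with law
  \<open>m\<close>. On a hyperbolic space this is the Busemann (horocyclic) coordinate of a point at distance \<open>t\<close> from
  the origin in a random direction. The theorem follows from two properties of this coordinate.

  The first is that \<open>X\<close> turns the Jacobi convolution into ordinary addition: for independent
  \<open>p\<close>, \<open>q\<close>, \<open>w\<close> with law \<open>m\<close>, the sum \<open>X(s, p) + X(t, q)\<close> has the law of \<open>X(u, p)\<close> with
  \<open>u = arcosh |cosh s cosh t + w sinh s sinh t|\<close> (lemma \<open>jacobi_char_product\<close>). All these variables are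
  bounded, so it suffices to compare the moments of \<open>exp (2 X)\<close>. These are Jacobi polynomials in
  \<open>(sinh t)^2\<close>, and the claim becomes their product formula (\<open>jacobi_poly_product\<close>), which has an
  algebraic proof: the moments of \<open>|cosh s cosh t + w sinh s sinh t|^2\<close> are Bateman's bilinear sums; these
  satisfy the hyperbolic equation \<open>L_a F = L_b F\<close> for the Jacobi operator \<open>L\<close>, in the variables
  \<open>a = (sinh s)^2\<close> and \<open>b = (sinh t)^2\<close>; and a polynomial solution is determined by its values at
  \<open>b = 0\<close>. As the Jacobi polynomial \<open>P\<close> is an eigenfunction of \<open>L\<close>, the product \<open>P(a) P(b)\<close> is a
  solution too, and it has the same values at \<open>b = 0\<close>. Consequently \<open>X(S_n, p)\<close>, with \<open>p\<close> independent of
  the walk, is distributed like a sum of \<open>n\<close> independent copies of \<open>X(T, p)\<close>, where \<open>T\<close> has law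
  \<open>\<nu>\<close>; the first two moments of \<open>X(T, p)\<close> are \<open>M1\<close> and \<open>M2\<close>.

  The second is that \<open>0 \<le> S_n - X(S_n, p) \<le> w\<close> unless \<open>r cos phi < 2 exp (- w) - 1\<close>. This exceptional
  event does not involve the walk, and its probability decays exponentially in \<open>w\<close> because
  \<open>\<alpha> > -1/2\<close>; the polynomial bound \<open>measure_cos_near_minus_one_le\<close> is enough. So \<open>S_n\<close> is a sum of independent identically distributed
  variables up to an error that is bounded in probability, and the central limit theorem follows from
  the continuity theorem for characteristic functions. The variance is positive since \<open>X(t, p)\<close> is not
  constant in \<open>p\<close> when \<open>t > 0\<close>, and \<open>M1 > 0\<close> since otherwise the normalized walk would be nonnegative,
  which contradicts the normal limit.

  For the rate, \<open>X(S_n, p)\<close> is smoothed by an independent normal variable of standard deviation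
  \<open>n^(-5/12)\<close> on the normalized scale. The third moment controls the characteristic function of the
  result, which gives the distance \<open>O(n^(-1/3))\<close> to the normal law by Fourier inversion. Smoothing and the
  defect \<open>S_n - X(S_n, p)\<close> together move the normalized variable by more than \<open>2 n^(-1/3)\<close> only with
  probability \<open>O(n^(-1/3))\<close>, so the bound carries over to the walk.
\<close>

section \<open>Jacobi polynomials and their product formula\<close>

text \<open>
  The coefficients of Bateman's sum. The factor \<open>(\<beta> + 1)_k\<close> normalizes the one for \<open>N = 0\<close> to 1; apart
  from it they are symmetric under exchanging \<open>\<alpha>\<close> with \<open>\<beta>\<close> and \<open>N\<close> with \<open>k - N\<close>.
\<close>
definition jacobi_coeff :: "real \<Rightarrow> real \<Rightarrow> nat \<Rightarrow> nat \<Rightarrow> real" where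
  "jacobi_coeff \<alpha> \<beta> k N =
     pochhammer (\<beta> + 1) k * (k choose N) / (pochhammer (\<beta> + 1) (k - N) * pochhammer (\<alpha> + 1) N)"

definition bin_poly :: "nat \<Rightarrow> nat \<Rightarrow> real poly" where
  "bin_poly M N = [:1, 1:] ^ M * [:0, 1:] ^ N"

text \<open>
  The hypergeometric operator \<open>a (1 + a) f'' + ((\<alpha> + 1) + (\<alpha> + \<beta> + 2) a) f'\<close>. In the variable
  \<open>a = (sinh t)^2\<close> it is the radial part of a Laplace operator, up to a factor 4.
\<close>
definition jacobi_op :: "real \<Rightarrow> real \<Rightarrow> real poly \<Rightarrow> real poly" where
  "jacobi_op \<alpha> \<beta> f = [:0, 1, 1:] * pderiv (pderiv f) + [:\<alpha> + 1, \<alpha> + \<beta> + 2:] * pderiv f"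

text \<open>
  The Jacobi polynomial of degree \<open>k\<close> at \<open>1 + 2 a\<close>, normalized to be 1 at \<open>a = 0\<close>.
\<close>
definition jacobi_poly :: "real \<Rightarrow> real \<Rightarrow> nat \<Rightarrow> real poly" where
  "jacobi_poly \<alpha> \<beta> k = (\<Sum>N\<le>k. smult (jacobi_coeff \<alpha> \<beta> k N) (bin_poly (k - N) N))"

text \<open>
  The generalized translate of \<open>f\<close> by \<open>b\<close> is the solution \<open>F\<close> of \<open>L_a F = L_b F\<close> with
  \<open>F(a, 0) = f(a)\<close>. The polynomial below is its coefficient of \<open>b^j\<close>: comparing the coefficients of
  \<open>b^j\<close> on both sides of the equation gives the recursion.
\<close>
primrec transl_coeff :: "real \<Rightarrow> real \<Rightarrow> real poly \<Rightarrow> nat \<Rightarrow> real poly" where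
  "transl_coeff \<alpha> \<beta> f 0 = f"
| "transl_coeff \<alpha> \<beta> f (Suc j) = smult (1 / ((real j + 1) * (real j + \<alpha> + 1)))
     (jacobi_op \<alpha> \<beta> (transl_coeff \<alpha> \<beta> f j)
        - smult (real j * (real j + \<alpha> + \<beta> + 1)) (transl_coeff \<alpha> \<beta> f j))"

lemma jacobi_op_linear:
  "jacobi_op \<alpha> \<beta> (f + g) = jacobi_op \<alpha> \<beta> f + jacobi_op \<alpha> \<beta> g"
  "jacobi_op \<alpha> \<beta> (smult c f) = smult c (jacobi_op \<alpha> \<beta> f)"
  "jacobi_op \<alpha> \<beta> 0 = 0"
  by (simp_all add: jacobi_op_def pderiv_add pderiv_smult algebra_simps smult_add_right)

lemma jacobi_op_sum: "jacobi_op \<alpha> \<beta> (\<Sum>i\<in>I. f i) = (\<Sum>i\<in>I. jacobi_op \<alpha> \<beta> (f i))"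
  by (induction I rule: infinite_finite_induct) (simp_all add: jacobi_op_linear)

text \<open>
  The factor in front of coefficient \<open>j + 1\<close> does not vanish for \<open>\<alpha> > -1\<close>. This is what makes a
  solution of \<open>L_a F = L_b F\<close> computable from \<open>F(a, 0)\<close>.
\<close>
lemma coeff_jacobi_op:
  "coeff (jacobi_op \<alpha> \<beta> g) j =
     (real j + 1) * (real j + \<alpha> + 1) * coeff g (Suc j) + real j * (real j + \<alpha> + \<beta> + 1) * coeff g j"
proof -
  have 1: "[:0, 1, 1:] * pderiv (pderiv g) =
     pCons 0 (pderiv (pderiv g)) + pCons 0 (pCons 0 (pderiv (pderiv g)))"
    by (simp add: mult_pCons_left)
  have 2: "[:\<alpha> + 1, \<alpha> + \<beta> + 2:] * pderiv g =
     smult (\<alpha> + 1) (pderiv g) + pCons 0 (smult (\<alpha> + \<beta> + 2) (pderiv g))"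
    by (simp add: mult_pCons_left)
  show ?thesis
    unfolding jacobi_op_def 1 2
    by (cases j; cases "j - 1") (auto simp: coeff_pCons coeff_pderiv algebra_simps)
qed

lemma transl_coeff_add:
  "transl_coeff \<alpha> \<beta> (f + g) j = transl_coeff \<alpha> \<beta> f j + transl_coeff \<alpha> \<beta> g j"
proof (induction j)
  case (Suc j)
  show ?case
    unfolding transl_coeff.simps Suc jacobi_op_linear
    by (simp add: algebra_simps smult_add_right smult_diff_right)
qed simp

lemma transl_coeff_smult:
  "transl_coeff \<alpha> \<beta> (smult c f) j = smult c (transl_coeff \<alpha> \<beta> f j)"
proof (induction j)
  case (Suc j)
  show ?case
    unfolding transl_coeff.simps Suc jacobi_op_linear
    by (simp add: smult_diff_right mult_ac)
qed simp

lemma transl_coeff_sum: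
  "transl_coeff \<alpha> \<beta> (\<Sum>i\<in>I. f i) j = (\<Sum>i\<in>I. transl_coeff \<alpha> \<beta> (f i) j)"
proof -
  have "transl_coeff \<alpha> \<beta> 0 j = 0"
    using transl_coeff_smult[of \<alpha> \<beta> 0 0] by simp
  then show ?thesis
    by (induction I rule: infinite_finite_induct) (simp_all add: transl_coeff_add)
qed

lemma transl_coeff_unique:
  assumes "\<alpha> > -1" and "H 0 = f"
    and rec: "\<And>j. jacobi_op \<alpha> \<beta> (H j) =
      smult ((real j + 1) * (real j + \<alpha> + 1)) (H (Suc j)) + smult (real j * (real j + \<alpha> + \<beta> + 1)) (H j)"
  shows "H j = transl_coeff \<alpha> \<beta> f j"
proof (induction j)
  case (Suc j)
  have "(real j + 1) * (real j + \<alpha> + 1) \<noteq> 0"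
    using assms(1) by simp
  then show ?case
    unfolding transl_coeff.simps Suc[symmetric] rec by simp
qed (simp add: assms)

lemma pderiv_bin_poly:
  "pderiv (bin_poly M N) = smult (real M) (bin_poly (M - 1) N) + smult (real N) (bin_poly M (N - 1))"
proof -
  have *: "pderiv ([:c, 1:] ^ M) = smult (real M) ([:c, 1:] ^ (M - 1))" for M and c :: real
    by (simp add: pderiv_power pderiv_pCons)
  show ?thesis
    unfolding bin_poly_def pderiv_mult * by (simp add: algebra_simps)
qed

text \<open>
  Up to multiples of itself, \<open>(1 + a)^M a^N\<close> is mapped by \<open>L\<close> to its two neighbours of the same total
  degree. In \<open>L_a F - L_b F\<close> the multiples of itself cancel, and the neighbour terms telescope.
\<close>
lemma jacobi_op_bin_poly:
  "jacobi_op \<alpha> \<beta> (bin_poly M N) =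
     smult (real M * (real M + \<beta>)) (bin_poly (M - 1) (Suc N))
   + smult (real N * (real N + \<alpha>)) (bin_poly (Suc M) (N - 1))
   + smult (2 * real M * real N + (\<alpha> + 1) * real M + (\<beta> + 1) * real N) (bin_poly M N)"
proof -
  have X: "[:0, 1:] * bin_poly M N = bin_poly M (Suc N)"
    and Y: "[:1, 1:] * bin_poly M N = bin_poly (Suc M) N" for M N
    by (simp_all add: bin_poly_def algebra_simps)
  have 1: "[:0, 1, 1:] * p = [:0, 1:] * ([:1, 1:] * p)" for p :: "real poly"
    by (simp add: mult.assoc[symmetric])
  have 2: "[:\<alpha> + 1, \<alpha> + \<beta> + 2:] * p = smult (\<alpha> + 1) ([:1, 1:] * p) + smult (\<beta> + 1) ([:0, 1:] * p)" for p
  proof -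
    have "[:\<alpha> + 1, \<alpha> + \<beta> + 2:] = smult (\<alpha> + 1) [:1, 1:] + smult (\<beta> + 1) [:0, 1:]"
      by simp
    then show ?thesis
      by (simp only: distrib_right mult_smult_left)
  qed
  have M2: "smult (real M * real (M - 1)) (bin_poly (Suc (M - 1 - 1)) (Suc N))
      = smult (real M * (real M - 1)) (bin_poly (M - 1) (Suc N))"
    by (cases M; cases "M - 1") simp_all
  have N2: "smult (real N * real (N - 1)) (bin_poly (Suc M) (Suc (N - 1 - 1)))
      = smult (real N * (real N - 1)) (bin_poly (Suc M) (N - 1))"
    by (cases N; cases "N - 1") simp_all
  have MN: "smult (real M * real N) (bin_poly (Suc (M - 1)) (Suc (N - 1)))
      = smult (real M * real N) (bin_poly M N)"
    by (cases M; cases N) simp_all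
  have M1: "smult (c * real M) (bin_poly (Suc (M - 1)) N) = smult (c * real M) (bin_poly M N)"
    and N1: "smult (c * real N) (bin_poly M (Suc (N - 1))) = smult (c * real N) (bin_poly M N)" for c
    by (cases M; simp) (cases N; simp)
  show ?thesis
    unfolding jacobi_op_def 1 2 pderiv_bin_poly pderiv_add pderiv_smult
    apply (simp only: distrib_left mult_smult_right smult_smult smult_add_right X Y
        M2 N2 M1 N1 MN mult.commute[of "real N" "real M"])
    apply (rule poly_eqI)
    apply (simp only: coeff_add coeff_smult)
    apply (simp add: algebra_simps)
    done
qed

lemma coeff_bin_poly_top: "coeff (bin_poly M N) (M + N) = 1"
  and degree_bin_poly: "degree (bin_poly M N) = M + N"
proof -
  have d: "degree ([:c, 1:] ^ M) = M" for M and c :: real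
    by (simp add: degree_power_eq)
  have l: "coeff ([:c, 1:] ^ M) M = 1" for M and c :: real
    using lead_coeff_power[of "[:c, 1:]" M] unfolding d by simp
  show "coeff (bin_poly M N) (M + N) = 1"
    using coeff_mult_degree_sum[of "[:1, 1:] ^ M" "[:0, 1 :: real:] ^ N"]
    unfolding d bin_poly_def l by simp
  show "degree (bin_poly M N) = M + N"
    unfolding bin_poly_def by (subst degree_mult_eq) (auto simp: d)
qed

lemma coeff_bin_poly_0: "coeff (bin_poly M N) 0 = (if N = 0 then 1 else 0)"
  by (cases N) (simp_all add: bin_poly_def coeff_mult_0 coeff_0_power del: power_Suc)

lemma poly_bin_poly: "poly (bin_poly M N) a = (1 + a) ^ M * a ^ N"
  by (simp add: bin_poly_def)

lemma jacobi_coeff_Suc: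
  assumes "\<alpha> > -1" "\<beta> > -1" "N < k"
  shows "jacobi_coeff \<alpha> \<beta> k (Suc N) * (real (Suc N) * (real (Suc N) + \<alpha>)) =
         jacobi_coeff \<alpha> \<beta> k N * (real (k - N) * (real (k - N) + \<beta>))"
proof -
  define M where "M = k - Suc N"
  have k: "k = Suc (M + N)" using assms by (simp add: M_def)
  have pos: "pochhammer (\<beta> + 1) j > 0" "pochhammer (\<alpha> + 1) j > 0" for j
    using assms by (auto intro!: pochhammer_pos)
  have "real (Suc N) * real (k choose Suc N) = real (Suc M) * real (k choose N)"
  proof -
    have "Suc N * (k choose Suc N) = (k - N) * (k choose N)"
      using binomial_absorb_comp[of k N] binomial_absorption[of N k] by simp
    then have "real (Suc N) * real (k choose Suc N) = real (k - N) * real (k choose N)"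
      by (metis of_nat_mult)
    then show ?thesis
      by (simp add: k Suc_diff_le)
  qed
  note binom = this
  have gen: "P * A / (p * (q * s)) * (n * s) = P * B / ((p * t) * q) * (m * t)"
    if "s > 0" "t > 0" "n * A = m * B" for P A B p q s t n m :: real
  proof -
    have "P * A / (p * (q * s)) * (n * s) = P * (n * A) / (p * q)"
      using that(1) by (simp add: divide_simps mult_ac)
    also have "\<dots> = P * B / ((p * t) * q) * (m * t)"
      unfolding that(3) using that(2) by (simp add: divide_simps mult_ac)
    finally show ?thesis .
  qed
  have "k - N = Suc M" by (simp add: k)
  moreover have "\<beta> + 1 + real M > 0" "\<alpha> + 1 + real N > 0" using assms by auto
  moreover have "real (Suc N) + \<alpha> = \<alpha> + 1 + real N" "real (Suc M) + \<beta> = \<beta> + 1 + real M" by simp_all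
  ultimately show ?thesis
    unfolding jacobi_coeff_def M_def[symmetric] pochhammer_Suc
    using gen[OF _ _ binom] by (simp only: pochhammer_Suc)
qed

text \<open>
  Bateman's sum is the generalized translate of \<open>(1 + a)^k\<close>. Its terms are
  \<open>(1 + a)^(k-N) a^N (1 + b)^(k-N) b^N\<close>, and the ratio of consecutive coefficients is exactly
  the one for which the neighbour terms in \<open>L_a F - L_b F\<close> form a telescoping sum.
\<close>
lemma transl_coeff_power:
  assumes "\<alpha> > -1" "\<beta> > -1"
  shows "transl_coeff \<alpha> \<beta> ([:1, 1:] ^ k) j =
    (\<Sum>N\<le>k. smult (jacobi_coeff \<alpha> \<beta> k N * coeff (bin_poly (k - N) N) j) (bin_poly (k - N) N))"
proof -
  define g where "g N = bin_poly (k - N) N" for N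
  define c where "c N = jacobi_coeff \<alpha> \<beta> k N" for N
  define H where "H j = (\<Sum>N\<le>k. smult (c N * coeff (g N) j) (g N))" for j
  have pos: "pochhammer (\<beta> + 1) k > 0" using assms by (auto intro!: pochhammer_pos)
  have "H 0 = (\<Sum>N\<in>{0}. smult (c N * coeff (g N) 0) (g N))"
    unfolding H_def by (rule sum.mono_neutral_right) (auto simp: g_def coeff_bin_poly_0)
  also have "\<dots> = [:1, 1:] ^ k"
    using pos by (simp add: g_def c_def coeff_bin_poly_0 jacobi_coeff_def) (simp add: bin_poly_def)
  finally have H0: "H 0 = [:1, 1:] ^ k" .
  \<comment> \<open>The contribution of the pair of neighbours N and N + 1.\<close>
  define T where "T j N = smult (c N * (real (k - N) * (real (k - N) + \<beta>)))
      (smult (coeff (g N) j) (g (Suc N)) - smult (coeff (g (Suc N)) j) (g N))" for j N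
  have step: "smult (c N) (smult (coeff (g N) j) (jacobi_op \<alpha> \<beta> (g N))
      - smult (coeff (jacobi_op \<alpha> \<beta> (g N)) j) (g N))
     = T j N - (if N = 0 then 0 else T j (N - 1))" if "N \<le> k" for j N
  proof -
    have 1: "smult (real (k - N) * r) (bin_poly (k - N - 1) (Suc N)) = smult (real (k - N) * r) (g (Suc N))" for r
      by (simp add: g_def)
    define d where "d = 2 * real (k - N) * real N + (\<alpha> + 1) * real (k - N) + (\<beta> + 1) * real N"
    have op: "jacobi_op \<alpha> \<beta> (g N) = smult (real (k - N) * (real (k - N) + \<beta>)) (g (Suc N))
       + smult (real N * (real N + \<alpha>)) (g (N - 1)) + smult d (g N)"
    proof -
      have 2: "smult (real N * r) (bin_poly (Suc (k - N)) (N - 1)) = smult (real N * r) (g (N - 1))" for r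
        using that by (cases N) (simp_all add: g_def Suc_diff_Suc)
      show ?thesis
        unfolding g_def[of N] jacobi_op_bin_poly 1 2 d_def ..
    qed
    show ?thesis
    proof (cases N)
      case 0
      then show ?thesis
        unfolding op T_def by (intro poly_eqI) (simp add: algebra_simps)
    next
      case (Suc n)
      have "c N * (real N * (real N + \<alpha>)) = c n * (real (k - n) * (real (k - n) + \<beta>))"
        using jacobi_coeff_Suc[OF assms, of n k] that Suc by (simp add: c_def)
      then have "T j (N - 1) = smult (c N * (real N * (real N + \<alpha>)))
          (smult (coeff (g (N - 1)) j) (g N) - smult (coeff (g N) j) (g (N - 1)))"
        unfolding T_def using Suc by simp
      then show ?thesis
        using Suc unfolding op T_def[of j N] by (intro poly_eqI) (simp add: algebra_simps)
    qed
  qed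
  have "(\<Sum>N\<le>n. T j N - (if N = 0 then 0 else T j (N - 1))) = T j n" for n j
    by (induction n) simp_all
  from this[of _ k] have zero: "(\<Sum>N\<le>k. smult (c N) (smult (coeff (g N) j) (jacobi_op \<alpha> \<beta> (g N))
      - smult (coeff (jacobi_op \<alpha> \<beta> (g N)) j) (g N))) = 0" for j
    using step by (simp add: T_def)
  have rec: "jacobi_op \<alpha> \<beta> (H j) =
      smult ((real j + 1) * (real j + \<alpha> + 1)) (H (Suc j)) + smult (real j * (real j + \<alpha> + \<beta> + 1)) (H j)" for j
  proof -
    have "jacobi_op \<alpha> \<beta> (H j) = (\<Sum>N\<le>k. smult (c N) (smult (coeff (g N) j) (jacobi_op \<alpha> \<beta> (g N))))"
      by (simp add: H_def jacobi_op_sum jacobi_op_linear)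
    also have "\<dots> = (\<Sum>N\<le>k. smult (c N) (smult (coeff (jacobi_op \<alpha> \<beta> (g N)) j) (g N)))"
      using zero[of j] by (simp add: smult_diff_right sum_subtractf)
    also have "\<dots> = smult ((real j + 1) * (real j + \<alpha> + 1)) (H (Suc j)) + smult (real j * (real j + \<alpha> + \<beta> + 1)) (H j)"
      unfolding coeff_jacobi_op H_def
      by (intro poly_eqI) (simp add: coeff_sum sum_distrib_left sum.distrib[symmetric] algebra_simps)
    finally show ?thesis .
  qed
  have "H j = transl_coeff \<alpha> \<beta> ([:1, 1:] ^ k) j"
    by (rule transl_coeff_unique[OF assms(1) H0 rec])
  then show ?thesis by (simp add: H_def c_def g_def)
qed

text \<open>
  Bateman's sum has degree \<open>k\<close> in \<open>b\<close>, and its leading coefficient is the Jacobi polynomial. In the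
  coefficient of \<open>b^k\<close> the equation \<open>L_a F = L_b F\<close> is therefore the eigenvalue equation.
\<close>
lemma jacobi_op_jacobi_poly:
  assumes "\<alpha> > -1" "\<beta> > -1"
  shows "jacobi_op \<alpha> \<beta> (jacobi_poly \<alpha> \<beta> k) = smult (real k * (real k + \<alpha> + \<beta> + 1)) (jacobi_poly \<alpha> \<beta> k)"
proof -
  let ?t = "transl_coeff \<alpha> \<beta> ([:1, 1:] ^ k)"
  have "?t k = jacobi_poly \<alpha> \<beta> k"
    unfolding transl_coeff_power[OF assms] jacobi_poly_def
  proof (intro sum.cong refl)
    fix N assume "N \<in> {..k}"
    then have "coeff (bin_poly (k - N) N) k = 1"
      using coeff_bin_poly_top[of "k - N" N] by simp
    then show "smult (jacobi_coeff \<alpha> \<beta> k N * coeff (bin_poly (k - N) N) k) (bin_poly (k - N) N) =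
        smult (jacobi_coeff \<alpha> \<beta> k N) (bin_poly (k - N) N)" by simp
  qed
  moreover have "?t (Suc k) = 0"
    unfolding transl_coeff_power[OF assms]
    by (intro sum.neutral ballI) (simp add: coeff_eq_0 degree_bin_poly)
  moreover have "(real k + 1) * (real k + \<alpha> + 1) \<noteq> 0" using assms by auto
  ultimately show ?thesis by auto
qed

text \<open>
  By the eigenvalue equation \<open>P(a) P(b)\<close> solves \<open>L_a F = L_b F\<close>, and \<open>P(0) = 1\<close>, so it is the
  generalized translate of \<open>P\<close>.
\<close>
lemma transl_coeff_jacobi_poly:
  assumes "\<alpha> > -1" "\<beta> > -1"
  shows "transl_coeff \<alpha> \<beta> (jacobi_poly \<alpha> \<beta> k) j =
    smult (coeff (jacobi_poly \<alpha> \<beta> k) j) (jacobi_poly \<alpha> \<beta> k)"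
proof -
  let ?p = "jacobi_poly \<alpha> \<beta> k"
  have pos: "pochhammer (\<beta> + 1) k > 0" using assms by (auto intro!: pochhammer_pos)
  have "coeff ?p 0 = (\<Sum>N\<in>{0}. jacobi_coeff \<alpha> \<beta> k N * coeff (bin_poly (k - N) N) 0)"
    unfolding jacobi_poly_def coeff_sum coeff_smult
    by (rule sum.mono_neutral_right) (auto simp: coeff_bin_poly_0)
  also have "\<dots> = 1" using pos by (simp add: coeff_bin_poly_0 jacobi_coeff_def)
  finally have c0: "coeff ?p 0 = 1" .
  have *: "real k * (real k + \<alpha> + \<beta> + 1) * coeff ?p j =
     (real j + 1) * (real j + \<alpha> + 1) * coeff ?p (Suc j) + real j * (real j + \<alpha> + \<beta> + 1) * coeff ?p j" for j
    using coeff_jacobi_op[of \<alpha> \<beta> ?p j] unfolding jacobi_op_jacobi_poly[OF assms] by simp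
  show ?thesis
  proof (rule transl_coeff_unique[OF assms(1), symmetric])
    show "smult (coeff ?p 0) ?p = ?p" by (simp add: c0)
    show "jacobi_op \<alpha> \<beta> (smult (coeff ?p j) ?p) =
       smult ((real j + 1) * (real j + \<alpha> + 1)) (smult (coeff ?p (Suc j)) ?p) +
       smult (real j * (real j + \<alpha> + \<beta> + 1)) (smult (coeff ?p j) ?p)" for j
      unfolding jacobi_op_linear jacobi_op_jacobi_poly[OF assms] smult_smult smult_add_left[symmetric]
      using *[of j] by (simp add: mult_ac)
  qed
qed

text \<open>
  The homogeneous form of Bateman's sum: \<open>x = (1 + a) (1 + b)\<close>, \<open>z = a b\<close> gives the translate of
  \<open>(1 + a)^k\<close>, and \<open>x = 1 + a\<close>, \<open>z = a\<close> gives the Jacobi polynomial.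
\<close>
definition bateman :: "real \<Rightarrow> real \<Rightarrow> nat \<Rightarrow> real \<Rightarrow> real \<Rightarrow> real" where
  "bateman \<alpha> \<beta> k x z = (\<Sum>N\<le>k. jacobi_coeff \<alpha> \<beta> k N * x ^ (k - N) * z ^ N)"

lemma poly_jacobi_poly: "poly (jacobi_poly \<alpha> \<beta> k) a = bateman \<alpha> \<beta> k (1 + a) a"
  by (simp add: jacobi_poly_def bateman_def poly_sum poly_bin_poly mult_ac)

lemma poly_eq_sum_le: "degree p \<le> n \<Longrightarrow> poly p x = (\<Sum>i\<le>n. coeff p i * x ^ i)"
  for p :: "real poly"
  unfolding poly_altdef by (rule sum.mono_neutral_left) (auto simp: coeff_eq_0)

lemma bateman_transl:
  assumes "\<alpha> > -1" "\<beta> > -1" "k \<le> n"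
  shows "bateman \<alpha> \<beta> k ((1 + a) * (1 + b)) (a * b) =
    (\<Sum>j\<le>n. b ^ j * poly (transl_coeff \<alpha> \<beta> ([:1, 1:] ^ k) j) a)"
proof -
  have "(\<Sum>j\<le>n. b ^ j * poly (transl_coeff \<alpha> \<beta> ([:1, 1:] ^ k) j) a) =
    (\<Sum>j\<le>n. \<Sum>N\<le>k. jacobi_coeff \<alpha> \<beta> k N * (coeff (bin_poly (k - N) N) j * b ^ j) * poly (bin_poly (k - N) N) a)"
    by (simp add: transl_coeff_power[OF assms(1,2)] poly_sum sum_distrib_left mult_ac)
  also have "\<dots> = (\<Sum>N\<le>k. jacobi_coeff \<alpha> \<beta> k N * (\<Sum>j\<le>n. coeff (bin_poly (k - N) N) j * b ^ j) * poly (bin_poly (k - N) N) a)"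
    by (subst sum.swap) (simp add: sum_distrib_left sum_distrib_right)
  also have "\<dots> = (\<Sum>N\<le>k. jacobi_coeff \<alpha> \<beta> k N * poly (bin_poly (k - N) N) b * poly (bin_poly (k - N) N) a)"
    using assms(3) by (intro sum.cong refl) (simp add: poly_eq_sum_le[symmetric] degree_bin_poly)
  also have "\<dots> = bateman \<alpha> \<beta> k ((1 + a) * (1 + b)) (a * b)"
    by (simp add: bateman_def poly_bin_poly power_mult_distrib mult_ac)
  finally show ?thesis ..
qed

text \<open>
  If \<open>P(q - 1)\<close> is the sum of \<open>d_i q^i\<close>, then by linearity of the translation \<open>P(a) P(b)\<close> is the same
  combination of the translates of \<open>(1 + a)^i\<close>. In this form the formula can be compared with
  expectations of powers.
\<close>
lemma jacobi_poly_product: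
  assumes "\<alpha> > -1" "\<beta> > -1"
  obtains d n where
    "\<And>q. bateman \<alpha> \<beta> k q (q - 1) = (\<Sum>i\<le>n. d i * q ^ i)"
    "\<And>a b. bateman \<alpha> \<beta> k (1 + a) a * bateman \<alpha> \<beta> k (1 + b) b =
       (\<Sum>i\<le>n. d i * bateman \<alpha> \<beta> i ((1 + a) * (1 + b)) (a * b))"
proof -
  define p where "p = jacobi_poly \<alpha> \<beta> k"
  define r where "r = pcompose p [:-1, 1:]"
  define n where "n = max (degree p) (degree r)"
  have r: "poly r q = (\<Sum>i\<le>n. coeff r i * q ^ i)" for q
    by (rule poly_eq_sum_le) (simp add: n_def)
  have 1: "bateman \<alpha> \<beta> k q (q - 1) = (\<Sum>i\<le>n. coeff r i * q ^ i)" for q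
    unfolding r[symmetric] using poly_jacobi_poly[of \<alpha> \<beta> k "q - 1"]
    by (simp add: r_def poly_pcompose p_def algebra_simps)
  have "poly p a = poly (\<Sum>i\<le>n. smult (coeff r i) ([:1, 1:] ^ i)) a" for a
    using r[of "1 + a"] by (simp add: r_def poly_pcompose poly_sum poly_power)
  then have p: "p = (\<Sum>i\<le>n. smult (coeff r i) ([:1, 1:] ^ i))"
    by (intro poly_eq_poly_eq_iff[THEN iffD1] ext)
  have 2: "bateman \<alpha> \<beta> k (1 + a) a * bateman \<alpha> \<beta> k (1 + b) b =
       (\<Sum>i\<le>n. coeff r i * bateman \<alpha> \<beta> i ((1 + a) * (1 + b)) (a * b))" for a b
  proof -
    have "bateman \<alpha> \<beta> k (1 + a) a * bateman \<alpha> \<beta> k (1 + b) b = poly p a * poly p b"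
      by (simp add: p_def poly_jacobi_poly)
    also have "poly p b = (\<Sum>j\<le>n. coeff p j * b ^ j)"
      by (rule poly_eq_sum_le) (simp add: n_def)
    also have "poly p a * \<dots> = (\<Sum>j\<le>n. b ^ j * poly (smult (coeff p j) p) a)"
      by (simp add: sum_distrib_left mult_ac)
    also have "\<dots> = (\<Sum>j\<le>n. b ^ j * poly (transl_coeff \<alpha> \<beta> p j) a)"
      unfolding p_def transl_coeff_jacobi_poly[OF assms] ..
    also have "\<dots> = (\<Sum>j\<le>n. \<Sum>i\<le>n. coeff r i * (b ^ j * poly (transl_coeff \<alpha> \<beta> ([:1, 1:] ^ i) j) a))"
      by (subst p) (simp add: transl_coeff_sum transl_coeff_smult poly_sum sum_distrib_left mult_ac)
    also have "\<dots> = (\<Sum>i\<le>n. coeff r i * bateman \<alpha> \<beta> i ((1 + a) * (1 + b)) (a * b))"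
      by (subst sum.swap) (simp add: bateman_transl[OF assms] sum_distrib_left)
    finally show ?thesis .
  qed
  show thesis using that[OF 1 2] .
qed


section \<open>Moments of the disc measure\<close>
lemma Beta_real_pos: "a > 0 \<Longrightarrow> b > 0 \<Longrightarrow> Beta a b > (0 :: real)"
  by (simp add: Beta_def Gamma_real_pos)

lemma Beta_ratio_pochhammer:
  fixes p q :: real
  assumes "p > 0" "q > 0"
  shows "Beta (p + real N) q / Beta p q = pochhammer p N / pochhammer (p + q) N"
proof -
  have n: "p \<notin> \<int>\<^sub>\<le>\<^sub>0" "p + q \<notin> \<int>\<^sub>\<le>\<^sub>0"
    using assms by (auto elim!: nonpos_Ints_cases)
  have pos: "Gamma p > 0" "Gamma q > 0" "Gamma (p + q) > 0" "Gamma (p + q + real N) > 0"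
    using assms by (auto intro!: Gamma_real_pos)
  show ?thesis
    unfolding pochhammer_Gamma[OF n(1)] pochhammer_Gamma[OF n(2)] Beta_def
    using pos by (simp add: field_simps add_ac)
qed

text \<open>
  The Beta integral after the substitution of the square of the variable; both the radial and the
  angular part of the disc measure reduce to it.
\<close>
lemma nn_integral_Beta_square:
  fixes p q :: real
  assumes "p > 0" "q > 0"
  shows "(\<integral>\<^sup>+x. ennreal (2 * x powr (2 * p - 1) * (1 - x\<^sup>2) powr (q - 1)) * indicator {0..1} x \<partial>lborel)
    = ennreal (Beta p q)"
proof -
  have "((\<lambda>t. t powr (p - 1) * (1 - t) powr (q - 1)) has_integral Beta p q) {0..1}"
    using has_integral_Beta_real[OF assms] .
  from nn_integral_has_integral_lebesgue[OF _ this] have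
     "ennreal (Beta p q) = (\<integral>\<^sup>+t. ennreal (t powr (p - 1) * (1 - t) powr (q - 1) * indicator {0^2..1^2} t) \<partial>lborel)"
    by (simp add: mult_ac ennreal_mult' ennreal_indicator)
  also have "\<dots> = (\<integral>\<^sup>+x. ennreal ((x\<^sup>2) powr (p - 1) * (1 - x\<^sup>2) powr (q - 1) * (2 * x) * indicator {0..1} x) \<partial>lborel)"
    by (subst nn_integral_substitution[where g = "\<lambda>x. x ^ 2" and g' = "\<lambda>x. 2 * x"])
       (auto intro!: derivative_eq_intros continuous_intros simp: set_borel_measurable_def)
  also have "\<dots> = (\<integral>\<^sup>+x. ennreal (2 * x powr (2 * p - 1) * (1 - x\<^sup>2) powr (q - 1)) * indicator {0..1} x \<partial>lborel)"
  proof (intro nn_integral_cong)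
    fix x :: real
    have "(x\<^sup>2) powr (p - 1) * x = x powr (2 * p - 1)" if "0 \<le> x"
    proof (cases "x = 0")
      case False
      then have "x > 0" using that by simp
      then have "(x\<^sup>2) powr (p - 1) * x = x powr (2 * (p - 1)) * x powr 1"
        by (simp add: powr_powr powr_numeral[symmetric] del: powr_numeral)
      also have "\<dots> = x powr (2 * (p - 1) + 1)"
        by (rule powr_add[symmetric])
      finally show ?thesis by (simp add: algebra_simps)
    qed simp
    then show "ennreal ((x\<^sup>2) powr (p - 1) * (1 - x\<^sup>2) powr (q - 1) * (2 * x) * indicator {0..1} x) =
      ennreal (2 * x powr (2 * p - 1) * (1 - x\<^sup>2) powr (q - 1)) * indicator {0..1} x"
      by (auto simp: indicator_def mult_ac)
  qed
  finally show ?thesis ..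
qed

lemma nn_integral_even_power_Beta_square:
  fixes p q :: real
  assumes "p > 0" "q > 0"
  shows "(\<integral>\<^sup>+x. ennreal (x ^ (2 * N) * (2 * x powr (2 * p - 1) * (1 - x\<^sup>2) powr (q - 1))) * indicator {0..1} x \<partial>lborel)
    = ennreal (Beta (p + real N) q)"
  unfolding nn_integral_Beta_square[of "p + real N" q, symmetric, OF add_pos_nonneg[OF assms(1) of_nat_0_le_iff] assms(2)]
proof (intro nn_integral_cong)
  fix x :: real
  have "x ^ (2 * N) * x powr (2 * p - 1) = x powr (2 * (p + real N) - 1)" if "0 \<le> x"
  proof (cases "x = 0")
    case False
    then have "x > 0" using that by simp
    then have "x ^ (2 * N) * x powr (2 * p - 1) = x powr (real (2 * N)) * x powr (2 * p - 1)"
      by (simp only: powr_realpow)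
    also have "\<dots> = x powr (real (2 * N) + (2 * p - 1))"
      by (rule powr_add[symmetric])
    finally show ?thesis by (simp add: algebra_simps)
  qed simp
  then show "ennreal (x ^ (2 * N) * (2 * x powr (2 * p - 1) * (1 - x\<^sup>2) powr (q - 1))) * indicator {0..1} x =
    ennreal (2 * x powr (2 * (p + real N) - 1) * (1 - x\<^sup>2) powr (q - 1)) * indicator {0..1} x"
    by (auto simp: indicator_def mult_ac)
qed

lemma prob_space_density_restrict_moments:
  fixes h g :: "real \<Rightarrow> real" and c :: "nat \<Rightarrow> real"
  assumes [measurable]: "h \<in> borel_measurable borel" "g \<in> borel_measurable borel"
    and h: "\<And>x. x \<in> {a..b} \<Longrightarrow> 0 \<le> h x"
    and nn: "\<And>N. (\<integral>\<^sup>+x. ennreal (g x ^ (2 * N) * h x) * indicator {a..b} x \<partial>lborel) = ennreal (c N)"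
    and c: "\<And>N. 0 \<le> c N" and c0: "c 0 = 1"
  defines "D \<equiv> density (restrict_space lborel {a..b}) (\<lambda>x. ennreal (h x))"
  shows "prob_space D" "(LINT x|D. g x ^ (2 * N)) = c N"
proof -
  have [measurable]: "h \<in> borel_measurable (restrict_space lborel {a..b})"
    "g \<in> borel_measurable (restrict_space lborel {a..b})"
    by (intro measurable_restrict_space1; simp)+
  have nnD: "(\<integral>\<^sup>+x. ennreal (g x ^ (2 * N)) \<partial>D) = ennreal (c N)" for N
  proof -
    have "(\<integral>\<^sup>+x. ennreal (g x ^ (2 * N)) \<partial>D) =
       (\<integral>\<^sup>+x. ennreal (h x) * ennreal (g x ^ (2 * N)) \<partial>restrict_space lborel {a..b})"
      unfolding D_def by (rule nn_integral_density) measurable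
    also have "\<dots> = (\<integral>\<^sup>+x. ennreal (h x) * ennreal (g x ^ (2 * N)) * indicator {a..b} x \<partial>lborel)"
      by (subst nn_integral_restrict_space) auto
    also have "\<dots> = (\<integral>\<^sup>+x. ennreal (g x ^ (2 * N) * h x) * indicator {a..b} x \<partial>lborel)"
      using h by (intro nn_integral_cong) (auto simp: indicator_def ennreal_mult' mult_ac)
    finally show ?thesis using nn by simp
  qed
  show "prob_space D"
    using nnD[of 0] by (intro prob_spaceI) (simp add: c0)
  have gD: "g \<in> borel_measurable D" unfolding D_def by simp
  show "(LINT x|D. g x ^ (2 * N)) = c N"
  proof -
    have "has_bochner_integral D (\<lambda>x. g x ^ (2 * N)) (c N)"
    proof (rule has_bochner_integral_nn_integral)
      show "(\<lambda>x. g x ^ (2 * N)) \<in> borel_measurable D" by (rule borel_measurable_power[OF gD])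
      show "AE x in D. 0 \<le> g x ^ (2 * N)" by (intro AE_I2) simp
    qed (use c nnD in auto)
    then show ?thesis by (rule has_bochner_integral_integral_eq)
  qed
qed

lemma radial_density_moments:
  fixes p q :: real
  assumes "p > 0" "q > 0"
  defines "D \<equiv> density (restrict_space lborel {0..1})
    (\<lambda>x. ennreal (2 / Beta p q * (x powr (2 * p - 1) * (1 - x\<^sup>2) powr (q - 1))))"
  shows "prob_space D" "(LINT x|D. x ^ (2 * N)) = pochhammer p N / pochhammer (p + q) N"
proof -
  have B: "Beta p q > 0" using assms by (simp add: Beta_real_pos)
  have "(\<integral>\<^sup>+x. ennreal (x ^ (2 * N) * (2 / Beta p q * (x powr (2 * p - 1) * (1 - x\<^sup>2) powr (q - 1)))) * indicator {0..1} x \<partial>lborel)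
     = ennreal (pochhammer p N / pochhammer (p + q) N)" for N
  proof -
    have "(\<integral>\<^sup>+x. ennreal (x ^ (2 * N) * (2 / Beta p q * (x powr (2 * p - 1) * (1 - x\<^sup>2) powr (q - 1)))) * indicator {0..1} x \<partial>lborel)
      = (\<integral>\<^sup>+x. ennreal (1 / Beta p q) * (ennreal (x ^ (2 * N) * (2 * x powr (2 * p - 1) * (1 - x\<^sup>2) powr (q - 1))) * indicator {0..1} x) \<partial>lborel)"
      using B by (intro nn_integral_cong) (auto simp: indicator_def ennreal_mult'[symmetric] mult_ac)
    also have "\<dots> = ennreal (1 / Beta p q) * ennreal (Beta (p + real N) q)"
      by (subst nn_integral_cmult) (auto simp: nn_integral_even_power_Beta_square[OF assms(1,2)])
    also have "\<dots> = ennreal (Beta (p + real N) q / Beta p q)"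
      using B by (simp add: ennreal_mult'[symmetric])
    finally show ?thesis by (simp add: Beta_ratio_pochhammer[OF assms(1,2)])
  qed
  note * = prob_space_density_restrict_moments[where g = "\<lambda>x. x" and h = "\<lambda>x. 2 / Beta p q * (x powr (2 * p - 1) * (1 - x\<^sup>2) powr (q - 1))" and a = 0 and b = 1, OF _ _ _ this]
  have pos: "0 \<le> pochhammer p N / pochhammer (p + q) N" for N
    using assms by (intro divide_nonneg_nonneg pochhammer_nonneg) auto
  show "prob_space D"
    unfolding D_def by (rule *) (use B pos in auto)
  show "(LINT x|D. x ^ (2 * N)) = pochhammer p N / pochhammer (p + q) N"
    unfolding D_def by (rule *) (use B pos in auto)
qed

lemma nn_integral_cos_sin:
  fixes q :: real
  assumes "q > 0"
  shows "(\<integral>\<^sup>+x. ennreal (cos x ^ (2 * N) * sin x powr (2 * q - 1)) * indicator {0..pi} x \<partial>lborel)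
     = ennreal (Beta (1/2 + real N) q)"
proof -
  let ?f = "\<lambda>x. x ^ (2 * N) * (1 - x\<^sup>2) powr (q - 1) :: real"
  have "(\<integral>\<^sup>+x. ennreal (cos x ^ (2 * N) * sin x powr (2 * q - 1)) * indicator {0..pi} x \<partial>lborel)
     = (\<integral>\<^sup>+x. ennreal (?f (- cos x) * sin x * indicator {0..pi} x) \<partial>lborel)"
  proof (intro nn_integral_cong)
    fix x :: real
    have "(1 - (cos x)\<^sup>2) powr (q - 1) * sin x = sin x powr (2 * q - 1)" if "x \<in> {0..pi}"
    proof (cases "sin x = 0")
      case False
      then have s: "sin x > 0" using that sin_ge_zero[of x] by auto
      have "(1 - (cos x)\<^sup>2) powr (q - 1) * sin x = ((sin x)\<^sup>2) powr (q - 1) * sin x powr 1"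
        using s by (simp add: sin_squared_eq)
      also have "\<dots> = sin x powr (2 * (q - 1)) * sin x powr 1"
        using s by (simp add: powr_powr powr_numeral[symmetric] del: powr_numeral)
      also have "\<dots> = sin x powr (2 * (q - 1) + 1)"
        by (rule powr_add[symmetric])
      finally show ?thesis by (simp add: algebra_simps)
    qed simp
    then show "ennreal (cos x ^ (2 * N) * sin x powr (2 * q - 1)) * indicator {0..pi} x =
       ennreal (?f (- cos x) * sin x * indicator {0..pi} x)"
      by (auto simp: indicator_def mult.assoc)
  qed
  also have "\<dots> = (\<integral>\<^sup>+x. ennreal (?f x * indicator {- cos 0..- cos pi} x) \<partial>lborel)"
    by (subst nn_integral_substitution[where g = "\<lambda>x. - cos x" and g' = sin])
       (auto intro!: derivative_eq_intros continuous_intros sin_ge_zero simp: set_borel_measurable_def)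
  also have "\<dots> = (\<integral>\<^sup>+x. ennreal (?f x * indicator {-1..1} x) \<partial>lborel)" by simp
  also have "\<dots> = (\<integral>\<^sup>+x. ennreal (?f x * indicator {-1..0} x) + ennreal (?f x * indicator {0..1} x) \<partial>lborel)"
    by (intro nn_integral_cong_AE AE_I[of _ _ "{0}"]) (auto simp: indicator_def)
  also have "\<dots> = (\<integral>\<^sup>+x. ennreal (?f x * indicator {-1..0} x) \<partial>lborel) + (\<integral>\<^sup>+x. ennreal (?f x * indicator {0..1} x) \<partial>lborel)"
    by (rule nn_integral_add) auto
  also have "(\<integral>\<^sup>+x. ennreal (?f x * indicator {-1..0} x) \<partial>lborel) = (\<integral>\<^sup>+x. ennreal (?f x * indicator {0..1} x) \<partial>lborel)"
    by (subst nn_integral_real_affine[of _ "-1" 0]) (auto simp: indicator_def intro!: nn_integral_cong)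
  also have "(\<integral>\<^sup>+x. ennreal (?f x * indicator {0..1} x) \<partial>lborel) + (\<integral>\<^sup>+x. ennreal (?f x * indicator {0..1} x) \<partial>lborel)
     = (\<integral>\<^sup>+x. ennreal (?f x * indicator {0..1} x) + ennreal (?f x * indicator {0..1} x) \<partial>lborel)"
    by (rule nn_integral_add[symmetric]) auto
  also have "\<dots> = (\<integral>\<^sup>+x. ennreal (x ^ (2 * N) * (2 * x powr (2 * (1/2) - 1) * (1 - x\<^sup>2) powr (q - 1))) * indicator {0..1} x \<partial>lborel)"
    by (intro nn_integral_cong_AE AE_I[of _ _ "{0}"]) (auto simp: indicator_def ennreal_plus[symmetric] simp del: ennreal_plus)
  also have "\<dots> = ennreal (Beta (1/2 + real N) q)"
    by (rule nn_integral_even_power_Beta_square) (use assms in auto)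
  finally show ?thesis .
qed

text \<open>
  With \<open>x = - cos phi\<close> the even moments become the radial ones. The odd moments vanish by the
  reflection of \<open>phi\<close> to \<open>pi - phi\<close>.
\<close>
lemma angular_density_moments:
  fixes q :: real
  assumes "q > 0"
  defines "D \<equiv> density (restrict_space lborel {0..pi})
    (\<lambda>x. ennreal (1 / Beta (1/2) q * sin x powr (2 * q - 1)))"
  shows "prob_space D" "(LINT x|D. cos x ^ (2 * N)) = pochhammer (1/2) N / pochhammer (1/2 + q) N"
    "odd j \<Longrightarrow> (LINT x|D. cos x ^ j) = 0"
proof -
  have B: "Beta (1/2) q > 0" using assms by (simp add: Beta_real_pos)
  have "(\<integral>\<^sup>+x. ennreal (cos x ^ (2 * N) * (1 / Beta (1/2) q * sin x powr (2 * q - 1))) * indicator {0..pi} x \<partial>lborel)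
     = ennreal (pochhammer (1/2) N / pochhammer (1/2 + q) N)" for N
  proof -
    have "(\<integral>\<^sup>+x. ennreal (cos x ^ (2 * N) * (1 / Beta (1/2) q * sin x powr (2 * q - 1))) * indicator {0..pi} x \<partial>lborel)
      = (\<integral>\<^sup>+x. ennreal (1 / Beta (1/2) q) * (ennreal (cos x ^ (2 * N) * sin x powr (2 * q - 1)) * indicator {0..pi} x) \<partial>lborel)"
      using B by (intro nn_integral_cong) (auto simp: indicator_def ennreal_mult'[symmetric] mult_ac)
    also have "\<dots> = ennreal (1 / Beta (1/2) q) * ennreal (Beta (1/2 + real N) q)"
      by (subst nn_integral_cmult) (auto simp: nn_integral_cos_sin[OF assms(1)])
    also have "\<dots> = ennreal (Beta (1/2 + real N) q / Beta (1/2) q)"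
      using B by (simp add: ennreal_mult'[symmetric])
    finally show ?thesis by (simp add: Beta_ratio_pochhammer assms(1))
  qed
  note * = prob_space_density_restrict_moments[where g = cos and h = "\<lambda>x. 1 / Beta (1/2) q * sin x powr (2 * q - 1)" and a = 0 and b = pi, OF _ _ _ this]
  have pos: "0 \<le> pochhammer (1/2) N / pochhammer (1/2 + q) N" for N
    using assms by (intro divide_nonneg_nonneg pochhammer_nonneg) auto
  show "prob_space D"
    unfolding D_def by (rule *) (use B pos in auto)
  show "(LINT x|D. cos x ^ (2 * N)) = pochhammer (1/2) N / pochhammer (1/2 + q) N"
    unfolding D_def by (rule *) (use B pos in auto)
  assume j: "odd j"
  let ?F = "\<lambda>x. indicator {0..pi} x *\<^sub>R ((1 / Beta (1/2) q * sin x powr (2 * q - 1)) *\<^sub>R cos x ^ j) :: real"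
  have "(LINT x|D. cos x ^ j) = (LINT x|lborel. ?F x)"
    unfolding D_def using B
    by (subst integral_density) (auto simp: integral_restrict_space intro!: measurable_restrict_space1)
  also have "\<dots> = \<bar>-1\<bar> *\<^sub>R (LINT x|lborel. ?F (pi + (-1) * x))"
    by (rule lborel_integral_real_affine) simp
  also have "\<dots> = (LINT x|lborel. - ?F x)"
    using j by (auto simp: indicator_def power_minus_odd cos_diff sin_diff intro!: Bochner_Integration.integral_cong)
  also have "\<dots> = - (LINT x|lborel. ?F x)" by simp
  finally show "(LINT x|D. cos x ^ j) = 0"
    using \<open>(LINT x|D. cos x ^ j) = (LINT x|lborel. ?F x)\<close> by simp
qed

text \<open>
  In each of the three cases the measure is a product of a radial and an angular law, and the moments
  are given by the same formulas: for \<open>\<alpha> = \<beta>\<close> the radial formula gives the moments of the point mass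
  at 1, and for \<open>\<beta> = -1/2\<close> the angular formula gives those of the uniform law on \<open>{0, pi}\<close>. From here on
  only these moments matter, and the case distinction is gone.
\<close>
lemma jacobi_measure_factorization:
  assumes "-1/2 \<le> \<beta>" "\<beta> \<le> \<alpha>" "-1/2 < \<alpha>"
  obtains R A where "jacobi_measure \<alpha> \<beta> = R \<Otimes>\<^sub>M A" "prob_space R" "prob_space A"
    "sets R = sets (restrict_space borel {0..1})" "sets A = sets (restrict_space borel {0..pi})"
    "\<And>N. (LINT r|R. r ^ (2 * N)) = pochhammer (\<beta> + 1) N / pochhammer (\<alpha> + 1) N"
    "\<And>N. (LINT \<phi>|A. cos \<phi> ^ (2 * N)) = pochhammer (1/2) N / pochhammer (\<beta> + 1) N"
    "\<And>j. odd j \<Longrightarrow> (LINT \<phi>|A. cos \<phi> ^ j) = 0"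
proof -
  have setsD: "sets (density (restrict_space lborel X) f) = sets (restrict_space (borel :: real measure) X)" for X f
    by (simp add: sets_restrict_space)
  have Gc: "Gamma (\<beta> + 1) / (Gamma (1/2) * Gamma (\<beta> + 1/2)) = 1 / Beta (1/2) (\<beta> + 1/2)" for \<beta> :: real
    by (simp add: Beta_def add_ac)
  have poch: "pochhammer (x + 1) N \<noteq> 0" if "x \<ge> -1/2" for x :: real and N
    using pochhammer_pos[of "x + 1" N] that by simp
  let ?A = "density (restrict_space lborel {0..pi})
         (\<lambda>\<phi>. ennreal (1 / Beta (1/2) (\<beta> + 1/2) * sin \<phi> powr (2 * (\<beta> + 1/2) - 1)))"
  let ?R = "density (restrict_space lborel {0..1})
         (\<lambda>x. ennreal (2 / Beta (\<beta> + 1) (\<alpha> - \<beta>) * (x powr (2 * (\<beta> + 1) - 1) * (1 - x\<^sup>2) powr (\<alpha> - \<beta> - 1))))"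
  have e: "\<beta> + 1 + (\<alpha> - \<beta>) = \<alpha> + 1" "1/2 + (\<beta> + 1/2) = \<beta> + 1" by simp_all
  note radial = radial_density_moments[of "\<beta> + 1" "\<alpha> - \<beta>", unfolded e]
    and angular = angular_density_moments[of "\<beta> + 1/2", unfolded e]
  consider "\<alpha> = \<beta>" | "\<alpha> \<noteq> \<beta>" "\<beta> = -1/2" | "\<beta> < \<alpha>" "-1/2 < \<beta>"
    using assms by fastforce
  then show thesis
  proof cases
    case 1
    then have q: "\<beta> + 1/2 > 0" using assms by auto
    let ?O = "return (restrict_space borel {0..1}) (1 :: real)"
    show thesis
    proof (rule that[of ?O ?A])
      show "jacobi_measure \<alpha> \<beta> = ?O \<Otimes>\<^sub>M ?A"
        unfolding jacobi_measure_def using 1 by (simp add: Gc)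
      show "prob_space ?O" by (rule prob_space_return) (simp add: space_restrict_space)
      show "(LINT r|?O. r ^ (2 * N)) = pochhammer (\<beta> + 1) N / pochhammer (\<alpha> + 1) N" for N
        using 1 poch[of \<alpha> N] assms
        by (subst integral_return) (auto simp: space_restrict_space intro!: measurable_restrict_space1)
    qed (rule angular q setsD sets_return | assumption)+
  next
    case 2
    have q: "\<alpha> - \<beta> > 0" "\<beta> + 1 > 0" using 2 assms by auto
    let ?M = "distr (uniform_count_measure {0, pi}) (restrict_space borel {0..pi}) (\<lambda>\<phi>. \<phi>)"
    have meas: "(\<lambda>\<phi>. \<phi>) \<in> measurable (uniform_count_measure {0, pi}) (restrict_space borel {0..pi})"
      by (rule measurableI)
        (auto simp: space_restrict_space space_uniform_count_measure sets_uniform_count_measure)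
    have int: "(LINT \<phi>|?M. cos \<phi> ^ j) = (1 + (-1) ^ j) / 2" for j
    proof -
      have "(LINT \<phi>|?M. cos \<phi> ^ j) = (LINT \<phi>|uniform_count_measure {0, pi}. cos \<phi> ^ j)"
        by (rule integral_distr[OF meas]) (auto intro!: measurable_restrict_space1)
      also have "\<dots> = (1 + (-1) ^ j) / 2"
        by (subst integral_uniform_count_measure) auto
      finally show ?thesis .
    qed
    have "?R = density (restrict_space lborel {0..1})
         (\<lambda>r. ennreal (2 * Gamma (\<alpha> + 1) / (Gamma (1/2) * Gamma (\<alpha> + 1/2)) * (1 - r\<^sup>2) powr (\<alpha> - 1/2)))"
    proof (rule density_cong)
      \<comment> \<open>The densities differ at 0, where 0 powr 0 is 0.\<close>
      have e: "ennreal (2 / Beta (\<beta> + 1) (\<alpha> - \<beta>) * (x powr (2 * (\<beta> + 1) - 1) * (1 - x\<^sup>2) powr (\<alpha> - \<beta> - 1))) =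
        ennreal (2 * Gamma (\<alpha> + 1) / (Gamma (1/2) * Gamma (\<alpha> + 1/2)) * (1 - x\<^sup>2) powr (\<alpha> - 1/2))"
        if "x \<noteq> 0" for x
        using 2 that by (simp add: Beta_def add_ac)
      show "AE x in restrict_space lborel {0..1}.
        ennreal (2 / Beta (\<beta> + 1) (\<alpha> - \<beta>) * (x powr (2 * (\<beta> + 1) - 1) * (1 - x\<^sup>2) powr (\<alpha> - \<beta> - 1))) =
        ennreal (2 * Gamma (\<alpha> + 1) / (Gamma (1/2) * Gamma (\<alpha> + 1/2)) * (1 - x\<^sup>2) powr (\<alpha> - 1/2))"
        by (subst AE_restrict_space_iff, simp, rule eventually_mono[OF AE_lborel_singleton[of 0]])
           (use e in auto)
    qed (auto intro!: measurable_restrict_space1)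
    then have m: "jacobi_measure \<alpha> \<beta> = ?R \<Otimes>\<^sub>M ?M"
      unfolding jacobi_measure_def using 2 by simp
    show thesis
    proof (rule that[of ?R ?M])
      show "prob_space ?M"
        by (rule prob_space.prob_space_distr[OF prob_space_uniform_count_measure meas]) auto
      show "(LINT \<phi>|?M. cos \<phi> ^ (2 * N)) = pochhammer (1/2) N / pochhammer (\<beta> + 1) N" for N
        unfolding int using 2 poch[of "-1/2" N] by simp
      show "(LINT \<phi>|?M. cos \<phi> ^ j) = 0" if "odd j" for j
        unfolding int using that by simp
    qed (rule m radial q setsD sets_distr)+
  next
    case 3
    have q: "\<alpha> - \<beta> > 0" "\<beta> + 1 > 0" "\<beta> + 1/2 > 0" using 3 assms by auto
    have G: "Gamma (\<beta> + 1) > 0" using q by (auto intro!: Gamma_real_pos)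
    interpret A: prob_space ?A by (rule angular_density_moments[OF q(3)])
    have "?R \<Otimes>\<^sub>M ?A = density (restrict_space lborel {0..1} \<Otimes>\<^sub>M restrict_space lborel {0..pi})
       (\<lambda>(x, \<phi>). ennreal (2 / Beta (\<beta> + 1) (\<alpha> - \<beta>) * (x powr (2 * (\<beta> + 1) - 1) * (1 - x\<^sup>2) powr (\<alpha> - \<beta> - 1)))
          * ennreal (1 / Beta (1/2) (\<beta> + 1/2) * sin \<phi> powr (2 * (\<beta> + 1/2) - 1)))"
    proof (rule pair_measure_density)
      show "sigma_finite_measure (restrict_space lborel {0..pi})"
        by (rule sigma_finite_measure_restrict_space) (auto intro: sigma_finite_lborel)
      show "sigma_finite_measure ?A" ..
    qed (auto intro!: measurable_restrict_space1)
    also have "\<dots> = jacobi_measure \<alpha> \<beta>"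
    proof -
      have "ennreal (2 / Beta (\<beta> + 1) (\<alpha> - \<beta>) * (r powr (2 * (\<beta> + 1) - 1) * (1 - r\<^sup>2) powr (\<alpha> - \<beta> - 1)))
          * ennreal (1 / Beta (1/2) (\<beta> + 1/2) * sin \<phi> powr (2 * (\<beta> + 1/2) - 1)) =
          ennreal (2 * Gamma (\<alpha> + 1) / (Gamma (1/2) * Gamma (\<alpha> - \<beta>) * Gamma (\<beta> + 1/2))
              * (1 - r\<^sup>2) powr (\<alpha> - \<beta> - 1) * (r * sin \<phi>) powr (2 * \<beta>) * r)"
        if "r \<in> {0..1}" "\<phi> \<in> {0..pi}" for r \<phi>
      proof -
        have B: "Beta (1/2) (\<beta> + 1/2) > 0" using q by (auto intro!: Beta_real_pos)
        have c: "2 / Beta (\<beta> + 1) (\<alpha> - \<beta>) * (1 / Beta (1/2) (\<beta> + 1/2)) =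
            2 * Gamma (\<alpha> + 1) / (Gamma (1/2) * Gamma (\<alpha> - \<beta>) * Gamma (\<beta> + 1/2))"
          using G by (simp add: Beta_def add_ac)
        have s: "sin \<phi> \<ge> 0" using that by (auto intro: sin_ge_zero)
        have r: "r powr (2 * \<beta>) * r = r powr (2 * (\<beta> + 1) - 1)"
        proof (cases "r = 0")
          case False
          then have "r > 0" using that by auto
          then have "r powr (2 * \<beta>) * r = r powr (2 * \<beta>) * r powr 1" by simp
          also have "\<dots> = r powr (2 * \<beta> + 1)" by (rule powr_add[symmetric])
          finally show ?thesis by (simp add: algebra_simps)
        qed simp
        have e: "2 * (\<beta> + 1/2) - 1 = 2 * \<beta>" by simp
        show ?thesis
          unfolding c[symmetric] r[symmetric] e
          using that s B by (subst ennreal_mult''[symmetric]) (auto simp: powr_mult mult_ac)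
      qed
      note eq = this
      let ?P = "restrict_space lborel {0..1} \<Otimes>\<^sub>M restrict_space lborel {0..pi} :: (real \<times> real) measure"
      have [measurable]: "fst \<in> borel_measurable ?P" "snd \<in> borel_measurable ?P"
        by (rule measurable_compose[OF measurable_fst measurable_restrict_space1], simp)
           (rule measurable_compose[OF measurable_snd measurable_restrict_space1], simp)
      have "\<alpha> \<noteq> \<beta>" "\<beta> \<noteq> -1/2" using 3 by auto
      then show ?thesis
        unfolding jacobi_measure_def if_not_P[OF \<open>\<alpha> \<noteq> \<beta>\<close>] if_not_P[OF \<open>\<beta> \<noteq> -1/2\<close>]
      proof (intro density_cong AE_I2, unfold case_prod_beta, goal_cases)
        case 1 then show ?case by measurable
      next
        case 2 then show ?case by measurable
      next
        case (3 x)
        then show ?case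
          by (intro eq) (auto simp: space_pair_measure space_restrict_space)
      qed
    qed
    finally have m: "jacobi_measure \<alpha> \<beta> = ?R \<Otimes>\<^sub>M ?A" ..
    show thesis
      by (rule that[of ?R ?A]) (rule m radial angular q setsD | assumption)+
  qed
qed


text \<open>
  The Chu--Vandermonde sum, with \<open>(-M)_m (-N)_m / m!\<close> written with binomial coefficients.
\<close>
lemma vandermonde_binomials:
  assumes "c > 0"
  shows "(\<Sum>m\<le>N. real (N choose m) * real (M choose m) * fact m / pochhammer c m) =
     pochhammer c (M + N) / (pochhammer c M * pochhammer c N)" (is "?L = _")
proof -
  have pos: "pochhammer c j > 0" for j using assms by (rule pochhammer_pos)
  have "(\<Sum>k\<in>{0..N}. (pochhammer (- real M) k * pochhammer (- real N) k) /
    (of_nat (fact k) * pochhammer c k)) = pochhammer (c - (- real M)) N / pochhammer c N"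
    by (rule Vandermonde_pochhammer) (use assms in auto)
  moreover have "pochhammer (- real M) k * pochhammer (- real N) k / (of_nat (fact k) * pochhammer c k)
     = real (N choose k) * real (M choose k) * fact k / pochhammer c k" for k
  proof -
    have *: "pochhammer (- real M) k = (-1) ^ k * fact k * real (M choose k)" for M
      by (simp add: binomial_gbinomial gbinomial_pochhammer)
    show ?thesis unfolding * by (simp add: field_simps power_mult_distrib[symmetric])
  qed
  ultimately have "?L = pochhammer (c + real M) N / pochhammer c N"
    by (simp add: atMost_atLeast0)
  also have "pochhammer c (M + N) = pochhammer c M * pochhammer (c + real M) N"
    by (rule pochhammer_product')
  then have "pochhammer (c + real M) N / pochhammer c N = pochhammer c (M + N) / (pochhammer c M * pochhammer c N)"
    using pos[of M] by simp
  finally show ?thesis .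
qed

locale jacobi_index =
  fixes \<alpha> \<beta> :: real
  assumes \<beta>_ge: "-1/2 \<le> \<beta>" and \<beta>_le: "\<beta> \<le> \<alpha>" and \<alpha>_gt: "-1/2 < \<alpha>"
begin

lemma borel_measurable_fst_snd_jacobi_measure [measurable]:
  "fst \<in> borel_measurable (jacobi_measure \<alpha> \<beta>)" "snd \<in> borel_measurable (jacobi_measure \<alpha> \<beta>)"
proof -
  let ?R = "restrict_space (borel :: real measure) {0..1} \<Otimes>\<^sub>M
            restrict_space (borel :: real measure) {0..pi}"
  have "fst \<in> borel_measurable ?R" "snd \<in> borel_measurable ?R"
    by (rule measurable_compose[OF measurable_fst measurable_restrict_space1], simp)
       (rule measurable_compose[OF measurable_snd measurable_restrict_space1], simp)
  then show "fst \<in> borel_measurable (jacobi_measure \<alpha> \<beta>)" "snd \<in> borel_measurable (jacobi_measure \<alpha> \<beta>)"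
    by (simp_all add: measurable_cong_sets[OF sets_jacobi_measure refl])
qed

lemma prob_space_jacobi_measure: "prob_space (jacobi_measure \<alpha> \<beta>)"
  by (rule jacobi_measure_factorization[OF \<beta>_ge \<beta>_le \<alpha>_gt]) (simp add: prob_space_pair)

sublocale m: prob_space "jacobi_measure \<alpha> \<beta>"
  by (rule prob_space_jacobi_measure)

lemma integral_jacobi_measure_moment:
  "(LINT p|jacobi_measure \<alpha> \<beta>. (fst p * cos (snd p)) ^ j * ((fst p)\<^sup>2) ^ l) =
     (if odd j then 0 else
       pochhammer (1/2) (j div 2) * pochhammer (\<beta> + 1) (j div 2 + l) /
         (pochhammer (\<beta> + 1) (j div 2) * pochhammer (\<alpha> + 1) (j div 2 + l)))"
proof -
  obtain R A where m: "jacobi_measure \<alpha> \<beta> = R \<Otimes>\<^sub>M A" and R: "prob_space R" and A: "prob_space A"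
    and sets: "sets R = sets (restrict_space borel {0..1})" "sets A = sets (restrict_space borel {0..pi})"
    and r: "\<And>N. (LINT r|R. r ^ (2 * N)) = pochhammer (\<beta> + 1) N / pochhammer (\<alpha> + 1) N"
    and c: "\<And>N. (LINT \<phi>|A. cos \<phi> ^ (2 * N)) = pochhammer (1/2) N / pochhammer (\<beta> + 1) N"
    and o: "\<And>j. odd j \<Longrightarrow> (LINT \<phi>|A. cos \<phi> ^ j) = 0"
    by (rule jacobi_measure_factorization[OF \<beta>_ge \<beta>_le \<alpha>_gt]) (rule that; assumption)
  interpret R: prob_space R by fact
  interpret A: prob_space A by fact
  interpret RA: pair_prob_space R A ..
  have sp: "space R = {0..1}" using sets_eq_imp_space_eq[OF sets(1)] by (simp add: space_restrict_space)
  have [measurable]: "(\<lambda>x. x) \<in> borel_measurable R" "(\<lambda>x. x) \<in> borel_measurable A"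
    by (simp_all add: measurable_cong_sets[OF sets(1) refl] measurable_cong_sets[OF sets(2) refl]
          measurable_restrict_space1)
  have [measurable]: "fst \<in> borel_measurable (R \<Otimes>\<^sub>M A)" "snd \<in> borel_measurable (R \<Otimes>\<^sub>M A)"
    using borel_measurable_fst_snd_jacobi_measure unfolding m .
  have "(LINT p|jacobi_measure \<alpha> \<beta>. (fst p * cos (snd p)) ^ j * ((fst p)\<^sup>2) ^ l) =
     (LINT p|(R \<Otimes>\<^sub>M A). fst p ^ (j + 2 * l) * cos (snd p) ^ j)"
    unfolding m by (simp add: power_mult_distrib power_add mult_ac flip: power_mult)
  also have "\<dots> = (LINT r|R. LINT \<phi>|A. fst (r, \<phi>) ^ (j + 2 * l) * cos (snd (r, \<phi>)) ^ j)"
  proof (rule RA.integral_fst'[symmetric], rule RA.integrable_const_bound[where B = 1])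
    show "AE p in R \<Otimes>\<^sub>M A. norm (fst p ^ (j + 2 * l) * cos (snd p) ^ j) \<le> 1"
      by (intro AE_I2) (auto simp: space_pair_measure sp abs_mult power_abs
          intro!: mult_le_one power_le_one)
  qed measurable
  also have "\<dots> = (LINT r|R. r ^ (j + 2 * l)) * (LINT \<phi>|A. cos \<phi> ^ j)"
    by simp
  also have "\<dots> = (if odd j then 0 else
       pochhammer (1/2) (j div 2) * pochhammer (\<beta> + 1) (j div 2 + l) /
         (pochhammer (\<beta> + 1) (j div 2) * pochhammer (\<alpha> + 1) (j div 2 + l)))"
  proof (cases "odd j")
    case False
    then have j: "j = 2 * (j div 2)" "j + 2 * l = 2 * (j div 2 + l)" by auto
    show ?thesis
      using False r[of "j div 2 + l"] c[of "j div 2"] unfolding j[symmetric] by (simp add: mult.commute)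
  qed (simp add: o)
  finally show ?thesis .
qed

lemma integrable_jacobi_measure_polynomial:
  "integrable (jacobi_measure \<alpha> \<beta>) (\<lambda>p. (fst p * cos (snd p)) ^ j * ((fst p)\<^sup>2) ^ l)"
proof -
  show ?thesis
  proof (rule m.integrable_const_bound[where B = 1])
    show "AE p in jacobi_measure \<alpha> \<beta>. norm ((fst p * cos (snd p)) ^ j * ((fst p)\<^sup>2) ^ l) \<le> 1"
      by (intro AE_I2) (auto simp: space_jacobi_measure norm_mult norm_power abs_mult power_abs
          intro!: mult_le_one power_le_one)
  qed measurable
qed

text \<open>
  For a point of the disc with real part \<open>u\<close> and squared modulus \<open>v\<close>, expand \<open>(x + 2 u y + v z)^k\<close>.
  Only even powers \<open>2 m\<close> of \<open>u\<close> contribute, and \<open>y^(2m)\<close> becomes \<open>(x z)^m\<close>. Collecting the powers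
  \<open>x^(k-N) z^N\<close> leaves a sum over \<open>m\<close>, which is of Chu--Vandermonde type.
\<close>
lemma integral_trinomial_jacobi_measure:
  fixes x y z :: real
  assumes xyz: "y\<^sup>2 = x * z"
  shows "(LINT p|jacobi_measure \<alpha> \<beta>. (x + 2 * (fst p * cos (snd p)) * y + (fst p)\<^sup>2 * z) ^ k) =
    bateman \<alpha> \<beta> k x z"
proof -
  let ?m = "jacobi_measure \<alpha> \<beta>"
  let ?U = "\<lambda>p :: real \<times> real. fst p * cos (snd p)" and ?V = "\<lambda>p :: real \<times> real. (fst p)\<^sup>2"
  define e where "e m l = pochhammer (1/2) m * pochhammer (\<beta> + 1) (m + l) /
         (pochhammer (\<beta> + 1) m * pochhammer (\<alpha> + 1) (m + l))" for m l
  define t where "t j l = (LINT p|?m. ?U p ^ j * ?V p ^ l)" for j l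
  have t_even: "t (2 * m) l = e m l" and t_odd: "odd j \<Longrightarrow> t j l = 0" for m l j
    by (simp_all add: t_def e_def integral_jacobi_measure_moment)
  have idx: "a + (a + b) = 2 * a + b" for a b :: nat by simp
  have t_nz: "even j" if "t j l \<noteq> 0" for j l
    using that t_odd by blast
  have "(x + 2 * u * y + v * z) ^ k =
    (\<Sum>j\<le>k. \<Sum>l\<le>k-j. (real (k choose j) * (2 * y) ^ j * real ((k - j) choose l) * z ^ l * x ^ (k - j - l)) * (u ^ j * v ^ l))" for u v
  proof -
    have "(x + 2 * u * y + v * z) ^ k = (2 * u * y + (v * z + x)) ^ k" by (simp add: add_ac)
    also have "\<dots> = (\<Sum>j\<le>k. real (k choose j) * (2 * u * y) ^ j * (v * z + x) ^ (k - j))"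
      by (rule binomial_ring)
    also have "\<dots> = (\<Sum>j\<le>k. real (k choose j) * (2 * u * y) ^ j * (\<Sum>l\<le>k-j. real ((k - j) choose l) * (v * z) ^ l * x ^ (k - j - l)))"
      by (simp add: binomial_ring)
    finally show ?thesis by (simp add: sum_distrib_left power_mult_distrib mult_ac)
  qed
  then have "(LINT p|?m. (x + 2 * ?U p * y + ?V p * z) ^ k) =
     (\<Sum>j\<le>k. \<Sum>l\<le>k-j. (real (k choose j) * (2 * y) ^ j * real ((k - j) choose l) * z ^ l * x ^ (k - j - l)) * t j l)"
    by (simp add: Bochner_Integration.integral_sum integrable_jacobi_measure_polynomial t_def
        Bochner_Integration.integrable_sum)
  also have "\<dots> = (\<Sum>j\<in>{j. even j \<and> j \<le> k}. \<Sum>l\<le>k-j. (real (k choose j) * (2 * y) ^ j * real ((k - j) choose l) * z ^ l * x ^ (k - j - l)) * t j l)"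
    by (rule sum.mono_neutral_right) (auto intro!: sum.neutral dest: t_nz)
  also have "\<dots> = (\<Sum>m\<in>{m. 2 * m \<le> k}. \<Sum>l\<le>k-2*m. (real (k choose (2*m)) * (2 * y) ^ (2*m) * real ((k - 2*m) choose l) * z ^ l * x ^ (k - 2*m - l)) * e m l)"
    by (rule sum.reindex_bij_witness[of _ "\<lambda>m. 2 * m" "\<lambda>j. j div 2"]) (auto simp: t_even)
  also have "\<dots> = (\<Sum>(m, l)\<in>(SIGMA m:{m. 2 * m \<le> k}. {..k - 2 * m}). (real (k choose (2*m)) * (2 * y) ^ (2*m) * real ((k - 2*m) choose l) * z ^ l * x ^ (k - 2*m - l)) * e m l)"
    by (rule sum.Sigma) (auto intro: finite_subset[of _ "{..k}"])
  also have "\<dots> = (\<Sum>(N, m)\<in>(SIGMA N:{..k}. {m. m \<le> N \<and> m + N \<le> k}).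
       (real (k choose (2*m)) * (2 * y) ^ (2*m) * real ((k - 2*m) choose (N - m)) * z ^ (N - m) * x ^ (k - m - N)) * e m (N - m))"
    by (rule sum.reindex_bij_witness[of _ "\<lambda>(N, m). (m, N - m)" "\<lambda>(m, l). (m + l, m)"])
       (auto simp: idx)
  also have "\<dots> = (\<Sum>N\<le>k. \<Sum>m\<in>{m. m \<le> N \<and> m + N \<le> k}.
       (real (k choose (2*m)) * (2 * y) ^ (2*m) * real ((k - 2*m) choose (N - m)) * z ^ (N - m) * x ^ (k - m - N)) * e m (N - m))"
    by (rule sum.Sigma[symmetric]) (auto intro: finite_subset[of _ "{..k}"])
  also have "\<dots> = bateman \<alpha> \<beta> k x z"
    unfolding bateman_def
  proof (intro sum.cong refl)
    fix N assume "N \<in> {..k}"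
    then have N: "N \<le> k" by simp
    have pos: "pochhammer (\<beta> + 1) j > 0" "pochhammer (\<alpha> + 1) j > 0" for j
      using \<beta>_ge \<alpha>_gt by (auto intro!: pochhammer_pos)
    have summand: "(real (k choose (2*m)) * (2 * y) ^ (2*m) * real ((k - 2*m) choose (N - m)) * z ^ (N - m) * x ^ (k - m - N)) * e m (N - m)
      = x ^ (k - N) * z ^ N * (pochhammer (\<beta> + 1) N / pochhammer (\<alpha> + 1) N * real (k choose N)) *
          (real (N choose m) * real ((k - N) choose m) * fact m / pochhammer (\<beta> + 1) m)"
      if m: "m \<le> N" "m + N \<le> k" for m
    proof -
      have "(2 * y) ^ (2 * m) = 4 ^ m * (x * z) ^ m"
        by (simp add: power_mult power_mult_distrib xyz)
      moreover have "z ^ m * z ^ (N - m) = z ^ N" "x ^ m * x ^ (k - m - N) = x ^ (k - N)"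
        using m by (simp_all add: power_add[symmetric])
      ultimately have 1: "(2 * y) ^ (2 * m) * z ^ (N - m) * x ^ (k - m - N) = 4 ^ m * (x ^ (k - N) * z ^ N)"
        by (simp add: power_mult_distrib mult_ac) (metis mult.assoc mult.commute)
      have f1: "fact (2 * m) = (4 ^ m * pochhammer (1/2) m * fact m :: real)"
        using fact_double[of m, where ?'a = real] by (simp add: power_mult)
      have 2: "real (k choose (2*m)) * 4 ^ m * real ((k - 2*m) choose (N - m)) * pochhammer (1/2) m
           = real (k choose N) * (real (N choose m) * real ((k - N) choose m) * fact m)"
      proof -
        have k2: "k - 2 * m - (N - m) = k - N - m" using m by simp
        have "pochhammer (1/2 :: real) m > 0" by (rule pochhammer_pos) simp
        then show ?thesis
          using m by (simp add: binomial_fact k2 f1) (simp add: field_simps)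
      qed
      have "(real (k choose (2*m)) * (2 * y) ^ (2*m) * real ((k - 2*m) choose (N - m)) * z ^ (N - m) * x ^ (k - m - N)) * e m (N - m)
         = real (k choose (2*m)) * real ((k - 2*m) choose (N - m)) * ((2 * y) ^ (2*m) * z ^ (N - m) * x ^ (k - m - N)) * e m (N - m)"
        by (simp add: mult_ac)
      also have "\<dots> = (real (k choose (2*m)) * 4 ^ m * real ((k - 2*m) choose (N - m)) * pochhammer (1/2) m) * (x ^ (k - N) * z ^ N)
          * (pochhammer (\<beta> + 1) N / (pochhammer (\<beta> + 1) m * pochhammer (\<alpha> + 1) N))"
        unfolding 1 e_def using m by (simp add: mult_ac)
      also have "\<dots> = x ^ (k - N) * z ^ N * (pochhammer (\<beta> + 1) N / pochhammer (\<alpha> + 1) N * real (k choose N)) *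
          (real (N choose m) * real ((k - N) choose m) * fact m / pochhammer (\<beta> + 1) m)"
        unfolding 2 by (simp add: mult_ac)
      finally show ?thesis .
    qed
    have "(\<Sum>m\<in>{m. m \<le> N \<and> m + N \<le> k}.
       (real (k choose (2*m)) * (2 * y) ^ (2*m) * real ((k - 2*m) choose (N - m)) * z ^ (N - m) * x ^ (k - m - N)) * e m (N - m))
      = x ^ (k - N) * z ^ N * (pochhammer (\<beta> + 1) N / pochhammer (\<alpha> + 1) N * real (k choose N)) *
         (\<Sum>m\<in>{m. m \<le> N \<and> m + N \<le> k}. real (N choose m) * real ((k - N) choose m) * fact m / pochhammer (\<beta> + 1) m)"
      unfolding sum_distrib_left by (intro sum.cong refl summand) auto
    also have "(\<Sum>m\<in>{m. m \<le> N \<and> m + N \<le> k}. real (N choose m) * real ((k - N) choose m) * fact m / pochhammer (\<beta> + 1) m)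
      = (\<Sum>m\<le>N. real (N choose m) * real ((k - N) choose m) * fact m / pochhammer (\<beta> + 1) m)"
      using N by (intro sum.mono_neutral_left) auto
    also have "\<dots> = pochhammer (\<beta> + 1) k / (pochhammer (\<beta> + 1) (k - N) * pochhammer (\<beta> + 1) N)"
      using vandermonde_binomials[of "\<beta> + 1" N "k - N"] \<beta>_ge N by simp
    also have "x ^ (k - N) * z ^ N * (pochhammer (\<beta> + 1) N / pochhammer (\<alpha> + 1) N * real (k choose N)) * \<dots>
      = jacobi_coeff \<alpha> \<beta> k N * x ^ (k - N) * z ^ N"
      unfolding jacobi_coeff_def using pos[of N] pos[of "k - N"] by (simp add: field_simps)
    finally show "(\<Sum>m\<in>{m. m \<le> N \<and> m + N \<le> k}.
       (real (k choose (2*m)) * (2 * y) ^ (2*m) * real ((k - 2*m) choose (N - m)) * z ^ (N - m) * x ^ (k - m - N)) * e m (N - m))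
       = jacobi_coeff \<alpha> \<beta> k N * x ^ (k - N) * z ^ N" .
  qed
  finally show ?thesis by simp
qed

end


section \<open>The horocyclic coordinate\<close>
definition horo_sq :: "real \<Rightarrow> real \<times> real \<Rightarrow> real" where
  "horo_sq t p = (cosh t)\<^sup>2 + 2 * (fst p * cos (snd p)) * (cosh t * sinh t) + (fst p)\<^sup>2 * (sinh t)\<^sup>2"

text \<open>
  The logarithm of \<open>|cosh t + r e^(i phi) sinh t|\<close>, expressed by the square of the modulus because the
  latter is polynomial in the real part and the squared modulus of the disc point.
\<close>
definition horo :: "real \<Rightarrow> real \<times> real \<Rightarrow> real" where
  "horo t p = ln (horo_sq t p) / 2"

lemma cmod_add_polar_squared:
  "(cmod (complex_of_real a + complex_of_real r * exp (\<i> * complex_of_real \<phi>) * complex_of_real b))\<^sup>2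
     = a\<^sup>2 + 2 * (r * cos \<phi>) * (a * b) + r\<^sup>2 * b\<^sup>2"
proof -
  have "(cmod (complex_of_real a + complex_of_real r * exp (\<i> * complex_of_real \<phi>) * complex_of_real b))\<^sup>2
     = (a + r * cos \<phi> * b)\<^sup>2 + (r * sin \<phi> * b)\<^sup>2"
    by (simp add: cmod_power2 Re_exp Im_exp)
  also have "\<dots> = a\<^sup>2 + 2 * (r * cos \<phi>) * (a * b) + r\<^sup>2 * b\<^sup>2 * ((sin \<phi>)\<^sup>2 + (cos \<phi>)\<^sup>2)"
    by (simp add: power2_eq_square algebra_simps del: sin_cos_squared_add sin_cos_squared_add2 sin_cos_squared_add3)
  finally show ?thesis by simp
qed

lemma horo_sq_bounds:
  assumes "p \<in> {0..1} \<times> {0..pi}" "0 \<le> t"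
  shows "exp (- (2 * t)) \<le> horo_sq t p" "horo_sq t p \<le> exp (2 * t)"
proof -
  let ?r = "fst p" and ?c = "cosh t" and ?s = "sinh t" and ?u = "fst p * cos (snd p)"
  have r: "0 \<le> ?r" "?r \<le> 1" using assms by auto
  have s: "0 \<le> ?s" "0 \<le> ?c" using assms by auto
  have u: "- ?r \<le> ?u" "?u \<le> ?r"
    using mult_left_mono[OF cos_ge_minus_one r(1), of "snd p"] mult_left_mono[OF cos_le_one r(1), of "snd p"] by auto
  have cs: "?c - ?s = exp (- t)" "?c + ?s = exp t"
    by (simp_all add: cosh_minus_sinh cosh_plus_sinh)
  have rs: "?r * ?s \<le> ?s" "0 \<le> ?r * ?s" using r s by (auto intro: mult_left_le_one_le)
  have "exp (- (2 * t)) = (?c - ?s)\<^sup>2" unfolding cs by (simp add: power2_eq_square mult_exp_exp)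
  also have "\<dots> \<le> (?c - ?r * ?s)\<^sup>2"
    using rs cs(1) by (intro power_mono) auto
  also have "\<dots> \<le> (?c - ?r * ?s)\<^sup>2 + 2 * (?c * ?s) * (?r + ?u)"
    using u s by simp
  also have "\<dots> = horo_sq t p" by (simp add: horo_sq_def power2_eq_square algebra_simps)
  finally show "exp (- (2 * t)) \<le> horo_sq t p" .
  have "horo_sq t p = (?c + ?r * ?s)\<^sup>2 - 2 * (?c * ?s) * (?r - ?u)"
    by (simp add: horo_sq_def power2_eq_square algebra_simps)
  also have "\<dots> \<le> (?c + ?r * ?s)\<^sup>2" using u s by simp
  also have "\<dots> \<le> (?c + ?s)\<^sup>2" using rs s by (intro power_mono) auto
  also have "\<dots> = exp (2 * t)" unfolding cs by (simp add: power2_eq_square mult_exp_exp)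
  finally show "horo_sq t p \<le> exp (2 * t)" .
qed

lemma horo_sq_pos: "p \<in> {0..1} \<times> {0..pi} \<Longrightarrow> 0 \<le> t \<Longrightarrow> 0 < horo_sq t p"
  using horo_sq_bounds(1)[of p t] by (meson exp_gt_zero less_le_trans)

lemma exp_horo: "p \<in> {0..1} \<times> {0..pi} \<Longrightarrow> 0 \<le> t \<Longrightarrow> exp (2 * horo t p) = horo_sq t p"
  by (simp add: horo_def horo_sq_pos)

lemma horo_bounds:
  assumes "p \<in> {0..1} \<times> {0..pi}" "0 \<le> t"
  shows "- t \<le> horo t p" "horo t p \<le> t" "\<bar>horo t p\<bar> \<le> t"
proof -
  have "exp (- (2 * t)) \<le> exp (2 * horo t p)" "exp (2 * horo t p) \<le> exp (2 * t)"
    using horo_sq_bounds[OF assms] exp_horo[OF assms] by simp_all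
  then show "- t \<le> horo t p" "horo t p \<le> t" by simp_all
  then show "\<bar>horo t p\<bar> \<le> t" by simp
qed

text \<open>
  The real part of \<open>cosh t + r e^(i phi) sinh t\<close> is already at least \<open>exp (t - w)\<close>. So the coordinate
  falls short of the distance \<open>t\<close> by more than \<open>w\<close> only if the disc point is close to -1, whatever
  \<open>t\<close> is.
\<close>
lemma horo_ge_of_cos_gt:
  assumes p: "p \<in> {0..1} \<times> {0..pi}" and t: "0 \<le> t" and w: "0 \<le> w"
    and u: "fst p * cos (snd p) \<ge> 2 * exp (- w) - 1"
  shows "horo t p \<ge> t - w"
proof -
  let ?c = "cosh t" and ?s = "sinh t" and ?u = "fst p * cos (snd p)"
  have s: "0 \<le> ?s" using t by simp
  have u2: "?u\<^sup>2 \<le> (fst p)\<^sup>2"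
  proof -
    have "\<bar>cos (snd p)\<bar> \<le> 1" by simp
    then have "(cos (snd p))\<^sup>2 \<le> 1" by (simp add: abs_square_le_1)
    then show ?thesis by (simp add: power_mult_distrib mult_left_le)
  qed
  have "exp (t - w) = exp t * exp (- w)" by (simp add: exp_diff exp_minus field_simps)
  also have "\<dots> \<le> exp (- t) * (1 - exp (- w)) + exp t * exp (- w)"
    using w by simp
  also have "\<dots> = ?c + (2 * exp (- w) - 1) * ?s"
    by (simp add: cosh_def sinh_def field_simps)
  also have "\<dots> \<le> ?c + ?u * ?s"
    using mult_right_mono[OF u s] by simp
  finally have "exp (t - w) \<le> ?c + ?u * ?s" .
  then have "(exp (t - w))\<^sup>2 \<le> (?c + ?u * ?s)\<^sup>2" by (intro power_mono) auto
  also have "\<dots> \<le> (?c + ?u * ?s)\<^sup>2 + ((fst p)\<^sup>2 - ?u\<^sup>2) * ?s\<^sup>2"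
    using u2 by simp
  also have "\<dots> = horo_sq t p" by (simp add: horo_sq_def power2_eq_square algebra_simps)
  also have "\<dots> = exp (2 * horo t p)" using exp_horo[OF p t] by simp
  finally have "exp (2 * (t - w)) \<le> exp (2 * horo t p)" by (simp add: power2_eq_square mult_exp_exp)
  then show ?thesis by simp
qed

lemma jacobi_moment_fun_eq:
  "jacobi_moment_fun \<alpha> \<beta> k t = (LINT p|jacobi_measure \<alpha> \<beta>. horo t p ^ k)"
proof -
  have "ln (cmod (complex_of_real (cosh t)
           + complex_of_real r * exp (\<i> * complex_of_real \<phi>) * complex_of_real (sinh t))) = horo t (r, \<phi>)"
    (is "ln ?c = _") for r \<phi>
  proof -
    have "horo t (r, \<phi>) = ln (?c\<^sup>2) / 2"
      unfolding cmod_add_polar_squared by (simp add: horo_def horo_sq_def)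
    also have "\<dots> = ln ?c" by (cases "?c = 0") (simp_all add: ln_realpow)
    finally show ?thesis by simp
  qed
  then show ?thesis
    unfolding jacobi_moment_fun_def by (intro Bochner_Integration.integral_cong) auto
qed

lemma jacobi_point_map_props:
  assumes "0 \<le> s" "0 \<le> t" "p \<in> {0..1} \<times> {0..pi}"
  defines "q \<equiv> (cosh s * cosh t)\<^sup>2 + 2 * (fst p * cos (snd p)) * ((cosh s * cosh t) * (sinh s * sinh t))
     + (fst p)\<^sup>2 * (sinh s * sinh t)\<^sup>2"
  shows "0 \<le> jacobi_point_map s t p" "jacobi_point_map s t p \<le> s + t"
    "(cosh (jacobi_point_map s t p))\<^sup>2 = q" "(sinh (jacobi_point_map s t p))\<^sup>2 = q - 1"
proof -
  obtain r \<phi> where p: "p = (r, \<phi>)" by (cases p)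
  have r: "r \<in> {0..1}" using assms p by auto
  let ?a = "complex_of_real (cosh s * cosh t)" and ?b = "complex_of_real r * exp (\<i> * complex_of_real \<phi>) * complex_of_real (sinh s * sinh t)"
  have u: "jacobi_point_map s t p = arcosh (cmod (?a + ?b))" by (simp add: jacobi_point_map_def p)
  have ge: "1 \<le> cmod (?a + ?b)" by (rule jacobi_point_map_arg_ge_1[OF assms(1,2) r])
  then show nonneg: "0 \<le> jacobi_point_map s t p" by (simp add: u)
  have ch: "cosh (jacobi_point_map s t p) = cmod (?a + ?b)" using ge by (simp add: u cosh_arcosh_real)
  then show c2: "(cosh (jacobi_point_map s t p))\<^sup>2 = q"
    unfolding ch cmod_add_polar_squared by (simp add: q_def p)
  then show "(sinh (jacobi_point_map s t p))\<^sup>2 = q - 1"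
    by (simp add: sinh_square_eq)
  have pos: "0 \<le> sinh s * sinh t" "0 \<le> cosh s * cosh t" using assms by auto
  have "cmod ?b = r * (sinh s * sinh t)"
    using r assms by (simp add: norm_mult abs_mult)
  also have "\<dots> \<le> 1 * (sinh s * sinh t)"
    using r pos by (intro mult_right_mono) auto
  finally have "cmod ?b \<le> sinh s * sinh t" by simp
  moreover have "cmod ?a = cosh s * cosh t" using pos by (simp only: norm_of_real abs_of_nonneg)
  ultimately have "cmod (?a + ?b) \<le> cosh (s + t)"
    using norm_triangle_ineq[of ?a ?b] by (simp add: cosh_add)
  then have "cosh (jacobi_point_map s t p) \<le> cosh (s + t)" using ch by simp
  then show "jacobi_point_map s t p \<le> s + t"
    using nonneg assms by (simp add: cosh_real_nonneg_le_iff)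
qed

text \<open>
  Bounded random variables with equal moments have equal laws, by the Weierstrass approximation
  theorem.
\<close>
lemma integral_eq_of_moments_eq:
  fixes f :: "real \<Rightarrow> real"
  assumes M: "prob_space M" and N: "prob_space N"
    and X[measurable]: "X \<in> borel_measurable M" and Y[measurable]: "Y \<in> borel_measurable N"
    and bX: "\<And>x. x \<in> space M \<Longrightarrow> X x \<in> {a..b}" and bY: "\<And>x. x \<in> space N \<Longrightarrow> Y x \<in> {a..b}"
    and eq: "\<And>k. (LINT x|M. X x ^ k) = (LINT x|N. Y x ^ k)"
    and f: "continuous_on {a..b} f" and f_meas[measurable]: "f \<in> borel_measurable borel"
  shows "(LINT x|M. f (X x)) = (LINT x|N. f (Y x))"
proof -
  interpret M: prob_space M by fact
  interpret N: prob_space N by fact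
  obtain B where B: "\<And>y. y \<in> {a..b} \<Longrightarrow> \<bar>f y\<bar> \<le> B"
    using compact_imp_bounded[OF compact_continuous_image[OF f compact_Icc]]
    unfolding bounded_iff by (metis image_eqI real_norm_def)
  have fM: "integrable M (\<lambda>x. f (X x))"
    by (rule M.integrable_const_bound[where B = B]) (use B bX in auto)
  have fN: "integrable N (\<lambda>x. f (Y x))"
    by (rule N.integrable_const_bound[where B = B]) (use B bY in auto)
  have "\<bar>(LINT x|M. f (X x)) - (LINT x|N. f (Y x))\<bar> \<le> 2 * e" if e: "e > 0" for e
  proof -
    obtain g where g: "real_polynomial_function g" "\<And>x. x \<in> {a..b} \<Longrightarrow> \<bar>f x - g x\<bar> < e"
      using Stone_Weierstrass_real_polynomial_function[OF compact_Icc f e] by blast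
    obtain c n where gc: "g = (\<lambda>x. \<Sum>i\<le>n. c i * x ^ i)"
      using real_polynomial_function_imp_sum[OF g(1)] by blast
    have bd: "\<bar>y ^ i\<bar> \<le> (max \<bar>a\<bar> \<bar>b\<bar>) ^ i" if "y \<in> {a..b}" for y i
      using that by (auto simp: power_abs intro!: power_mono)
    have iM: "integrable M (\<lambda>x. X x ^ i)" for i
      by (rule M.integrable_const_bound[where B = "(max \<bar>a\<bar> \<bar>b\<bar>) ^ i"]) (use bd bX in auto)
    have iN: "integrable N (\<lambda>x. Y x ^ i)" for i
      by (rule N.integrable_const_bound[where B = "(max \<bar>a\<bar> \<bar>b\<bar>) ^ i"]) (use bd bY in auto)
    have gM: "integrable M (\<lambda>x. g (X x))" and gN: "integrable N (\<lambda>x. g (Y x))"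
      unfolding gc using iM iN by auto
    have geq: "(LINT x|M. g (X x)) = (LINT x|N. g (Y x))"
      unfolding gc using iM iN eq by simp
    have "\<bar>(LINT x|M. f (X x)) - (LINT x|M. g (X x))\<bar> \<le> e"
    proof -
      have "\<bar>LINT x|M. f (X x) - g (X x)\<bar> \<le> (LINT x|M. e)"
        using fM gM g(2) bX
        by (intro integral_abs_bound[THEN order_trans] integral_mono) (auto intro: less_imp_le)
      then show ?thesis using fM gM by (simp add: M.prob_space)
    qed
    moreover have "\<bar>(LINT x|N. f (Y x)) - (LINT x|N. g (Y x))\<bar> \<le> e"
    proof -
      have "\<bar>LINT x|N. f (Y x) - g (Y x)\<bar> \<le> (LINT x|N. e)"
        using fN gN g(2) bY
        by (intro integral_abs_bound[THEN order_trans] integral_mono) (auto intro: less_imp_le)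
      then show ?thesis using fN gN by (simp add: N.prob_space)
    qed
    ultimately show ?thesis using geq by linarith
  qed
  from this[of "\<bar>(LINT x|M. f (X x)) - (LINT x|N. f (Y x))\<bar> / 4"] show ?thesis by auto
qed

text \<open>
  The Jacobi function with spectral parameter such that it is the characteristic function of
  \<open>horo t\<close> under the disc measure.
\<close>
definition jacobi_char :: "real \<Rightarrow> real \<Rightarrow> real \<Rightarrow> real \<Rightarrow> complex" where
  "jacobi_char \<alpha> \<beta> \<theta> t = (LINT p|jacobi_measure \<alpha> \<beta>. iexp (\<theta> * horo t p))"

context jacobi_index
begin

lemma borel_measurable_horo_pair [measurable]:
  "(\<lambda>x. horo (fst x) (snd x)) \<in> borel_measurable (borel \<Otimes>\<^sub>M jacobi_measure \<alpha> \<beta>)"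
proof -
  have [measurable]: "cosh \<in> borel_measurable (borel :: real measure)" "sinh \<in> borel_measurable (borel :: real measure)"
    by (auto intro!: borel_measurable_continuous_onI continuous_intros)
  show ?thesis unfolding horo_def horo_sq_def by measurable
qed

lemma borel_measurable_horo [measurable (raw)]:
  assumes "f \<in> borel_measurable M" "g \<in> measurable M (jacobi_measure \<alpha> \<beta>)"
  shows "(\<lambda>x. horo (f x) (g x)) \<in> borel_measurable M"
  using measurable_compose[OF measurable_Pair[OF assms] borel_measurable_horo_pair] by simp

lemma measurable_jacobi_point_map_triple:
  "(\<lambda>x. jacobi_point_map (fst x) (fst (snd x)) (snd (snd x))) \<in>
     measurable (half_line \<Otimes>\<^sub>M (half_line \<Otimes>\<^sub>M jacobi_measure \<alpha> \<beta>)) half_line"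
proof (rule measurable_restrict_space2)
  let ?T = "half_line \<Otimes>\<^sub>M (half_line \<Otimes>\<^sub>M jacobi_measure \<alpha> \<beta>)"
  show "(\<lambda>x. jacobi_point_map (fst x) (fst (snd x)) (snd (snd x))) \<in> space ?T \<rightarrow> {0..}"
    using jacobi_point_map_props(1)
    by (auto simp: space_pair_measure space_restrict_space space_jacobi_measure)
  have [measurable]: "cosh \<in> borel_measurable (borel :: real measure)" "sinh \<in> borel_measurable (borel :: real measure)"
    by (auto intro!: borel_measurable_continuous_onI continuous_intros)
  have [measurable]: "(\<lambda>x. x) \<in> borel_measurable half_line" by (rule measurable_restrict_space1) simp
  have [measurable]: "fst \<in> borel_measurable ?T" "(\<lambda>x. fst (snd x)) \<in> borel_measurable ?T"
    by (rule measurable_compose[OF measurable_fst], simp)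
       (rule measurable_compose[OF measurable_snd], rule measurable_compose[OF measurable_fst], simp)
  show "(\<lambda>x. jacobi_point_map (fst x) (fst (snd x)) (snd (snd x))) \<in> borel_measurable ?T"
    unfolding jacobi_point_map_def arcosh_def case_prod_beta cis_conv_exp[symmetric] cis.code Complex_eq
    by measurable
qed

lemma integral_exp_horo:
  assumes "0 \<le> t"
  shows "(LINT p|jacobi_measure \<alpha> \<beta>. exp (2 * horo t p) ^ k) = bateman \<alpha> \<beta> k ((cosh t)\<^sup>2) ((sinh t)\<^sup>2)"
proof -
  have "(LINT p|jacobi_measure \<alpha> \<beta>. exp (2 * horo t p) ^ k) =
    (LINT p|jacobi_measure \<alpha> \<beta>. ((cosh t)\<^sup>2 + 2 * (fst p * cos (snd p)) * (cosh t * sinh t) + (fst p)\<^sup>2 * (sinh t)\<^sup>2) ^ k)"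
    using exp_horo assms
    by (intro Bochner_Integration.integral_cong) (simp_all add: space_jacobi_measure horo_sq_def)
  also have "\<dots> = bateman \<alpha> \<beta> k ((cosh t)\<^sup>2) ((sinh t)\<^sup>2)"
    by (rule integral_trinomial_jacobi_measure) (simp add: power_mult_distrib)
  finally show ?thesis .
qed

text \<open>
  The product formula for Jacobi functions. The left hand side is the characteristic function of
  \<open>X = horo s p + horo t q\<close> and the right hand side that of \<open>Y = horo u p\<close>, where \<open>u\<close> is distributed as
  the convolution of the point measures at \<open>s\<close> and \<open>t\<close>. Both variables are bounded by \<open>s + t\<close>, and the
  moments of \<open>exp (2 X)\<close> and \<open>exp (2 Y)\<close> agree by the product formula for Jacobi polynomials.
\<close>
lemma jacobi_char_product:
  assumes s: "0 \<le> s" and t: "0 \<le> t"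
  shows "jacobi_char \<alpha> \<beta> \<theta> s * jacobi_char \<alpha> \<beta> \<theta> t =
    (LINT w|jacobi_measure \<alpha> \<beta>. jacobi_char \<alpha> \<beta> \<theta> (jacobi_point_map s t w))"
proof -
  let ?m = "jacobi_measure \<alpha> \<beta>"
  interpret m: prob_space ?m by (rule prob_space_jacobi_measure)
  interpret mm: pair_prob_space ?m ?m ..
  let ?u = "jacobi_point_map s t"
  define X where "X z = horo s (fst z) + horo t (snd z)" for z
  define Y where "Y z = horo (?u (fst z)) (snd z)" for z
  have sp: "space (?m \<Otimes>\<^sub>M ?m) = ({0..1} \<times> {0..pi}) \<times> ({0..1} \<times> {0..pi})"
    by (simp add: space_pair_measure space_jacobi_measure)
  have [measurable]: "?u \<in> borel_measurable ?m"
    by (rule measurable_compose[OF jacobi_point_map_measurable[OF s t] measurable_restrict_space1]) simp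
  have [measurable]: "X \<in> borel_measurable (?m \<Otimes>\<^sub>M ?m)" "Y \<in> borel_measurable (?m \<Otimes>\<^sub>M ?m)"
    unfolding X_def[abs_def] Y_def[abs_def] by measurable
  have bX: "\<bar>X z\<bar> \<le> s + t" if "z \<in> space (?m \<Otimes>\<^sub>M ?m)" for z
    using that horo_bounds(3)[OF _ s, of "fst z"] horo_bounds(3)[OF _ t, of "snd z"]
    by (auto simp: sp X_def)
  have bY: "\<bar>Y z\<bar> \<le> s + t" if "z \<in> space (?m \<Otimes>\<^sub>M ?m)" for z
  proof -
    have z: "fst z \<in> {0..1} \<times> {0..pi}" "snd z \<in> {0..1} \<times> {0..pi}" using that by (auto simp: sp)
    show ?thesis
      using horo_bounds(3)[OF z(2) jacobi_point_map_props(1)[OF s t z(1)]]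
        jacobi_point_map_props(2)[OF s t z(1)] by (simp add: Y_def)
  qed
  have moments: "(LINT z|(?m \<Otimes>\<^sub>M ?m). exp (2 * X z) ^ k) = (LINT z|(?m \<Otimes>\<^sub>M ?m). exp (2 * Y z) ^ k)" for k
  proof -
    have bd: "integrable (?m \<Otimes>\<^sub>M ?m) (\<lambda>z. exp (2 * Z z) ^ k)"
      if "Z \<in> borel_measurable (?m \<Otimes>\<^sub>M ?m)" "\<And>z. z \<in> space (?m \<Otimes>\<^sub>M ?m) \<Longrightarrow> \<bar>Z z\<bar> \<le> s + t" for Z
    proof (rule mm.integrable_const_bound[where B = "exp (2 * (s + t)) ^ k"])
      show "AE z in ?m \<Otimes>\<^sub>M ?m. norm (exp (2 * Z z) ^ k) \<le> exp (2 * (s + t)) ^ k"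
      proof (rule AE_I2)
        fix z assume "z \<in> space (?m \<Otimes>\<^sub>M ?m)"
        then have "Z z \<le> s + t" using that(2) abs_le_D1 by blast
        then have "exp (2 * Z z) \<le> exp (2 * (s + t))" by simp
        from power_mono[OF this, of k] show "norm (exp (2 * Z z) ^ k) \<le> exp (2 * (s + t)) ^ k"
          by (simp add: norm_power)
      qed
    qed (use that(1) in measurable)
    have "\<alpha> > -1" "\<beta> > -1" using \<alpha>_gt \<beta>_ge by auto
    then obtain d n where
      d1: "\<And>q. bateman \<alpha> \<beta> k q (q - 1) = (\<Sum>i\<le>n. d i * q ^ i)" and
      d2: "\<And>a b. bateman \<alpha> \<beta> k (1 + a) a * bateman \<alpha> \<beta> k (1 + b) b =
         (\<Sum>i\<le>n. d i * bateman \<alpha> \<beta> i ((1 + a) * (1 + b)) (a * b))"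
      by (rule jacobi_poly_product[where k = k]) (rule that; assumption)
    \<comment> \<open>Q p is the square of cosh at the random endpoint, so its powers average to Bateman's sums.\<close>
    define Q where "Q p = (cosh s * cosh t)\<^sup>2 + 2 * (fst p * cos (snd p)) * ((cosh s * cosh t) * (sinh s * sinh t))
      + (fst p)\<^sup>2 * (sinh s * sinh t)\<^sup>2" for p :: "real \<times> real"
    have Qu: "Q p = (cosh (?u p))\<^sup>2" "Q p - 1 = (sinh (?u p))\<^sup>2" if "p \<in> space ?m" for p
      using jacobi_point_map_props(3,4)[OF s t, of p] that by (simp_all add: Q_def space_jacobi_measure)
    have Qm[measurable]: "Q \<in> borel_measurable ?m"
      unfolding Q_def by measurable
    have Qi: "integrable ?m (\<lambda>p. Q p ^ i)" for i
    proof (rule m.integrable_const_bound[where B = "((cosh (s + t))\<^sup>2) ^ i"])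
      have "\<bar>Q p ^ i\<bar> \<le> ((cosh (s + t))\<^sup>2) ^ i" if "p \<in> space ?m" for p
      proof -
        have p: "p \<in> {0..1} \<times> {0..pi}" using that by (simp add: space_jacobi_measure)
        have "cosh (?u p) \<le> cosh (s + t)"
          using jacobi_point_map_props(1,2)[OF s t p] s t by (simp add: cosh_real_nonneg_le_iff)
        then have "(cosh (?u p))\<^sup>2 \<le> (cosh (s + t))\<^sup>2" by (intro power_mono) auto
        then show ?thesis unfolding Qu(1)[OF that] by (simp add: power_abs power_mono)
      qed
      then show "AE p in ?m. norm (Q p ^ i) \<le> ((cosh (s + t))\<^sup>2) ^ i" by (intro AE_I2) simp
    qed measurable
    have "(LINT z|(?m \<Otimes>\<^sub>M ?m). exp (2 * X z) ^ k) = (LINT p|?m. LINT p'|?m. exp (2 * X (p, p')) ^ k)"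
      by (rule mm.integral_fst'[symmetric]) (rule bd, measurable, rule bX)
    also have "\<dots> = (LINT p|?m. LINT p'|?m. exp (2 * horo s p) ^ k * exp (2 * horo t p') ^ k)"
      by (simp add: X_def exp_add distrib_left power_mult_distrib)
    also have "\<dots> = bateman \<alpha> \<beta> k ((cosh s)\<^sup>2) ((sinh s)\<^sup>2) * bateman \<alpha> \<beta> k ((cosh t)\<^sup>2) ((sinh t)\<^sup>2)"
      by (simp add: integral_exp_horo s t)
    also have "\<dots> = (\<Sum>i\<le>n. d i * bateman \<alpha> \<beta> i ((cosh s * cosh t)\<^sup>2) ((sinh s * sinh t)\<^sup>2))"
      using d2[of "(sinh s)\<^sup>2" "(sinh t)\<^sup>2"] by (simp add: cosh_square_eq power_mult_distrib add.commute)
    also have "\<dots> = (\<Sum>i\<le>n. d i * (LINT w|?m. Q w ^ i))"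
      unfolding Q_def
      by (subst integral_trinomial_jacobi_measure) (simp_all add: power_mult_distrib)
    also have "\<dots> = (LINT w|?m. bateman \<alpha> \<beta> k (Q w) (Q w - 1))"
      unfolding d1 using Qi by simp
    also have "\<dots> = (LINT w|?m. LINT p|?m. exp (2 * Y (w, p)) ^ k)"
    proof (rule Bochner_Integration.integral_cong)
      fix w assume w: "w \<in> space ?m"
      have "0 \<le> ?u w" using jacobi_point_map_props(1)[OF s t] w by (simp add: space_jacobi_measure)
      then show "bateman \<alpha> \<beta> k (Q w) (Q w - 1) = (LINT p|?m. exp (2 * Y (w, p)) ^ k)"
        unfolding Qu(1)[OF w] by (simp add: Y_def integral_exp_horo sinh_square_eq)
    qed simp
    also have "\<dots> = (LINT z|(?m \<Otimes>\<^sub>M ?m). exp (2 * Y z) ^ k)"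
      by (rule mm.integral_fst') (rule bd, measurable, rule bY)
    finally show ?thesis .
  qed
  have real_eq: "(LINT z|(?m \<Otimes>\<^sub>M ?m). f (\<theta> * X z)) = (LINT z|(?m \<Otimes>\<^sub>M ?m). f (\<theta> * Y z))"
    if f: "continuous_on UNIV f" for f :: "real \<Rightarrow> real"
  proof -
    have fb: "f \<in> borel_measurable borel" using f by (rule borel_measurable_continuous_onI)
    have "(LINT z|(?m \<Otimes>\<^sub>M ?m). f (\<theta> * (ln (exp (2 * X z)) / 2))) = (LINT z|(?m \<Otimes>\<^sub>M ?m). f (\<theta> * (ln (exp (2 * Y z)) / 2)))"
    proof (rule integral_eq_of_moments_eq[where f = "\<lambda>x. f (\<theta> * (ln x / 2))" and a = "exp (- (2 * (s + t)))" and b = "exp (2 * (s + t))"])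
      show "continuous_on {exp (- (2 * (s + t)))..exp (2 * (s + t))} (\<lambda>x. f (\<theta> * (ln x / 2)))"
        by (rule continuous_on_compose2[OF f], intro continuous_intros)
           (use exp_gt_zero[of "- (2 * (s + t))"] in \<open>auto simp del: exp_gt_zero\<close>)
      show "(\<lambda>x. f (\<theta> * (ln x / 2))) \<in> borel_measurable borel"
        by (rule measurable_compose[OF _ fb]) measurable
      show "exp (2 * X z) \<in> {exp (- (2 * (s + t)))..exp (2 * (s + t))}" if "z \<in> space (?m \<Otimes>\<^sub>M ?m)" for z
        using bX[OF that] by auto
      show "exp (2 * Y z) \<in> {exp (- (2 * (s + t)))..exp (2 * (s + t))}" if "z \<in> space (?m \<Otimes>\<^sub>M ?m)" for z
        using bY[OF that] by auto
      show "(\<lambda>z. exp (2 * X z)) \<in> borel_measurable (?m \<Otimes>\<^sub>M ?m)" by measurable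
      show "(\<lambda>z. exp (2 * Y z)) \<in> borel_measurable (?m \<Otimes>\<^sub>M ?m)" by measurable
    qed (fact mm.prob_space_axioms mm.prob_space_axioms moments)+
    then show ?thesis by simp
  qed
  have int: "integrable (?m \<Otimes>\<^sub>M ?m) (\<lambda>z. iexp (\<theta> * Z z))" if [measurable]: "Z \<in> borel_measurable (?m \<Otimes>\<^sub>M ?m)" for Z
    by (rule mm.integrable_iexp) measurable
  have eq: "(LINT z|(?m \<Otimes>\<^sub>M ?m). iexp (\<theta> * X z)) = (LINT z|(?m \<Otimes>\<^sub>M ?m). iexp (\<theta> * Y z))"
  proof (rule complex_eqI)
    have Re: "Re (LINT z|(?m \<Otimes>\<^sub>M ?m). iexp (\<theta> * Z z)) = (LINT z|(?m \<Otimes>\<^sub>M ?m). cos (\<theta> * Z z))"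
     and Im: "Im (LINT z|(?m \<Otimes>\<^sub>M ?m). iexp (\<theta> * Z z)) = (LINT z|(?m \<Otimes>\<^sub>M ?m). sin (\<theta> * Z z))"
      if "Z \<in> borel_measurable (?m \<Otimes>\<^sub>M ?m)" for Z
      using int[OF that] by (simp_all flip: integral_Re integral_Im add: Re_exp Im_exp)
    show "Re (LINT z|(?m \<Otimes>\<^sub>M ?m). iexp (\<theta> * X z)) = Re (LINT z|(?m \<Otimes>\<^sub>M ?m). iexp (\<theta> * Y z))"
      by (subst (1 2) Re; measurable?) (rule real_eq, intro continuous_intros)
    show "Im (LINT z|(?m \<Otimes>\<^sub>M ?m). iexp (\<theta> * X z)) = Im (LINT z|(?m \<Otimes>\<^sub>M ?m). iexp (\<theta> * Y z))"
      by (subst (1 2) Im; measurable?) (rule real_eq, intro continuous_intros)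
  qed
  have "jacobi_char \<alpha> \<beta> \<theta> s * jacobi_char \<alpha> \<beta> \<theta> t = (LINT p|?m. LINT p'|?m. iexp (\<theta> * horo s p) * iexp (\<theta> * horo t p'))"
    unfolding jacobi_char_def by simp
  also have "\<dots> = (LINT p|?m. LINT p'|?m. iexp (\<theta> * X (p, p')))"
    by (simp add: X_def exp_add[symmetric] distrib_left)
  also have "\<dots> = (LINT z|(?m \<Otimes>\<^sub>M ?m). iexp (\<theta> * X z))"
    by (rule mm.integral_fst') (rule int, measurable)
  also have "\<dots> = (LINT z|(?m \<Otimes>\<^sub>M ?m). iexp (\<theta> * Y z))" by (rule eq)
  also have "\<dots> = (LINT w|?m. LINT p|?m. iexp (\<theta> * Y (w, p)))"
    by (rule mm.integral_fst'[symmetric]) (rule int, measurable)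
  also have "\<dots> = (LINT w|?m. jacobi_char \<alpha> \<beta> \<theta> (?u w))"
    by (simp add: Y_def jacobi_char_def)
  finally show ?thesis .
qed

end


section \<open>Characteristic functions and normal approximation\<close>
text \<open>
  The kernel in the inversion formula is at most \<open>2 / |t|\<close>, uniformly in the interval. Subtracting the
  formulas for the two laws and letting the left end point tend to minus infinity gives the bound.
\<close>
lemma cdf_diff_le_integral_char:
  assumes M: "real_distribution M" and N: "real_distribution N"
    and atoms: "\<And>x. measure M {x} = 0" "\<And>x. measure N {x} = 0"
    and b: "integrable lborel b"
    and le: "\<And>t. cmod (char M t - char N t) \<le> \<bar>t\<bar> * b t"
  shows "\<bar>cdf M x - cdf N x\<bar> \<le> (LINT t|lborel. b t) / pi"
proof -
  interpret M: real_distribution M by fact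
  interpret N: real_distribution N by fact
  have b0: "0 \<le> b t" if "t \<noteq> 0" for t
  proof -
    have "0 \<le> \<bar>t\<bar> * b t" by (rule order_trans[OF norm_ge_zero le])
    then show ?thesis using that by (simp add: zero_le_mult_iff)
  qed
  have b0': "AE t in lborel. 0 \<le> b t"
    by (rule eventually_mono[OF AE_lborel_singleton[of 0]]) (rule b0)
  have int: "\<bar>measure M {a<..x} - measure N {a<..x}\<bar> \<le> (LINT t|lborel. b t) / pi" if ax: "a \<le> x" for a
  proof -
    define K where "K t = (iexp (-(t * a)) - iexp (-(t * x))) / (\<i> * complex_of_real t)" for t
    have K2: "cmod (K t) \<le> 2 / \<bar>t\<bar>" for t
    proof -
      have "cmod (iexp (-(t * a)) - iexp (-(t * x))) \<le> 1 + 1"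
        by (rule order_trans[OF norm_triangle_ineq4]) (simp only: norm_exp_i_times order_refl)
      then show ?thesis by (simp add: K_def norm_divide norm_mult divide_right_mono)
    qed
    have K1: "cmod (K t) \<le> x - a" if "t \<noteq> 0" for t
      using Levy_Inversion_aux2[of "-x" "-a" t] that ax by (simp add: K_def)
    have [measurable]: "K \<in> borel_measurable borel" unfolding K_def[abs_def] by measurable
    have setint: "set_integrable lborel {-T..T} (\<lambda>t. K t * f t)"
      if [measurable]: "f \<in> borel_measurable borel" and f: "\<And>t. cmod (f t) \<le> 1" for f :: "real \<Rightarrow> complex" and T
      unfolding set_integrable_def
    proof (rule integrableI_bounded_set_indicator[where B = "x - a"])
      show "emeasure lborel {-T..T} < \<infinity>" by (cases "-T \<le> T") simp_all
      have "cmod (K t * f t) \<le> x - a" if "t \<noteq> 0" for t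
        using mult_mono[OF K1[OF that] f[of t]] ax by (simp add: norm_mult)
      then show "AE t in lborel. t \<in> {-T..T} \<longrightarrow> norm (K t * f t) \<le> x - a"
        by (intro eventually_mono[OF AE_lborel_singleton[of 0]]) auto
    qed measurable
    have I: "(CLBINT t=ereal (- real n)..ereal (real n). K t * f t) = (CLBINT t:{-real n..real n}. K t * f t)" for n :: nat and f
      using interval_integral_Icc[of "- real n" "real n"] by simp
    have lim: "(\<lambda>n. 1 / (2 * pi) * (CLBINT t:{-real n..real n}. K t * char M t)
         - 1 / (2 * pi) * (CLBINT t:{-real n..real n}. K t * char N t))
      \<longlonglongrightarrow> complex_of_real (measure M {a<..x}) - complex_of_real (measure N {a<..x})"
      using tendsto_diff[OF M.Levy_Inversion[OF ax atoms(1) atoms(1)] N.Levy_Inversion[OF ax atoms(2) atoms(2)]]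
      unfolding K_def[symmetric] by (simp add: I)
    have bound: "cmod (1 / (2 * pi) * (CLBINT t:{-real n..real n}. K t * char M t)
         - 1 / (2 * pi) * (CLBINT t:{-real n..real n}. K t * char N t)) \<le> (LINT t|lborel. b t) / pi" for n :: nat
    proof -
      have si: "set_integrable lborel {-real n..real n} (\<lambda>t. K t * char M t)"
        "set_integrable lborel {-real n..real n} (\<lambda>t. K t * char N t)"
        by (auto intro!: setint M.cmod_char_le_1 N.cmod_char_le_1)
      have "cmod ((CLBINT t:{-real n..real n}. K t * char M t) - (CLBINT t:{-real n..real n}. K t * char N t))
         = cmod (CLBINT t:{-real n..real n}. K t * char M t - K t * char N t)"
        by (subst set_integral_diff[OF si]) simp
      also have "\<dots> \<le> (LINT t|lborel. 2 * b t)"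
        unfolding set_lebesgue_integral_def
      proof (rule order_trans[OF integral_norm_bound integral_mono_AE])
        show "integrable lborel (\<lambda>t. norm (indicator {-real n..real n} t *\<^sub>R (K t * char M t - K t * char N t)))"
          using set_integral_diff(1)[OF si] by (intro integrable_norm) (simp add: set_integrable_def)
        show "integrable lborel (\<lambda>t. 2 * b t)" using b by simp
        show "AE t in lborel. norm (indicator {-real n..real n} t *\<^sub>R (K t * char M t - K t * char N t)) \<le> 2 * b t"
        proof (rule eventually_mono[OF AE_lborel_singleton[of 0]])
          fix t :: real assume t: "t \<noteq> 0"
          have "cmod (K t * char M t - K t * char N t) = cmod (K t) * cmod (char M t - char N t)"
            by (simp add: norm_mult right_diff_distrib[symmetric])
          also have "\<dots> \<le> 2 / \<bar>t\<bar> * (\<bar>t\<bar> * b t)"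
            by (rule mult_mono[OF K2 le]) auto
          finally have "cmod (K t * char M t - K t * char N t) \<le> 2 * b t" using t by simp
          then show "norm (indicator {-real n..real n} t *\<^sub>R (K t * char M t - K t * char N t)) \<le> 2 * b t"
            using b0[OF t] by (auto simp: indicator_def)
        qed
      qed
      finally have "cmod ((CLBINT t:{-real n..real n}. K t * char M t) - (CLBINT t:{-real n..real n}. K t * char N t))
        \<le> 2 * (LINT t|lborel. b t)" by simp
      then show ?thesis
        unfolding right_diff_distrib[symmetric] norm_mult
        by (simp add: norm_divide norm_mult field_simps)
    qed
    have "cmod (complex_of_real (measure M {a<..x}) - complex_of_real (measure N {a<..x})) \<le> (LINT t|lborel. b t) / pi"
      by (rule LIMSEQ_le_const2[OF tendsto_norm[OF lim]]) (use bound in blast)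
    then show ?thesis unfolding of_real_diff[symmetric] norm_of_real .
  qed
  have "(\<lambda>i. \<bar>(cdf M x - cdf M (- real i)) - (cdf N x - cdf N (- real i))\<bar>) \<longlonglongrightarrow> \<bar>(cdf M x - 0) - (cdf N x - 0)\<bar>"
    by (intro tendsto_intros M.cdf_lim_neg_infty N.cdf_lim_neg_infty)
  moreover have "\<exists>n0. \<forall>i\<ge>n0. \<bar>(cdf M x - cdf M (- real i)) - (cdf N x - cdf N (- real i))\<bar> \<le> (LINT t|lborel. b t) / pi"
  proof (intro exI allI impI)
    fix i assume "i \<ge> nat \<lceil>\<bar>x\<bar>\<rceil> + 1"
    then have "- real i < x" by linarith
    then show "\<bar>(cdf M x - cdf M (- real i)) - (cdf N x - cdf N (- real i))\<bar> \<le> (LINT t|lborel. b t) / pi"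
      using int[of "- real i"] by (simp add: M.cdf_diff_eq N.cdf_diff_eq)
  qed
  ultimately have "\<bar>(cdf M x - 0) - (cdf N x - 0)\<bar> \<le> (LINT t|lborel. b t) / pi"
    by (rule LIMSEQ_le_const2)
  then show ?thesis by simp
qed

text \<open>
  A random variable may be replaced by a close one at the price of the probability that they differ by
  more than \<open>\<delta>\<close> and of the oscillation of the limit distribution function over distance \<open>\<delta>\<close>.
\<close>
lemma (in prob_space) cdf_perturbation:
  fixes Y Y' :: "'a \<Rightarrow> real"
  assumes [measurable]: "Y \<in> borel_measurable M" "Y' \<in> borel_measurable M"
    and close: "\<And>x. \<bar>cdf (distr M borel Y') x - F x\<bar> \<le> B"
    and lip: "\<And>x y. x \<le> y \<Longrightarrow> F y - F x \<le> L * (y - x)"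
    and \<delta>: "0 \<le> \<delta>"
    and tail: "prob {\<omega>\<in>space M. \<bar>Y \<omega> - Y' \<omega>\<bar> > \<delta>} \<le> \<tau>"
  shows "\<bar>cdf (distr M borel Y) x - F x\<bar> \<le> B + L * \<delta> + \<tau>"
proof -
  have cdf: "cdf (distr M borel Z) y = prob {\<omega>\<in>space M. Z \<omega> \<le> y}" if "Z \<in> borel_measurable M" for Z y
    unfolding cdf_def using that by (simp add: measure_distr vimage_def Int_def conj_commute)
  have "prob {\<omega>\<in>space M. Y \<omega> \<le> x} \<le> prob ({\<omega>\<in>space M. Y' \<omega> \<le> x + \<delta>} \<union> {\<omega>\<in>space M. \<bar>Y \<omega> - Y' \<omega>\<bar> > \<delta>})"
    by (intro finite_measure_mono) auto
  also have "\<dots> \<le> prob {\<omega>\<in>space M. Y' \<omega> \<le> x + \<delta>} + prob {\<omega>\<in>space M. \<bar>Y \<omega> - Y' \<omega>\<bar> > \<delta>}"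
    by (rule measure_Un_le) measurable
  finally have 1: "prob {\<omega>\<in>space M. Y \<omega> \<le> x} \<le> prob {\<omega>\<in>space M. Y' \<omega> \<le> x + \<delta>} + \<tau>"
    using tail by linarith
  have "prob {\<omega>\<in>space M. Y' \<omega> \<le> x - \<delta>} \<le> prob ({\<omega>\<in>space M. Y \<omega> \<le> x} \<union> {\<omega>\<in>space M. \<bar>Y \<omega> - Y' \<omega>\<bar> > \<delta>})"
    by (intro finite_measure_mono) auto
  also have "\<dots> \<le> prob {\<omega>\<in>space M. Y \<omega> \<le> x} + prob {\<omega>\<in>space M. \<bar>Y \<omega> - Y' \<omega>\<bar> > \<delta>}"
    by (rule measure_Un_le) measurable
  finally have 2: "prob {\<omega>\<in>space M. Y' \<omega> \<le> x - \<delta>} \<le> prob {\<omega>\<in>space M. Y \<omega> \<le> x} + \<tau>"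
    using tail by linarith
  show ?thesis
    using 1 2 close[of "x + \<delta>"] close[of "x - \<delta>"] lip[of x "x + \<delta>"] lip[of "x - \<delta>" x] \<delta>
    by (simp add: cdf abs_le_iff)
qed

lemma distr_std_normal:
  assumes "0 < \<sigma>"
  shows "distr std_normal_distribution borel (\<lambda>x. \<sigma> * x) = density lborel (normal_density 0 \<sigma>)"
proof -
  interpret real_distribution std_normal_distribution by (rule real_dist_normal_dist)
  have "distributed std_normal_distribution lborel (\<lambda>x. x) std_normal_density"
    by (auto simp: distributed_def distr_id2)
  from normal_density_affine[OF this, of \<sigma> 0] assms
  have "distributed std_normal_distribution lborel (\<lambda>x. \<sigma> * x) (normal_density 0 \<sigma>)" by simp
  then show ?thesis by (simp add: distributed_def cong: distr_cong)
qed

lemma real_distribution_normal: "0 < \<sigma> \<Longrightarrow> real_distribution (density lborel (normal_density \<mu> \<sigma>))"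
  using prob_space_normal_density[of \<sigma> \<mu>] by (simp add: real_distribution_def real_distribution_axioms_def)

lemma char_normal:
  assumes "0 < \<sigma>"
  shows "char (density lborel (normal_density 0 \<sigma>)) t = complex_of_real (exp (- (\<sigma>\<^sup>2 * t\<^sup>2 / 2)))"
proof -
  have "char (density lborel (normal_density 0 \<sigma>)) t = char std_normal_distribution (t * \<sigma>)"
    unfolding distr_std_normal[OF assms, symmetric] char_def
    by (subst integral_distr) (auto simp: mult_ac)
  then show ?thesis by (simp add: char_std_normal_distribution power_mult_distrib mult_ac)
qed

text \<open>
  The constant \<open>1 / \<sigma>\<close> is a crude bound for the density.
\<close>
lemma cdf_normal_lipschitz:
  assumes \<sigma>: "0 < \<sigma>" and xy: "x \<le> y"
  shows "cdf (density lborel (normal_density 0 \<sigma>)) y - cdf (density lborel (normal_density 0 \<sigma>)) x \<le> (1 / \<sigma>) * (y - x)"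
proof (cases "x = y")
  case False
  let ?N = "density lborel (normal_density 0 \<sigma>)"
  interpret real_distribution ?N by (rule real_distribution_normal[OF \<sigma>])
  have le: "normal_density 0 \<sigma> z \<le> 1 / \<sigma>" for z
  proof -
    have "1 \<le> sqrt (2 * pi)" using pi_ge_two by (intro real_le_rsqrt) simp
    then have "1 / sqrt (2 * pi * \<sigma>\<^sup>2) \<le> 1 / \<sigma>"
      using \<sigma> by (simp add: real_sqrt_mult field_simps)
    then have "1 / sqrt (2 * pi * \<sigma>\<^sup>2) * exp (- (z - 0)\<^sup>2 / (2 * \<sigma>\<^sup>2)) \<le> 1 / \<sigma> * 1"
      using \<sigma> by (intro mult_mono) auto
    then show ?thesis by (simp add: normal_density_def)
  qed
  have "emeasure ?N {x<..y} = (\<integral>\<^sup>+z. ennreal (normal_density 0 \<sigma> z) * indicator {x<..y} z \<partial>lborel)"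
    by (rule emeasure_density) auto
  also have "\<dots> \<le> (\<integral>\<^sup>+z. ennreal (1 / \<sigma>) * indicator {x<..y} z \<partial>lborel)"
    using le by (intro nn_integral_mono mult_right_mono ennreal_leI) auto
  also have "\<dots> = ennreal (1 / \<sigma> * (y - x))"
    using xy \<sigma> by (simp add: nn_integral_cmult ennreal_mult'[symmetric])
  finally have "measure ?N {x<..y} \<le> 1 / \<sigma> * (y - x)"
    using xy \<sigma> by (simp add: measure_def enn2real_leI)
  then show ?thesis using cdf_diff_eq[of x y] False xy by simp
qed simp

lemma measure_singleton_normal: "measure (density lborel (normal_density 0 \<sigma>)) {x} = 0"
proof -
  have "emeasure (density lborel (normal_density 0 \<sigma>)) {x} =
      (\<integral>\<^sup>+z. ennreal (normal_density 0 \<sigma> z) * indicator {x} z \<partial>lborel)"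
    by (rule emeasure_density) auto
  also have "\<dots> = (\<integral>\<^sup>+z. 0 \<partial>(lborel :: real measure))"
    by (intro nn_integral_cong_AE eventually_mono[OF AE_lborel_singleton[of x]]) (auto simp: indicator_def)
  finally show ?thesis by (simp add: measure_def)
qed


text \<open>
  The bound \<open>n |z - w|\<close> for numbers in the unit disc, rescaled to the disc of radius \<open>r\<close>. The factor
  \<open>r^n\<close> is what makes the estimate integrable later.
\<close>
lemma power_diff_le_exp:
  fixes z w :: complex
  assumes z: "cmod z \<le> r" and w: "cmod w \<le> r" and r: "0 < r"
  shows "cmod (z ^ n - w ^ n) \<le> real n * r ^ n / r * cmod (z - w)"
proof -
  define z' w' where "z' = z / of_real r" and "w' = w / of_real r"
  have zw: "z = of_real r * z'" "w = of_real r * w'" using r by (simp_all add: z'_def w'_def)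
  have "cmod z' \<le> 1" "cmod w' \<le> 1"
    using assms by (simp_all add: z'_def w'_def norm_divide)
  then have "cmod (z' ^ n - w' ^ n) \<le> real n * cmod (z' - w')" by (rule norm_power_diff)
  moreover have "cmod (z ^ n - w ^ n) = r ^ n * cmod (z' ^ n - w' ^ n)"
    unfolding zw power_mult_distrib right_diff_distrib[symmetric] norm_mult using r by (simp add: norm_power)
  moreover have "cmod (z - w) = r * cmod (z' - w')"
    unfolding zw right_diff_distrib[symmetric] norm_mult using r by simp
  ultimately show ?thesis using r by simp
qed

text \<open>
  The analytic half of the central limit theorem, stated for powers of a characteristic function
  since the variables considered here are only known to be distributed like sums.
\<close>
lemma (in real_distribution) char_power_tendsto:
  assumes int1: "integrable M (\<lambda>x. x)" and mean: "expectation (\<lambda>x. x) = 0"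
    and int2: "integrable M (\<lambda>x. x^2)" and var: "expectation (\<lambda>x. x^2) = \<sigma>2"
  shows "(\<lambda>n. char M (t / sqrt (real n)) ^ n) \<longlonglongrightarrow> complex_of_real (exp (- (\<sigma>2 * t\<^sup>2 / 2)))"
proof -
  have var': "variance (\<lambda>x. x) = \<sigma>2" using var mean by simp
  have s0: "0 \<le> \<sigma>2" unfolding var[symmetric] by simp
  define h where "h n = (LINT x|M. min (6 * x\<^sup>2) (\<bar>t / sqrt (real n)\<bar> * \<bar>x\<bar> ^ 3))" for n :: nat
  have main: "cmod (char M (t / sqrt (real n)) ^ n - complex_of_real ((1 + (- (\<sigma>2 * t\<^sup>2 / 2)) / real n) ^ n)) \<le> t\<^sup>2 / 6 * h n"
    if n: "n \<ge> nat \<lceil>\<sigma>2 * t\<^sup>2 / 4\<rceil> + 1" for n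
  proof -
    let ?u = "t / sqrt (real n)"
    have n0: "real n > 0" using n by simp
    have n4: "\<sigma>2 * t\<^sup>2 / 4 \<le> real n" using n by linarith
    have u2: "?u\<^sup>2 = t\<^sup>2 / real n" using n0 by (simp add: power_divide)
    have e: "1 - ?u\<^sup>2 * \<sigma>2 / 2 = 1 + (- (\<sigma>2 * t\<^sup>2 / 2)) / real n"
      unfolding u2 by (simp add: mult_ac)
    have "norm (complex_of_real (1 + (- (\<sigma>2 * t\<^sup>2 / 2)) / real n)) \<le> 1"
      unfolding norm_of_real using n4 n0 s0 by (intro abs_leI) (auto simp: field_simps)
    then have "cmod (char M ?u ^ n - (complex_of_real (1 + (- (\<sigma>2 * t\<^sup>2 / 2)) / real n)) ^ n)
       \<le> real n * cmod (char M ?u - complex_of_real (1 + (- (\<sigma>2 * t\<^sup>2 / 2)) / real n))"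
      by (intro norm_power_diff cmod_char_le_1)
    also have "\<dots> \<le> real n * (?u\<^sup>2 / 6 * h n)"
      using char_approx3[OF int1 mean int2 var', of ?u] unfolding e h_def
      by (intro mult_left_mono) auto
    also have "\<dots> = t\<^sup>2 / 6 * h n" unfolding u2 using n0 by simp
    finally show ?thesis by simp
  qed
  have hlim: "h \<longlonglongrightarrow> 0"
  proof -
    have "(\<lambda>n. min (6 * x\<^sup>2) (\<bar>t / sqrt (real n)\<bar> * \<bar>x\<bar> ^ 3)) \<longlonglongrightarrow> 0" for x :: real
    proof -
      have "(\<lambda>n. \<bar>t / sqrt (real n)\<bar> * \<bar>x\<bar> ^ 3) \<longlonglongrightarrow> \<bar>0\<bar> * \<bar>x\<bar> ^ 3"
        by (intro tendsto_intros tendsto_divide_0[OF tendsto_const] filterlim_at_top_imp_at_infinity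
             filterlim_compose[OF sqrt_at_top] filterlim_real_sequentially)
      then have "(\<lambda>n. min (6 * x\<^sup>2) (\<bar>t / sqrt (real n)\<bar> * \<bar>x\<bar> ^ 3)) \<longlonglongrightarrow> min (6 * x\<^sup>2) 0"
        by (intro tendsto_min tendsto_const) simp
      then show ?thesis by simp
    qed
    then have "(\<lambda>n. LINT x|M. min (6 * x\<^sup>2) (\<bar>t / sqrt (real n)\<bar> * \<bar>x\<bar> ^ 3)) \<longlonglongrightarrow> (LINT x|M. 0)"
      using int2 by (intro integral_dominated_convergence[where w = "\<lambda>x. 6 * x\<^sup>2"]) auto
    then show ?thesis by (simp add: h_def[abs_def])
  qed
  have "(\<lambda>n. t\<^sup>2 / 6 * h n) \<longlonglongrightarrow> t\<^sup>2 / 6 * 0" by (intro tendsto_intros hlim)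
  then have null: "(\<lambda>n. t\<^sup>2 / 6 * h n) \<longlonglongrightarrow> 0" by simp
  have ev: "\<forall>\<^sub>F n in sequentially. cmod (char M (t / sqrt (real n)) ^ n - complex_of_real ((1 + (- (\<sigma>2 * t\<^sup>2 / 2)) / real n) ^ n)) \<le> t\<^sup>2 / 6 * h n"
    using main by (rule eventually_sequentiallyI)
  have diff: "(\<lambda>n. char M (t / sqrt (real n)) ^ n - complex_of_real ((1 + (- (\<sigma>2 * t\<^sup>2 / 2)) / real n) ^ n)) \<longlonglongrightarrow> 0"
    by (rule Lim_null_comparison[OF ev null])
  have lim: "(\<lambda>n. complex_of_real ((1 + (- (\<sigma>2 * t\<^sup>2 / 2)) / real n) ^ n)) \<longlonglongrightarrow> complex_of_real (exp (- (\<sigma>2 * t\<^sup>2 / 2)))"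
    by (rule isCont_tendsto_compose[OF _ tendsto_exp_limit_sequentially]) auto
  show ?thesis by (rule Lim_transform[OF lim diff])
qed

lemma integrable_power_gaussian:
  fixes a :: real
  assumes a: "0 < a"
  shows "integrable lborel (\<lambda>t. \<bar>t\<bar> ^ k * exp (- (a * t\<^sup>2)))"
proof -
  define \<sigma> where "\<sigma> = 1 / sqrt (2 * a)"
  have s: "0 < \<sigma>" "2 * \<sigma>\<^sup>2 = 1 / a" using a by (simp_all add: \<sigma>_def power_divide)
  have "integrable lborel (\<lambda>t. sqrt (2 * pi * \<sigma>\<^sup>2) * (normal_density 0 \<sigma> t * \<bar>t - 0\<bar> ^ k))"
    by (intro integrable_mult_right integrable_normal_moment_abs s)
  also have "(\<lambda>t. sqrt (2 * pi * \<sigma>\<^sup>2) * (normal_density 0 \<sigma> t * \<bar>t - 0\<bar> ^ k)) = (\<lambda>t. \<bar>t\<bar> ^ k * exp (- (a * t\<^sup>2)))"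
    using s a by (simp add: normal_density_def fun_eq_iff mult_ac)
  finally show ?thesis .
qed

lemma integral_gaussian_scale:
  fixes e :: real
  assumes "0 < e"
  shows "(LINT t|lborel. exp (- (e\<^sup>2 * t\<^sup>2 / 4))) = (LINT t|lborel. exp (- ((t::real)\<^sup>2 / 4))) / e"
proof -
  have "(LINT t|lborel. exp (- ((t::real)\<^sup>2 / 4))) = \<bar>e\<bar> *\<^sub>R (LINT t|lborel. exp (- ((0 + e * t)\<^sup>2 / 4)))"
    by (rule lborel_integral_real_affine) (use assms in simp)
  then show ?thesis using assms by (simp add: power_mult_distrib)
qed

lemma abs_exp_minus_linear_le:
  fixes y :: real
  assumes y0: "0 \<le> y"
  shows "\<bar>exp (- y) - (1 - y)\<bar> \<le> y\<^sup>2 / 2"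
proof -
  have "1 - y \<le> exp (- y)" using exp_ge_add_one_self[of "-y"] by simp
  moreover have "exp (- y) \<le> 1 - y + y\<^sup>2 / 2"
  proof -
    have pos: "0 < 1 + y + y\<^sup>2 / 2" using y0 by (simp add: add_pos_nonneg)
    have "1 + y + y\<^sup>2 / 2 \<le> exp y" by (rule exp_lower_Taylor_quadratic[OF y0])
    then have "exp (- y) \<le> 1 / (1 + y + y\<^sup>2 / 2)"
      unfolding exp_minus using pos by (simp add: field_simps)
    also have "\<dots> \<le> 1 - y + y\<^sup>2 / 2"
    proof -
      have "(1 - y + y\<^sup>2 / 2) * (1 + y + y\<^sup>2 / 2) = 1 + y ^ 4 / 4"
        by (simp add: field_simps power2_eq_square power4_eq_xxxx)
      then show ?thesis using y0 pos by (simp add: divide_le_eq)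
    qed
    finally show ?thesis .
  qed
  ultimately show ?thesis by simp
qed

text \<open>
  Near 0 both the characteristic function and its normal counterpart are bounded by
  \<open>exp (- \<sigma>^2 u^2 / 4)\<close>, and they differ by a multiple of \<open>|u|^3\<close>.
\<close>
lemma (in real_distribution) char_power_diff_near_0:
  assumes int1: "integrable M (\<lambda>x. x)" and mean: "expectation (\<lambda>x. x) = 0"
    and int2: "integrable M (\<lambda>x. x^2)" and var: "expectation (\<lambda>x. x^2) = \<sigma>\<^sup>2" and \<sigma>: "0 < \<sigma>"
    and int3: "integrable M (\<lambda>x. \<bar>x\<bar>^3)"
  obtains c K where "0 < c" "0 \<le> K"
    "\<And>u n. \<bar>u\<bar> \<le> c \<Longrightarrow> cmod (char M u ^ n - complex_of_real (exp (- (\<sigma>\<^sup>2 * u\<^sup>2 / 2))) ^ n)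
      \<le> 3 * K * (real n * \<bar>u\<bar> ^ 3 * exp (- (\<sigma>\<^sup>2 * (real n * u\<^sup>2) / 4)))"
proof -
  have var': "variance (\<lambda>x. x) = \<sigma>\<^sup>2" using var mean by simp
  define \<rho> where "\<rho> = expectation (\<lambda>x. \<bar>x\<bar>^3)"
  have \<rho>0: "0 \<le> \<rho>" unfolding \<rho>_def by (intro integral_nonneg_AE) simp
  \<comment> \<open>The first bound keeps y = sigma^2 u^2 / 2 below 1/2; the second makes the cubic error
    at most half of y.\<close>
  define c where "c = min (1 / \<sigma>) (3 * \<sigma>\<^sup>2 / (2 * (\<rho> + 1)))"
  have c0: "0 < c" using \<sigma> \<rho>0 by (simp add: c_def)
  have c1: "\<sigma> * c \<le> 1" 
  proof -
    have "\<sigma> * c \<le> \<sigma> * (1 / \<sigma>)" unfolding c_def using \<sigma> by (intro mult_left_mono) auto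
    then show ?thesis using \<sigma> by simp
  qed
  have c2: "\<rho> * c \<le> 3 * \<sigma>\<^sup>2 / 2"
  proof -
    have "\<rho> * c \<le> (\<rho> + 1) * (3 * \<sigma>\<^sup>2 / (2 * (\<rho> + 1)))"
      unfolding c_def using \<rho>0 \<sigma> by (intro mult_mono) auto
    also have "\<dots> = (3 * \<sigma>\<^sup>2 / 2) * ((\<rho> + 1) / (\<rho> + 1))"
      by (simp add: field_simps)
    also have "\<dots> = 3 * \<sigma>\<^sup>2 / 2" using \<rho>0 by simp
    finally show ?thesis .
  qed
  have a3: "cmod (char M u - complex_of_real (1 - u\<^sup>2 * \<sigma>\<^sup>2 / 2)) \<le> \<rho> / 6 * \<bar>u\<bar> ^ 3" for u
  proof -
    have "cmod (char M u - complex_of_real (1 - u\<^sup>2 * \<sigma>\<^sup>2 / 2)) \<le> (u\<^sup>2 / 6) * expectation (\<lambda>x. min (6 * x^2) (\<bar>u\<bar> * \<bar>x\<bar>^3))"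
      using char_approx3[OF int1 mean int2 var', of u] by simp
    also have "\<dots> \<le> (u\<^sup>2 / 6) * expectation (\<lambda>x. \<bar>u\<bar> * \<bar>x\<bar>^3)"
      using int2 int3 by (intro mult_left_mono integral_mono) auto
    also have "\<dots> = \<rho> / 6 * \<bar>u\<bar> ^ 3" by (simp add: \<rho>_def power2_eq_square power3_eq_cube abs_mult_self_eq)
    finally show ?thesis .
  qed
  define K where "K = \<rho> / 6 + \<sigma> ^ 4 * c / 8"
  have K0: "0 \<le> K" using \<rho>0 c0 by (simp add: K_def)
  have inner: "cmod (char M u ^ n - complex_of_real (exp (- (\<sigma>\<^sup>2 * u\<^sup>2 / 2))) ^ n)
      \<le> 3 * K * (real n * \<bar>u\<bar> ^ 3 * exp (- (\<sigma>\<^sup>2 * (real n * u\<^sup>2) / 4)))" if u: "\<bar>u\<bar> \<le> c" for u n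
  proof -
    define y where "y = \<sigma>\<^sup>2 * u\<^sup>2 / 2"
    have y0: "0 \<le> y" by (simp add: y_def)
    have u2: "u\<^sup>2 \<le> c\<^sup>2" using power_mono[OF u, of 2] by simp
    have "\<sigma>\<^sup>2 * u\<^sup>2 \<le> (\<sigma> * c)\<^sup>2" unfolding power_mult_distrib by (intro mult_left_mono u2) simp
    also have "\<dots> \<le> 1\<^sup>2" by (intro power_mono c1) (use \<sigma> c0 in auto)
    finally have y1: "y \<le> 1 / 2" by (simp add: y_def)
    have z_le: "cmod (char M u) \<le> exp (- (y / 2))"
    proof -
      have "cmod (char M u) \<le> cmod (char M u - complex_of_real (1 - u\<^sup>2 * \<sigma>\<^sup>2 / 2)) + cmod (complex_of_real (1 - u\<^sup>2 * \<sigma>\<^sup>2 / 2))"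
        by norm
      also have "cmod (complex_of_real (1 - u\<^sup>2 * \<sigma>\<^sup>2 / 2)) = 1 - y"
        unfolding norm_of_real using y1 by (simp add: y_def mult_ac)
      also have "cmod (char M u - complex_of_real (1 - u\<^sup>2 * \<sigma>\<^sup>2 / 2)) \<le> y / 2"
      proof -
        have "\<rho> / 6 * \<bar>u\<bar> ^ 3 = \<rho> * \<bar>u\<bar> * u\<^sup>2 / 6" by (simp add: power3_eq_cube power2_eq_square)
        also have "\<dots> \<le> (3 * \<sigma>\<^sup>2 / 2) * u\<^sup>2 / 6"
          using order_trans[OF mult_left_mono[OF u \<rho>0] c2]
          by (intro divide_right_mono mult_right_mono) auto
        also have "\<dots> = y / 2" by (simp add: y_def)
        finally show ?thesis using a3[of u] by linarith
      qed
      finally have "cmod (char M u) \<le> 1 + (- (y / 2))" by simp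
      then show ?thesis using exp_ge_add_one_self[of "- (y / 2)"] by linarith
    qed
    have w_le: "cmod (complex_of_real (exp (- y))) \<le> exp (- (y / 2))"
      using y0 by simp
    have diff: "cmod (char M u - complex_of_real (exp (- y))) \<le> K * \<bar>u\<bar> ^ 3"
    proof -
      have "\<bar>exp (- y) - (1 - y)\<bar> \<le> y\<^sup>2 / 2" by (rule abs_exp_minus_linear_le[OF y0])
      also have "y\<^sup>2 / 2 = \<sigma> ^ 4 * \<bar>u\<bar> * \<bar>u\<bar> ^ 3 / 8"
        by (simp add: y_def power2_eq_square power4_eq_xxxx power3_eq_cube)
      also have "\<dots> \<le> \<sigma> ^ 4 * c * \<bar>u\<bar> ^ 3 / 8"
        using u by (intro divide_right_mono mult_right_mono mult_left_mono) auto
      finally have 1: "\<bar>exp (- y) - (1 - y)\<bar> \<le> \<sigma> ^ 4 * c / 8 * \<bar>u\<bar> ^ 3" by simp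
      have "char M u - complex_of_real (exp (- y)) =
        (char M u - complex_of_real (1 - u\<^sup>2 * \<sigma>\<^sup>2 / 2)) - complex_of_real (exp (- y) - (1 - y))"
        by (simp add: y_def mult_ac)
      also have "cmod \<dots> \<le> \<rho> / 6 * \<bar>u\<bar> ^ 3 + \<sigma> ^ 4 * c / 8 * \<bar>u\<bar> ^ 3"
        by (rule order_trans[OF norm_triangle_ineq4 add_mono[OF a3]]) (use 1 in \<open>simp only: norm_of_real\<close>)
      finally show ?thesis by (simp add: K_def algebra_simps)
    qed
    have "cmod (char M u ^ n - complex_of_real (exp (- y)) ^ n)
       \<le> real n * exp (- (y / 2)) ^ n / exp (- (y / 2)) * cmod (char M u - complex_of_real (exp (- y)))"
      by (rule power_diff_le_exp[OF z_le w_le]) simp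
    also have "\<dots> \<le> real n * exp (- (y / 2)) ^ n / exp (- (y / 2)) * (K * \<bar>u\<bar> ^ 3)"
      by (intro mult_left_mono diff) auto
    also have "\<dots> = exp (y / 2) * (K * (real n * \<bar>u\<bar> ^ 3 * exp (- (y / 2)) ^ n))"
      by (simp add: exp_minus field_simps)
    also have "\<dots> \<le> 3 * (K * (real n * \<bar>u\<bar> ^ 3 * exp (- (y / 2)) ^ n))"
    proof (rule mult_right_mono)
      have "exp (y / 2) \<le> exp 1" using y1 by simp
      then show "exp (y / 2) \<le> 3" using exp_le by linarith
    qed (use K0 in auto)
    also have "exp (- (y / 2)) ^ n = exp (- (\<sigma>\<^sup>2 * (real n * u\<^sup>2) / 4))"
      by (simp add: exp_of_nat_mult[symmetric] y_def mult_ac)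
    finally show ?thesis by (simp add: y_def mult_ac)
  qed
  show thesis by (rule that[OF c0 K0 inner])
qed

text \<open>
  The exponential that multiplies the power is the characteristic function of a normal variable of standard
  deviation \<open>n powr (-5/12)\<close>. For \<open>|t| \<le> c sqrt n\<close> the previous lemma applies. Beyond that nothing is
  known about the characteristic function except that it is at most 1, and there the normal factor
  contributes \<open>exp (- c^2 n^(1/6) / 4)\<close>, which beats every power of \<open>n\<close>. The exponent
  \<open>-5/12\<close> may be anything strictly between \<open>-1/2\<close>, so that this works, and \<open>-1/3\<close>, so that the smoothing
  is negligible on the scale \<open>n^(-1/3)\<close>.
\<close>
lemma (in real_distribution) char_power_smoothed_bound:
  assumes int1: "integrable M (\<lambda>x. x)" and mean: "expectation (\<lambda>x. x) = 0"
    and int2: "integrable M (\<lambda>x. x^2)" and var: "expectation (\<lambda>x. x^2) = \<sigma>\<^sup>2" and \<sigma>: "0 < \<sigma>"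
    and int3: "integrable M (\<lambda>x. \<bar>x\<bar>^3)"
  obtains C b where "\<And>n. n \<ge> 1 \<Longrightarrow> integrable lborel (b n)"
    "\<And>n. n \<ge> 1 \<Longrightarrow> (LINT t|lborel. b n t) \<le> C * real n powr (-1/3)"
    "\<And>n t. n \<ge> (1::nat) \<Longrightarrow> cmod (char M (t / sqrt (real n)) ^ n *
        complex_of_real (exp (- ((real n powr (-5/12))\<^sup>2 * t\<^sup>2 / 2))) - complex_of_real (exp (- (\<sigma>\<^sup>2 * t\<^sup>2 / 2)))) \<le> \<bar>t\<bar> * b n t"
proof -
  obtain c K where c0: "0 < c" and K0: "0 \<le> K"
    and inner: "\<And>u n. \<bar>u\<bar> \<le> c \<Longrightarrow> cmod (char M u ^ n - complex_of_real (exp (- (\<sigma>\<^sup>2 * u\<^sup>2 / 2))) ^ n)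
      \<le> 3 * K * (real n * \<bar>u\<bar> ^ 3 * exp (- (\<sigma>\<^sup>2 * (real n * u\<^sup>2) / 4)))"
    by (rule char_power_diff_near_0[OF assms]) (rule that; assumption)
  define e where "e n = real n powr (-5/12)" for n :: nat
  \<comment> \<open>The summands bound, in this order: the distance of the unsmoothed characteristic functions near
    0; the effect of smoothing there; the smoothed function far out; the normal one far out. In
    the last two, 1 is at most |t| / (c sqrt n).\<close>
  define b where "b n t = 3 * K / sqrt (real n) * (\<bar>t\<bar> ^ 2 * exp (- (\<sigma>\<^sup>2 / 4 * t\<^sup>2)))
     + (e n)\<^sup>2 / 2 * (\<bar>t\<bar> ^ 1 * exp (- (\<sigma>\<^sup>2 / 2 * t\<^sup>2)))
     + exp (- ((e n)\<^sup>2 * (c\<^sup>2 * real n) / 4)) / (c * sqrt (real n)) * exp (- ((e n)\<^sup>2 * t\<^sup>2 / 4))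
     + 1 / (c * sqrt (real n)) * (\<bar>t\<bar> ^ 0 * exp (- (\<sigma>\<^sup>2 / 4 * t\<^sup>2)))" for n t
  define I2 where "I2 = (LINT t|lborel. \<bar>t\<bar> ^ 2 * exp (- (\<sigma>\<^sup>2 / 4 * t\<^sup>2)))"
  define I1 where "I1 = (LINT t|lborel. \<bar>t\<bar> ^ 1 * exp (- (\<sigma>\<^sup>2 / 2 * t\<^sup>2)))"
  define I0 where "I0 = (LINT t|lborel. \<bar>t\<bar> ^ 0 * exp (- (\<sigma>\<^sup>2 / 4 * t\<^sup>2)))"
  define J where "J = (LINT t|lborel. exp (- ((t::real)\<^sup>2 / 4)))"
  have I0s: "0 \<le> I2" "0 \<le> I1" "0 \<le> I0" "0 \<le> J"
    unfolding I2_def I1_def I0_def J_def by (intro integral_nonneg_AE AE_I2; simp)+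
  have e0: "0 < e n" if "n \<ge> 1" for n using that by (simp add: e_def)
  have ints: "integrable lborel (\<lambda>t. \<bar>t\<bar> ^ 2 * exp (- (\<sigma>\<^sup>2 / 4 * t\<^sup>2)))"
    "integrable lborel (\<lambda>t. \<bar>t\<bar> ^ 1 * exp (- (\<sigma>\<^sup>2 / 2 * t\<^sup>2)))"
    "integrable lborel (\<lambda>t. \<bar>t\<bar> ^ 0 * exp (- (\<sigma>\<^sup>2 / 4 * t\<^sup>2)))"
    by (rule integrable_power_gaussian, use \<sigma> in simp)+
  have inte: "integrable lborel (\<lambda>t. exp (- ((e n)\<^sup>2 * t\<^sup>2 / 4)))" if "n \<ge> 1" for n
    using integrable_power_gaussian[of "(e n)\<^sup>2 / 4" 0] e0[OF that] by simp
  show thesis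
  proof (rule that[of b "3 * K * I2 + I1 / 2 + 32 / c ^ 5 * J + I0 / c"])
    fix n :: nat assume n: "n \<ge> 1"
    show "integrable lborel (b n)"
      unfolding b_def by (intro Bochner_Integration.integrable_add integrable_mult_right ints inte n)
    have "(LINT t|lborel. b n t) = 3 * K / sqrt (real n) * I2 + (e n)\<^sup>2 / 2 * I1
       + exp (- ((e n)\<^sup>2 * (c\<^sup>2 * real n) / 4)) / (c * sqrt (real n)) * (J / e n) + 1 / (c * sqrt (real n)) * I0"
      unfolding b_def I2_def I1_def I0_def J_def integral_gaussian_scale[OF e0[OF n], symmetric]
      using ints inte[OF n]
      by (simp only: Bochner_Integration.integral_add Bochner_Integration.integrable_add integrable_mult_right integral_mult_right_zero)
    also have "\<dots> \<le> (3 * K * I2 + I1 / 2 + 32 / c ^ 5 * J + I0 / c) * real n powr (-1/3)"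
    proof -
      have rn: "real n \<ge> 1" "real n > 0" using n by auto
      have s: "1 / sqrt (real n) = real n powr (-1/2)"
        using rn by (simp add: powr_half_sqrt[symmetric] powr_minus field_simps)
      have sle: "1 / sqrt (real n) \<le> real n powr (-1/3)"
        unfolding s using rn by (intro powr_mono) auto
      have e2: "(e n)\<^sup>2 = real n powr (-5/6)"
        using rn by (simp add: e_def powr_power)
      have ele: "(e n)\<^sup>2 \<le> real n powr (-1/3)"
        unfolding e2 using rn by (intro powr_mono) auto
      have x: "exp (- ((e n)\<^sup>2 * (c\<^sup>2 * real n) / 4)) / (c * sqrt (real n)) * (1 / e n) \<le> 32 / c ^ 5 * real n powr (-1/3)"
      proof -
        define v where "v = (e n)\<^sup>2 * (c\<^sup>2 * real n) / 4"
        have v: "v = c\<^sup>2 / 4 * real n powr (1/6)"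
        proof -
          have "(e n)\<^sup>2 * real n = real n powr (-5/6) * real n powr 1" unfolding e2 using rn by simp
          also have "\<dots> = real n powr (1/6)" by (subst powr_add[symmetric]) simp
          finally show ?thesis by (simp add: v_def mult_ac)
        qed
        have v0: "0 < v" unfolding v using c0 rn by simp
        have "v\<^sup>2 / 2 \<le> exp v" using exp_lower_Taylor_quadratic[of v] v0 by linarith
        then have "exp (- v) \<le> 2 / v\<^sup>2"
          unfolding exp_minus using v0 by (simp add: field_simps)
        also have "2 / v\<^sup>2 = 32 / c ^ 4 * real n powr (-1/3)"
          unfolding v using c0 rn by (simp add: power_mult_distrib powr_power powr_minus field_simps power_divide)
        finally have ev: "exp (- v) \<le> 32 / c ^ 4 * real n powr (-1/3)" .
        have se: "1 / sqrt (real n) * (1 / e n) \<le> 1"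
        proof -
          have "1 / sqrt (real n) * (1 / e n) = real n powr (-1/2) * real n powr (5/12)"
            unfolding s e_def by (simp add: powr_minus_divide)
          also have "\<dots> = real n powr (-1/12)" by (subst powr_add[symmetric]) simp
          also have "\<dots> \<le> real n powr 0" using rn by (intro powr_mono) auto
          finally show ?thesis using rn by simp
        qed
        have "exp (- v) / (c * sqrt (real n)) * (1 / e n) = exp (- v) / c * (1 / sqrt (real n) * (1 / e n))"
          by simp
        also have "\<dots> \<le> exp (- v) / c * 1" using se c0 by (intro mult_left_mono) auto
        also have "\<dots> \<le> 32 / c ^ 4 * real n powr (-1/3) / c"
          unfolding mult_1_right by (rule divide_right_mono[OF ev]) (use c0 in simp)
        also have "\<dots> = 32 / c ^ 5 * real n powr (-1/3)" by (simp add: eval_nat_numeral)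
        finally show ?thesis by (simp only: v_def)
      qed
      have "3 * K / sqrt (real n) * I2 = 3 * K * I2 * (1 / sqrt (real n))" by simp
      also have "\<dots> \<le> 3 * K * I2 * real n powr (-1/3)" using K0 I0s by (intro mult_left_mono sle) auto
      finally have 1: "3 * K / sqrt (real n) * I2 \<le> 3 * K * I2 * real n powr (-1/3)" .
      have "(e n)\<^sup>2 / 2 * I1 = I1 / 2 * (e n)\<^sup>2" by simp
      also have "\<dots> \<le> I1 / 2 * real n powr (-1/3)" using I0s by (intro mult_left_mono ele) auto
      finally have 2: "(e n)\<^sup>2 / 2 * I1 \<le> I1 / 2 * real n powr (-1/3)" .
      have "1 / (c * sqrt (real n)) * I0 = I0 / c * (1 / sqrt (real n))" by simp
      also have "\<dots> \<le> I0 / c * real n powr (-1/3)" using I0s c0 by (intro mult_left_mono sle) auto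
      finally have 3: "1 / (c * sqrt (real n)) * I0 \<le> I0 / c * real n powr (-1/3)" .
      have "exp (- ((e n)\<^sup>2 * (c\<^sup>2 * real n) / 4)) / (c * sqrt (real n)) * (J / e n)
        = exp (- ((e n)\<^sup>2 * (c\<^sup>2 * real n) / 4)) / (c * sqrt (real n)) * (1 / e n) * J" by simp
      also have "\<dots> \<le> 32 / c ^ 5 * real n powr (-1/3) * J" by (intro mult_right_mono x I0s)
      finally have 4: "exp (- ((e n)\<^sup>2 * (c\<^sup>2 * real n) / 4)) / (c * sqrt (real n)) * (J / e n)
         \<le> 32 / c ^ 5 * J * real n powr (-1/3)" by (simp add: mult_ac)
      show ?thesis using 1 2 3 4 by (simp only: distrib_right)
    qed
    finally show "(LINT t|lborel. b n t) \<le> (3 * K * I2 + I1 / 2 + 32 / c ^ 5 * J + I0 / c) * real n powr (-1/3)" .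
    fix t :: real
    have rn: "real n > 0" using n by auto
    define u where "u = t / sqrt (real n)"
    have nu2: "real n * u\<^sup>2 = t\<^sup>2" using rn by (simp add: u_def power_divide)
    define g where "g = exp (- (\<sigma>\<^sup>2 * t\<^sup>2 / 2))"
    define h where "h = exp (- ((e n)\<^sup>2 * t\<^sup>2 / 2))"
    have h1: "0 < h" "h \<le> 1" by (simp_all add: h_def)
    have g1: "0 < g" by (simp add: g_def)
    have b4: "0 \<le> 3 * K / sqrt (real n) * (\<bar>t\<bar> ^ 2 * exp (- (\<sigma>\<^sup>2 / 4 * t\<^sup>2)))"
      "0 \<le> (e n)\<^sup>2 / 2 * (\<bar>t\<bar> ^ 1 * exp (- (\<sigma>\<^sup>2 / 2 * t\<^sup>2)))"
      "0 \<le> exp (- ((e n)\<^sup>2 * (c\<^sup>2 * real n) / 4)) / (c * sqrt (real n)) * exp (- ((e n)\<^sup>2 * t\<^sup>2 / 4))"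
      "0 \<le> 1 / (c * sqrt (real n)) * (\<bar>t\<bar> ^ 0 * exp (- (\<sigma>\<^sup>2 / 4 * t\<^sup>2)))"
      using K0 c0 by simp_all
    have "cmod (char M u ^ n * complex_of_real h - complex_of_real g) \<le> \<bar>t\<bar> * b n t"
    proof (cases "\<bar>u\<bar> \<le> c")
      case True
      have gn: "complex_of_real g = complex_of_real (exp (- (\<sigma>\<^sup>2 * u\<^sup>2 / 2))) ^ n"
      proof -
        have "exp (- (\<sigma>\<^sup>2 * u\<^sup>2 / 2)) ^ n = exp (- (\<sigma>\<^sup>2 * (real n * u\<^sup>2) / 2))"
          by (simp add: exp_of_nat_mult[symmetric] mult_ac)
        then show ?thesis unfolding g_def nu2 by (metis of_real_power)
      qed
      have "char M u ^ n * complex_of_real h - complex_of_real g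
        = (char M u ^ n - complex_of_real g) * complex_of_real h - complex_of_real (g * (1 - h))"
        by (simp add: algebra_simps)
      also have "cmod \<dots> \<le> cmod (char M u ^ n - complex_of_real g) * h + g * (1 - h)"
        by (rule order_trans[OF norm_triangle_ineq4])
           (use h1 g1 in \<open>simp only: norm_mult norm_of_real, simp\<close>)
      also have "\<dots> \<le> cmod (char M u ^ n - complex_of_real g) * 1 + g * ((e n)\<^sup>2 * t\<^sup>2 / 2)"
      proof (intro add_mono mult_left_mono h1)
        show "1 - h \<le> (e n)\<^sup>2 * t\<^sup>2 / 2"
          using exp_ge_add_one_self[of "- ((e n)\<^sup>2 * t\<^sup>2 / 2)"] by (simp add: h_def)
      qed (use g1 in auto)
      also have "\<dots> \<le> 3 * K * (real n * \<bar>u\<bar> ^ 3 * exp (- (\<sigma>\<^sup>2 * (real n * u\<^sup>2) / 4))) + g * ((e n)\<^sup>2 * t\<^sup>2 / 2)"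
        unfolding gn using inner[OF True, of n] by simp
      also have "real n * \<bar>u\<bar> ^ 3 = \<bar>t\<bar> * (\<bar>t\<bar> ^ 2 / sqrt (real n))"
      proof -
        have "\<bar>u\<bar> ^ 3 = \<bar>t\<bar> ^ 3 / (real n * sqrt (real n))"
          using rn by (simp add: u_def power_divide abs_divide power3_eq_cube)
        then show ?thesis using rn by (simp add: power3_eq_cube power2_eq_square)
      qed
      also have "3 * K * (\<bar>t\<bar> * (\<bar>t\<bar> ^ 2 / sqrt (real n)) * exp (- (\<sigma>\<^sup>2 * (real n * u\<^sup>2) / 4))) + g * ((e n)\<^sup>2 * t\<^sup>2 / 2)
        = \<bar>t\<bar> * (3 * K / sqrt (real n) * (\<bar>t\<bar> ^ 2 * exp (- (\<sigma>\<^sup>2 / 4 * t\<^sup>2)))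
     + (e n)\<^sup>2 / 2 * (\<bar>t\<bar> ^ 1 * exp (- (\<sigma>\<^sup>2 / 2 * t\<^sup>2))))"
        unfolding nu2 g_def by (simp add: power2_eq_square algebra_simps)
      also have "\<dots> \<le> \<bar>t\<bar> * b n t"
        unfolding b_def using b4 by (intro mult_left_mono) auto
      finally show ?thesis .
    next
      case False
      then have tc: "c * sqrt (real n) < \<bar>t\<bar>" using rn by (simp add: u_def abs_divide field_simps)
      have cs: "0 < c * sqrt (real n)" using c0 rn by simp
      have t2: "c\<^sup>2 * real n \<le> t\<^sup>2"
      proof -
        have "(c * sqrt (real n))\<^sup>2 \<le> \<bar>t\<bar>\<^sup>2" using tc cs by (intro power_mono) auto
        then show ?thesis using rn by (simp add: power_mult_distrib)
      qed
      have 1: "1 \<le> \<bar>t\<bar> / (c * sqrt (real n))" using tc cs by (simp add: field_simps)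
      have hb: "h \<le> exp (- ((e n)\<^sup>2 * (c\<^sup>2 * real n) / 4)) * exp (- ((e n)\<^sup>2 * t\<^sup>2 / 4))"
        unfolding h_def exp_add[symmetric] using mult_left_mono[OF t2, of "(e n)\<^sup>2"] by simp
      have gb: "g \<le> exp (- (\<sigma>\<^sup>2 / 4 * t\<^sup>2))" unfolding g_def by simp
      have "cmod (char M u ^ n * complex_of_real h - complex_of_real g) \<le> h + g"
      proof (rule order_trans[OF norm_triangle_ineq4 add_mono])
        show "cmod (char M u ^ n * complex_of_real h) \<le> h"
          using h1 power_le_one[OF norm_ge_zero cmod_char_le_1, of u n]
          by (simp add: norm_mult norm_power mult_le_cancel_right1)
      qed (use g1 in simp)
      also have "\<dots> \<le> exp (- ((e n)\<^sup>2 * (c\<^sup>2 * real n) / 4)) * exp (- ((e n)\<^sup>2 * t\<^sup>2 / 4)) + exp (- (\<sigma>\<^sup>2 / 4 * t\<^sup>2))"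
        using hb gb by simp
      also have "\<dots> = 1 * \<dots>" by simp
      also have "\<dots> \<le> \<bar>t\<bar> / (c * sqrt (real n)) * (exp (- ((e n)\<^sup>2 * (c\<^sup>2 * real n) / 4)) * exp (- ((e n)\<^sup>2 * t\<^sup>2 / 4)) + exp (- (\<sigma>\<^sup>2 / 4 * t\<^sup>2)))"
        by (intro mult_right_mono 1) (simp add: add_nonneg_nonneg)
      also have "\<dots> = \<bar>t\<bar> * (exp (- ((e n)\<^sup>2 * (c\<^sup>2 * real n) / 4)) / (c * sqrt (real n)) * exp (- ((e n)\<^sup>2 * t\<^sup>2 / 4))
     + 1 / (c * sqrt (real n)) * (\<bar>t\<bar> ^ 0 * exp (- (\<sigma>\<^sup>2 / 4 * t\<^sup>2))))"
        by (simp add: distrib_left)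
      also have "\<dots> \<le> \<bar>t\<bar> * b n t"
        unfolding b_def using b4 by (intro mult_left_mono) auto
      finally show ?thesis .
    qed
    then show "cmod (char M (t / sqrt (real n)) ^ n *
        complex_of_real (exp (- ((real n powr (-5/12))\<^sup>2 * t\<^sup>2 / 2))) - complex_of_real (exp (- (\<sigma>\<^sup>2 * t\<^sup>2 / 2)))) \<le> \<bar>t\<bar> * b n t"
      unfolding u_def h_def g_def e_def .
  qed
qed


section \<open>The disc measure near -1\<close>
lemma space_half_line: "space half_line = {0..}"
  by (simp add: space_restrict_space)

text \<open>
  Each factor of the quotient is \<open>1 - (q - p) / y\<close> with \<open>y = q + i\<close>, which is at most
  \<open>(y / (y + 1)) powr (q - p)\<close>; the product of these telescopes.
\<close>
lemma pochhammer_ratio_le: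
  fixes p q :: real
  assumes "0 < p" "p < q"
  shows "pochhammer p n / pochhammer q n \<le> (q / (q + real n)) powr (q - p)"
proof (induction n)
  case (Suc n)
  let ?y = "q + real n"
  have y: "?y > 0" "p + real n > 0" using assms by auto
  have "(p + real n) / ?y = 1 - (q - p) / ?y" using y by (simp add: field_simps)
  also have "\<dots> \<le> exp (- ((q - p) / ?y))" using exp_ge_add_one_self[of "- ((q - p) / ?y)"] by simp
  also have "\<dots> \<le> (?y / (?y + 1)) powr (q - p)"
  proof -
    have "ln ((?y + 1) / ?y) \<le> (?y + 1) / ?y - 1" using y by (intro ln_le_minus_one) auto
    also have "\<dots> = 1 / ?y" using y by (simp add: field_simps)
    finally have "- (1 / ?y) \<le> ln (?y / (?y + 1))" using y by (simp add: ln_div)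
    then have "(q - p) * - (1 / ?y) \<le> (q - p) * ln (?y / (?y + 1))"
      using assms by (intro mult_left_mono) auto
    then show ?thesis using y by (simp add: powr_def)
  qed
  finally have step: "(p + real n) / ?y \<le> (?y / (?y + 1)) powr (q - p)" .
  have "pochhammer p (Suc n) / pochhammer q (Suc n) = pochhammer p n / pochhammer q n * ((p + real n) / ?y)"
    by (simp add: pochhammer_Suc)
  also have "\<dots> \<le> (q / ?y) powr (q - p) * (?y / (?y + 1)) powr (q - p)"
    using y by (intro mult_mono Suc step) (auto simp: less_imp_le)
  also have "\<dots> = (q / (q + real (Suc n))) powr (q - p)"
    using y assms by (simp add: powr_mult[symmetric] add_ac)
  finally show ?case .
qed (use assms in simp)

context jacobi_index
begin

text \<open>
  The moments of even order \<open>2 a\<close> of the real part decay like \<open>a powr (- \<delta>)\<close> with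
  \<open>\<delta> = \<alpha> + 1/2 > 0\<close>. By Markov's inequality with \<open>a\<close> about \<open>exp w\<close> the probability is
  \<open>O(exp (- \<delta> w))\<close>; the weaker bound is convenient later.
\<close>
lemma measure_cos_near_minus_one_le:
  obtains C where "C \<ge> 0" "\<And>w. 0 < w \<Longrightarrow>
    measure (jacobi_measure \<alpha> \<beta>) {p \<in> space (jacobi_measure \<alpha> \<beta>). fst p * cos (snd p) < 2 * exp (- w) - 1} \<le> C / w\<^sup>2"
proof -
  let ?m = "jacobi_measure \<alpha> \<beta>" and ?U = "\<lambda>p :: real \<times> real. fst p * cos (snd p)"
  define \<delta> where "\<delta> = \<alpha> + 1 / 2"
  have \<delta>0: "\<delta> > 0" using \<alpha>_gt by (simp add: \<delta>_def)
  define C where "C = exp 8 * (2 * (\<alpha> + 1)) powr \<delta> + 4 powr \<delta>"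
  have C0: "C \<ge> 0" by (simp add: C_def add_nonneg_nonneg)
  have bound: "m.prob {p \<in> space ?m. ?U p < 2 * exp (- w) - 1} \<le> C * exp (- (\<delta> * w))" if w: "0 < w" for w
  proof (cases "exp w < 4")
    case True
    then have "w < ln 4" by (metis exp_less_cancel_iff exp_ln zero_less_numeral)
    then have "\<delta> * w \<le> \<delta> * ln 4" using \<delta>0 by simp
    then have "1 \<le> 4 powr \<delta> * exp (- (\<delta> * w))"
      by (simp add: powr_def exp_minus field_simps)
    also have "\<dots> \<le> C * exp (- (\<delta> * w))" by (intro mult_right_mono) (simp_all add: C_def)
    finally show ?thesis using m.prob_le_1 by (meson order_trans)
  next
    case False
    then have ew: "exp w \<ge> 4" by simp
    \<comment> \<open>With this exponent the power of 1 - 2 exp (- w) in Markov's inequality stays above exp (- 8).\<close>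
    define a where "a = nat \<lfloor>exp w\<rfloor>"
    define y where "y = 2 * exp (- w)"
    have a: "real a \<le> exp w" "exp w - 1 \<le> real a" using ew by (auto simp: a_def)
    have y: "0 < y" "y \<le> 1 / 2" using ew by (auto simp: y_def exp_minus field_simps)
    have "exp (- (2 * y)) \<le> 1 - y"
    proof -
      have "2 * y\<^sup>2 \<le> y" using y by (simp add: power2_eq_square)
      then have "- (2 * y) \<le> - y - 2 * y\<^sup>2" by simp
      also have "\<dots> \<le> ln (1 - y)" using y by (intro ln_one_minus_pos_lower_bound) auto
      finally show ?thesis using y by (simp add: ln_ge_iff)
    qed
    then have "exp (- (2 * y)) ^ (2 * a) \<le> (1 - y) ^ (2 * a)" by (intro power_mono) auto
    moreover have "exp (- 8) \<le> exp (- (2 * y)) ^ (2 * a)"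
    proof -
      have "real a * y \<le> exp w * (2 * exp (- w))" unfolding y_def using a by (intro mult_right_mono) auto
      also have "exp w * (2 * exp (- w)) = 2" by (simp add: exp_minus)
      finally have "real a * y \<le> 2" .
      then show ?thesis by (simp add: exp_of_nat_mult[symmetric] mult.commute)
    qed
    ultimately have y8: "exp (- 8) \<le> (1 - y) ^ (2 * a)" by linarith
    have int: "integrable ?m (\<lambda>p. ?U p ^ (2 * a))"
      using integrable_jacobi_measure_polynomial[of "2 * a" 0] by simp
    have "(LINT p|?m. ?U p ^ (2 * a)) = pochhammer (1/2) a / pochhammer (\<alpha> + 1) a"
      using integral_jacobi_measure_moment[of "2 * a" 0] pochhammer_pos[of "\<beta> + 1" a] \<beta>_ge by simp
    also have "\<dots> \<le> ((\<alpha> + 1) / (\<alpha> + 1 + real a)) powr \<delta>"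
      using pochhammer_ratio_le[of "1/2" "\<alpha> + 1" a] \<alpha>_gt by (simp add: \<delta>_def algebra_simps)
    also have "\<dots> \<le> (2 * (\<alpha> + 1) * exp (- w)) powr \<delta>"
    proof (rule powr_mono2)
      have "exp w / 2 \<le> \<alpha> + 1 + real a" using a ew \<alpha>_gt by linarith
      then have "(\<alpha> + 1) / (\<alpha> + 1 + real a) \<le> (\<alpha> + 1) / (exp w / 2)"
        using \<alpha>_gt by (intro divide_left_mono) (auto intro!: mult_pos_pos)
      also have "\<dots> = 2 * (\<alpha> + 1) * exp (- w)" by (simp add: exp_minus field_simps)
      finally show "(\<alpha> + 1) / (\<alpha> + 1 + real a) \<le> 2 * (\<alpha> + 1) * exp (- w)" .
    qed (use \<delta>0 \<alpha>_gt in auto)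
    also have "\<dots> = (2 * (\<alpha> + 1)) powr \<delta> * exp (- (\<delta> * w))"
      using \<alpha>_gt by (simp add: powr_mult exp_powr_real mult.commute)
    finally have EU: "(LINT p|?m. ?U p ^ (2 * a)) \<le> (2 * (\<alpha> + 1)) powr \<delta> * exp (- (\<delta> * w))" .
    have "m.prob {p \<in> space ?m. ?U p < 2 * exp (- w) - 1} \<le> m.prob {p \<in> space ?m. ?U p ^ (2 * a) \<ge> (1 - y) ^ (2 * a)}"
    proof (rule m.finite_measure_mono)
      show "{p \<in> space ?m. ?U p < 2 * exp (- w) - 1} \<subseteq> {p \<in> space ?m. ?U p ^ (2 * a) \<ge> (1 - y) ^ (2 * a)}"
      proof safe
        fix r \<phi> assume "?U (r, \<phi>) < 2 * exp (- w) - 1"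
        then have "1 - y \<le> - ?U (r, \<phi>)" by (simp add: y_def)
        then have "(1 - y) ^ (2 * a) \<le> (- ?U (r, \<phi>)) ^ (2 * a)" using y by (intro power_mono) auto
        then show "(1 - y) ^ (2 * a) \<le> ?U (r, \<phi>) ^ (2 * a)" by (simp add: power_minus_even)
      qed
    qed measurable
    also have "\<dots> \<le> (LINT p|?m. ?U p ^ (2 * a)) / (1 - y) ^ (2 * a)"
      by (rule integral_Markov_inequality_measure[OF int, where A = "{}"]) (use y in auto)
    also have "\<dots> \<le> ((2 * (\<alpha> + 1)) powr \<delta> * exp (- (\<delta> * w))) / exp (- 8)"
      using EU y8 by (intro frac_le) auto
    also have "\<dots> = exp 8 * (2 * (\<alpha> + 1)) powr \<delta> * exp (- (\<delta> * w))" by (simp add: exp_minus[of 8] field_simps)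
    also have "\<dots> \<le> C * exp (- (\<delta> * w))" by (intro mult_right_mono) (simp_all add: C_def)
    finally show ?thesis .
  qed
  show thesis
  proof (rule that[of "C * 2 / \<delta>\<^sup>2"])
    show "0 \<le> C * 2 / \<delta>\<^sup>2" using C0 by simp
    fix w :: real assume w: "0 < w"
    have dw: "0 < \<delta> * w" using \<delta>0 w by simp
    have "(\<delta> * w)\<^sup>2 / 2 \<le> exp (\<delta> * w)" using exp_lower_Taylor_quadratic[of "\<delta> * w"] dw by linarith
    then have "1 / exp (\<delta> * w) \<le> 1 / ((\<delta> * w)\<^sup>2 / 2)"
      by (rule frac_le[OF zero_le_one order_refl, rotated]) (use \<delta>0 w in simp)
    then have "exp (- (\<delta> * w)) \<le> 2 / (\<delta> * w)\<^sup>2"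
      by (simp add: exp_minus inverse_eq_divide)
    then have "C * exp (- (\<delta> * w)) \<le> C * (2 / (\<delta> * w)\<^sup>2)" by (intro mult_left_mono C0)
    also have "\<dots> = C * 2 / \<delta>\<^sup>2 / w\<^sup>2" by (simp add: power_mult_distrib)
    finally show "m.prob {p \<in> space ?m. ?U p < 2 * exp (- w) - 1} \<le> C * 2 / \<delta>\<^sup>2 / w\<^sup>2"
      using bound[OF w] by linarith
  qed
qed

lemma borel_measurable_jacobi_char:
  "jacobi_char \<alpha> \<beta> \<theta> \<in> borel_measurable borel"
proof -
  interpret m: prob_space "jacobi_measure \<alpha> \<beta>" by (rule prob_space_jacobi_measure)
  show ?thesis
    unfolding jacobi_char_def[abs_def]
    by (rule m.borel_measurable_lebesgue_integral) measurable
qed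

lemma norm_jacobi_char_le: "cmod (jacobi_char \<alpha> \<beta> \<theta> t) \<le> 1"
proof -
  interpret m: prob_space "jacobi_measure \<alpha> \<beta>" by (rule prob_space_jacobi_measure)
  have "cmod (jacobi_char \<alpha> \<beta> \<theta> t) \<le> (LINT p|jacobi_measure \<alpha> \<beta>. cmod (iexp (\<theta> * horo t p)))"
    unfolding jacobi_char_def by (rule integral_norm_bound)
  then show ?thesis by (simp add: m.prob_space)
qed

end


section \<open>The increments of the walk\<close>
text \<open>
  The values for \<open>k = 1\<close> and \<open>k = 2\<close> are the first two moments of \<open>exp (2 horo t p)\<close>, so this says that
  \<open>horo t\<close> is not almost surely constant when \<open>a = (sinh t)^2 > 0\<close>.
\<close>
lemma bateman_2_gt_square:
  assumes "-1/2 \<le> \<beta>" "\<beta> \<le> \<alpha>" "-1/2 < \<alpha>" and a: "0 < a"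
  shows "(bateman \<alpha> \<beta> 1 (1 + a) a)\<^sup>2 < bateman \<alpha> \<beta> 2 (1 + a) a"
proof -
  have pos: "0 < \<alpha> + 1" "0 < \<alpha> + 2" "0 < \<beta> + 1" "0 < \<beta> + 2" using assms by auto
  have b1: "bateman \<alpha> \<beta> 1 (1 + a) a = 1 + a + (\<beta> + 1) / (\<alpha> + 1) * a"
    using pos by (simp add: bateman_def jacobi_coeff_def)
  have b2: "bateman \<alpha> \<beta> 2 (1 + a) a = (1 + a)\<^sup>2 + 2 * (\<beta> + 2) / (\<alpha> + 1) * (1 + a) * a
     + (\<beta> + 1) * (\<beta> + 2) / ((\<alpha> + 1) * (\<alpha> + 2)) * a\<^sup>2"
    using pos by (simp add: bateman_def jacobi_coeff_def numeral_2_eq_2 pochhammer_Suc add_ac)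
  have "(1 + a)\<^sup>2 + 2 * (\<beta> + 2) / (\<alpha> + 1) * (1 + a) * a + (\<beta> + 1) * (\<beta> + 2) / ((\<alpha> + 1) * (\<alpha> + 2)) * a\<^sup>2
     - (1 + a + (\<beta> + 1) / (\<alpha> + 1) * a)\<^sup>2
     = 2 * a * (1 + a) / (\<alpha> + 1) + a\<^sup>2 * (\<beta> + 1) * (\<alpha> - \<beta>) / ((\<alpha> + 1)\<^sup>2 * (\<alpha> + 2))"
    using pos by (simp add: divide_simps) (simp add: power2_eq_square algebra_simps)
  moreover have "0 < 2 * a * (1 + a) / (\<alpha> + 1)" using pos a by simp
  moreover have "0 \<le> a\<^sup>2 * (\<beta> + 1) * (\<alpha> - \<beta>) / ((\<alpha> + 1)\<^sup>2 * (\<alpha> + 2))" using pos assms by simp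
  ultimately show ?thesis unfolding b1 b2 by linarith
qed

locale jacobi_increment = jacobi_index +
  fixes \<nu> :: "real measure"
  assumes prob_\<nu>: "prob_space \<nu>" and sets_\<nu>: "sets \<nu> = sets half_line"
begin

sublocale n: prob_space \<nu>
  by (rule prob_\<nu>)

lemmas \<nu> = prob_\<nu> sets_\<nu>

text \<open>
  Both bind operations unfold to integrals, so one step from \<open>x\<close> is the image of
  an independent pair of a step length with law \<open>\<nu>\<close> and a disc point.
\<close>
lemma jacobi_conv_return:
  assumes x: "0 \<le> x" and A: "A \<in> sets half_line"
  shows "emeasure (jacobi_conv \<alpha> \<beta> (return half_line x) \<nu>) A =
    emeasure (\<nu> \<Otimes>\<^sub>M jacobi_measure \<alpha> \<beta>)
      (Pair x -` ((\<lambda>y. jacobi_point_map (fst y) (fst (snd y)) (snd (snd y))) -` A \<inter> space (half_line \<Otimes>\<^sub>M (\<nu> \<Otimes>\<^sub>M jacobi_measure \<alpha> \<beta>))))"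
proof -
  let ?m = "jacobi_measure \<alpha> \<beta>"
  interpret m: prob_space ?m by (rule prob_space_jacobi_measure)
  let ?T = "\<lambda>y. jacobi_point_map (fst y) (fst (snd y)) (snd (snd y))"
  have T: "?T \<in> measurable (half_line \<Otimes>\<^sub>M (half_line \<Otimes>\<^sub>M ?m)) half_line"
    by (rule measurable_jacobi_point_map_triple)
  have sp\<nu>: "space \<nu> = {0..}" using sets_eq_imp_space_eq[OF \<nu>(2)] by (simp add: space_half_line)
  have T\<nu>: "?T \<in> measurable (half_line \<Otimes>\<^sub>M (\<nu> \<Otimes>\<^sub>M ?m)) half_line"
    using T by (simp add: measurable_cong_sets[OF sets_pair_measure_cong[OF refl sets_pair_measure_cong[OF \<nu>(2) refl]] refl])
  have kern: "(\<lambda>z. jacobi_conv_point \<alpha> \<beta> (fst z) (snd z)) \<in> measurable (half_line \<Otimes>\<^sub>M half_line) (subprob_algebra half_line)"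
    unfolding jacobi_conv_point_def
  proof (rule measurable_distr2)
    have "(\<lambda>x. ?T (fst (fst x), (snd (fst x), snd x))) \<in> measurable ((half_line \<Otimes>\<^sub>M half_line) \<Otimes>\<^sub>M ?m) half_line"
      by (rule measurable_compose[OF _ T]) measurable
    then show "(\<lambda>(z, p). jacobi_point_map (fst z) (snd z) p) \<in> measurable ((half_line \<Otimes>\<^sub>M half_line) \<Otimes>\<^sub>M ?m) half_line"
      by (simp add: case_prod_beta)
    show "(\<lambda>z. ?m) \<in> measurable (half_line \<Otimes>\<^sub>M half_line) (subprob_algebra ?m)"
      by (rule measurable_const) (simp add: space_subprob_algebra m.subprob_space_axioms)
  qed
  have \<nu>in: "\<nu> \<in> space (subprob_algebra half_line)"
    using \<nu>(2) by (simp add: space_subprob_algebra n.subprob_space_axioms)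
  have kern1: "(\<lambda>s. bind \<nu> (\<lambda>t. jacobi_conv_point \<alpha> \<beta> s t)) \<in> measurable half_line (subprob_algebra half_line)"
    by (rule measurable_bind[OF measurable_const[OF \<nu>in] kern])
  have xin: "x \<in> space half_line" using x by (simp add: space_half_line)
  have kx: "jacobi_conv_point \<alpha> \<beta> x \<in> measurable \<nu> (subprob_algebra half_line)"
    using measurable_compose[OF measurable_Pair1'[OF xin, of half_line] kern]
    by (simp add: measurable_cong_sets[OF \<nu>(2) refl])
  have "emeasure (jacobi_conv \<alpha> \<beta> (return half_line x) \<nu>) A = emeasure (bind \<nu> (jacobi_conv_point \<alpha> \<beta> x)) A"
    unfolding jacobi_conv_def by (subst bind_return[OF kern1 xin]) (rule refl)
  also have "\<dots> = (\<integral>\<^sup>+t. emeasure (jacobi_conv_point \<alpha> \<beta> x t) A \<partial>\<nu>)"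
    by (rule emeasure_bind[OF n.not_empty kx A])
  also have "\<dots> = (\<integral>\<^sup>+t. emeasure ?m (Pair t -` (Pair x -` (?T -` A \<inter> space (half_line \<Otimes>\<^sub>M (\<nu> \<Otimes>\<^sub>M ?m))))) \<partial>\<nu>)"
  proof (rule nn_integral_cong)
    fix t assume t: "t \<in> space \<nu>"
    have "emeasure (jacobi_conv_point \<alpha> \<beta> x t) A = emeasure ?m (jacobi_point_map x t -` A \<inter> space ?m)"
      unfolding jacobi_conv_point_def
      by (rule emeasure_distr[OF jacobi_point_map_measurable A]) (use x t sp\<nu> in auto)
    also have "jacobi_point_map x t -` A \<inter> space ?m = Pair t -` (Pair x -` (?T -` A \<inter> space (half_line \<Otimes>\<^sub>M (\<nu> \<Otimes>\<^sub>M ?m))))"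
      using t xin by (auto simp: space_pair_measure)
    finally show "emeasure (jacobi_conv_point \<alpha> \<beta> x t) A = emeasure ?m (Pair t -` (Pair x -` (?T -` A \<inter> space (half_line \<Otimes>\<^sub>M (\<nu> \<Otimes>\<^sub>M ?m)))))" .
  qed
  also have "\<dots> = emeasure (\<nu> \<Otimes>\<^sub>M ?m) (Pair x -` (?T -` A \<inter> space (half_line \<Otimes>\<^sub>M (\<nu> \<Otimes>\<^sub>M ?m))))"
    by (rule m.emeasure_pair_measure_alt[symmetric]) (rule sets_Pair1[OF measurable_sets[OF T\<nu> A]])
  finally show ?thesis .
qed

abbreviation (input) "mom1 \<equiv> jacobi_modified_moment \<alpha> \<beta> \<nu> 1"
abbreviation (input) "mom2 \<equiv> jacobi_modified_moment \<alpha> \<beta> \<nu> 2"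

definition increment_space :: "(real \<times> real \<times> real) measure" where
  "increment_space = \<nu> \<Otimes>\<^sub>M jacobi_measure \<alpha> \<beta>"

definition increment :: "real \<times> real \<times> real \<Rightarrow> real" where
  "increment z = horo (fst z) (snd z)"

lemma space_\<nu>: "space \<nu> = {0..}"
  using sets_eq_imp_space_eq[OF \<nu>(2)] by (simp add: space_half_line)

lemma id_measurable_\<nu>: "(\<lambda>t. t) \<in> borel_measurable \<nu>"
  using measurable_restrict_space1[of "\<lambda>x. x" borel borel "{0..}"]
  by (simp add: measurable_cong_sets[OF \<nu>(2) refl])

lemma integrable_first_moment:
  assumes "integrable \<nu> (\<lambda>t. t ^ 2)"
  shows "integrable \<nu> (\<lambda>t. t ^ 1)"
proof -
  interpret n: prob_space \<nu> by (rule \<nu>)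
  show ?thesis
    unfolding power_one_right
    by (rule n.square_integrable_imp_integrable[OF id_measurable_\<nu> assms])
qed

lemma prob_space_increment: "prob_space increment_space"
  unfolding increment_space_def
  by (rule prob_space_pair[OF \<nu>(1) prob_space_jacobi_measure])

sublocale I: prob_space increment_space
  by (rule prob_space_increment)

lemma increment_measurable [measurable]: "increment \<in> borel_measurable increment_space"
proof -
  show ?thesis
    unfolding increment_def increment_space_def
    by (intro borel_measurable_horo) (auto intro: measurable_compose[OF measurable_fst id_measurable_\<nu>])
qed

lemma abs_increment_le: "z \<in> space increment_space \<Longrightarrow> \<bar>increment z\<bar> \<le> fst z"
  using horo_bounds(3)[of "snd z" "fst z"]
  by (auto simp: increment_def increment_space_def space_pair_measure space_\<nu> space_jacobi_measure)

lemma integrable_increment_power: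
  assumes "integrable \<nu> (\<lambda>t. t ^ k)"
  shows "integrable increment_space (\<lambda>z. increment z ^ k)"
proof (rule Bochner_Integration.integrable_bound)
  interpret m: prob_space "jacobi_measure \<alpha> \<beta>" by (rule prob_space_jacobi_measure)
  interpret n: prob_space \<nu> by (rule \<nu>)
  interpret nm: pair_prob_space \<nu> "jacobi_measure \<alpha> \<beta>" ..
  have "integrable (distr increment_space \<nu> fst) (\<lambda>t. t ^ k)"
    unfolding increment_space_def m.distr_pair_fst by (rule assms)
  then show "integrable increment_space (\<lambda>z. fst z ^ k)"
    by (subst (asm) integrable_distr_eq) (auto simp: increment_space_def intro: borel_measurable_integrable assms)
  show "AE z in increment_space. norm (increment z ^ k) \<le> norm (fst z ^ k)"
  proof (rule AE_I2)
    fix z assume "z \<in> space increment_space"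
    from abs_increment_le[OF this] have "\<bar>increment z\<bar> \<le> \<bar>fst z\<bar>" by simp
    from power_mono[OF this, of k]
    show "norm (increment z ^ k) \<le> norm (fst z ^ k)" by (simp add: power_abs)
  qed
qed measurable

lemma
  assumes "integrable \<nu> (\<lambda>t. t ^ k)"
  shows integrable_jacobi_moment_fun: "integrable \<nu> (jacobi_moment_fun \<alpha> \<beta> k)"
    and integral_increment_power: "(LINT z|increment_space. increment z ^ k) = jacobi_modified_moment \<alpha> \<beta> \<nu> k"
proof -
  interpret m: prob_space "jacobi_measure \<alpha> \<beta>" by (rule prob_space_jacobi_measure)
  interpret n: prob_space \<nu> by (rule \<nu>)
  interpret nm: pair_prob_space \<nu> "jacobi_measure \<alpha> \<beta>" ..
  have eq: "jacobi_moment_fun \<alpha> \<beta> k = (\<lambda>t. LINT p|jacobi_measure \<alpha> \<beta>. increment (t, p) ^ k)"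
    by (simp add: fun_eq_iff jacobi_moment_fun_eq increment_def)
  have int: "integrable (\<nu> \<Otimes>\<^sub>M jacobi_measure \<alpha> \<beta>) (\<lambda>z. increment z ^ k)"
    using integrable_increment_power[OF assms] by (simp add: increment_space_def)
  show "integrable \<nu> (jacobi_moment_fun \<alpha> \<beta> k)"
    unfolding eq by (rule nm.integrable_fst'[OF int])
  show "(LINT z|increment_space. increment z ^ k) = jacobi_modified_moment \<alpha> \<beta> \<nu> k"
    unfolding jacobi_modified_moment_def eq increment_space_def by (rule nm.integral_fst'[OF int, symmetric])
qed

lemma integral_iexp_increment:
  "(LINT z|increment_space. iexp (\<theta> * increment z)) = (LINT t|\<nu>. jacobi_char \<alpha> \<beta> \<theta> t)"
proof -
  interpret m: prob_space "jacobi_measure \<alpha> \<beta>" by (rule prob_space_jacobi_measure)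
  interpret n: prob_space \<nu> by (rule \<nu>)
  interpret nm: pair_prob_space \<nu> "jacobi_measure \<alpha> \<beta>" ..
  have [measurable]: "increment \<in> borel_measurable (\<nu> \<Otimes>\<^sub>M jacobi_measure \<alpha> \<beta>)"
    using increment_measurable by (simp add: increment_space_def)
  have "integrable (\<nu> \<Otimes>\<^sub>M jacobi_measure \<alpha> \<beta>) (\<lambda>z. iexp (\<theta> * increment z))"
    by (rule nm.integrable_iexp) measurable
  from nm.integral_fst'[OF this] show ?thesis
    by (simp add: increment_space_def jacobi_char_def increment_def)
qed

text \<open>
  If the variance vanished, then for almost every step length \<open>t\<close> the coordinate \<open>horo t\<close> would be
  almost surely constant, which forces \<open>t = 0\<close>.
\<close>
lemma variance_increment_pos:
  assumes sq: "integrable \<nu> (\<lambda>t. t ^ 2)" and ne: "\<nu> \<noteq> return half_line 0"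
  shows "(jacobi_modified_moment \<alpha> \<beta> \<nu> 1)\<^sup>2 < jacobi_modified_moment \<alpha> \<beta> \<nu> 2"
proof (rule ccontr)
  assume neg: "\<not> ?thesis"
  let ?m = "jacobi_measure \<alpha> \<beta>"
  define M1 where "M1 = jacobi_modified_moment \<alpha> \<beta> \<nu> 1"
  define M2 where "M2 = jacobi_modified_moment \<alpha> \<beta> \<nu> 2"
  interpret m: prob_space ?m by (rule prob_space_jacobi_measure)
  interpret n: prob_space \<nu> by (rule \<nu>)
  interpret nm: pair_prob_space \<nu> ?m ..
  note one = integrable_first_moment[OF sq]
  have i1: "integrable increment_space increment" and i2: "integrable increment_space (\<lambda>z. (increment z)\<^sup>2)"
    using integrable_increment_power[OF one] integrable_increment_power[OF sq] by simp_all
  have e1: "I.expectation increment = M1" and e2: "I.expectation (\<lambda>z. (increment z)\<^sup>2) = M2"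
    using integral_increment_power[OF one] integral_increment_power[OF sq] by (simp_all add: M1_def M2_def)
  have var: "I.variance increment = M2 - M1\<^sup>2"
    using I.variance_eq[OF i1 i2] by (simp add: e1 e2)
  moreover have "0 \<le> I.variance increment" by simp
  ultimately have "I.variance increment = 0" using neg by (simp add: M1_def M2_def)
  then have v0: "(LINT z|increment_space. (increment z - M1)\<^sup>2) = 0" by (simp add: e1)
  have "integrable increment_space (\<lambda>z. (increment z - M1)\<^sup>2)"
    using i1 i2 by (simp add: power2_diff)
  with v0 have "AE z in increment_space. (increment z - M1)\<^sup>2 = 0"
    by (subst (asm) integral_nonneg_eq_0_iff_AE) auto
  then have "AE z in increment_space. increment z = M1" by simp
  then have "AE z in \<nu> \<Otimes>\<^sub>M ?m. increment z = M1" unfolding increment_space_def .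
  then have AE2: "AE t in \<nu>. AE p in ?m. increment (t, p) = M1" by (rule nm.AE_pair)
  have t0: "t = 0" if t: "0 \<le> t" and h: "AE p in ?m. increment (t, p) = M1" for t
  proof (rule ccontr)
    assume "t \<noteq> 0"
    with t have a: "0 < (sinh t)\<^sup>2" by simp
    have [measurable]: "horo t \<in> borel_measurable ?m"
      by (rule borel_measurable_horo) simp_all
    have B: "bateman \<alpha> \<beta> k (1 + (sinh t)\<^sup>2) ((sinh t)\<^sup>2) = exp (2 * M1) ^ k" for k
    proof -
      have "bateman \<alpha> \<beta> k (1 + (sinh t)\<^sup>2) ((sinh t)\<^sup>2) = (LINT p|?m. exp (2 * horo t p) ^ k)"
        using integral_exp_horo[OF t, of k] by (simp add: cosh_square_eq add.commute)
      also have "\<dots> = (LINT p|?m. exp (2 * M1) ^ k)"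
        by (rule integral_cong_AE) (use h in \<open>auto simp: increment_def elim!: eventually_mono\<close>)
      finally show ?thesis by (simp add: m.prob_space)
    qed
    show False
      using bateman_2_gt_square[OF \<beta>_ge \<beta>_le \<alpha>_gt a] unfolding B by simp
  qed
  have "AE t in \<nu>. t = 0"
    using AE2 AE_space by eventually_elim (auto simp: space_\<nu> intro: t0)
  then have "\<nu> = return half_line 0"
  proof (intro measure_eqI)
    fix A assume "A \<in> sets \<nu>"
    then have A: "A \<in> sets \<nu>" "A \<in> sets half_line" using \<nu>(2) by auto
    assume z: "AE t in \<nu>. t = 0"
    have "emeasure \<nu> A = (\<integral>\<^sup>+t. indicator A t \<partial>\<nu>)" using A by simp
    also have "\<dots> = (\<integral>\<^sup>+t. indicator A 0 \<partial>\<nu>)"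
      by (rule nn_integral_cong_AE) (use z in \<open>auto elim!: eventually_mono\<close>)
    also have "\<dots> = indicator A 0" by (simp add: n.emeasure_space_1)
    finally show "emeasure \<nu> A = emeasure (return half_line 0) A" using A(2) by simp
  qed (simp add: \<nu>(2))
  with ne show False by contradiction
qed

end

section \<open>The law of the random walk\<close>
locale jacobi_walk = jacobi_increment +
  fixes P :: "'a measure" and S :: "nat \<Rightarrow> 'a \<Rightarrow> real"
  assumes walk: "jacobi_random_walk \<alpha> \<beta> \<nu> P S"
begin

lemma prob_space_P: "prob_space P"
  using walk by (simp add: jacobi_random_walk_def markov_chain_def)

sublocale P: prob_space P
  by (rule prob_space_P)

lemma S_measurable [measurable]: "S n \<in> borel_measurable P"
  using walk by (auto simp: jacobi_random_walk_def markov_chain_def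
      intro!: measurable_compose[of "S n" P half_line "\<lambda>x. x" borel, OF _ measurable_restrict_space1])

lemma S_nonneg: "\<omega> \<in> space P \<Longrightarrow> 0 \<le> S n \<omega>"
proof -
  assume "\<omega> \<in> space P"
  moreover have "S n \<in> measurable P half_line"
    using walk by (simp add: jacobi_random_walk_def markov_chain_def)
  ultimately show ?thesis using measurable_space[of "S n" P half_line \<omega>] by (simp add: space_half_line)
qed

text \<open>
  Integrating the Markov property removes the conditioning: the law of the next position is the
  image of three independent variables, the present position, a step length and a disc point.
\<close>
lemma distr_jacobi_random_walk_Suc:
  shows "distr P half_line (S (Suc n)) =
    distr (distr P half_line (S n) \<Otimes>\<^sub>M (\<nu> \<Otimes>\<^sub>M jacobi_measure \<alpha> \<beta>)) half_line
      (\<lambda>y. jacobi_point_map (fst y) (fst (snd y)) (snd (snd y)))"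
proof -
  let ?m = "jacobi_measure \<alpha> \<beta>"
  let ?K = "\<lambda>x. jacobi_conv \<alpha> \<beta> (return half_line x) \<nu>"
  let ?T = "\<lambda>y. jacobi_point_map (fst y) (fst (snd y)) (snd (snd y))"
  interpret m: prob_space ?m by (rule prob_space_jacobi_measure)
  interpret nm: pair_prob_space \<nu> ?m ..
  have S: "S k \<in> measurable P half_line" for k
    using walk by (simp add: jacobi_random_walk_def markov_chain_def)
  have S0: "0 \<le> S k \<omega>" if "\<omega> \<in> space P" for k \<omega>
    using measurable_space[OF S that] by (simp add: space_half_line)
  let ?F = "history_algebra P half_line S n"
  have sub: "subalgebra P ?F"
    unfolding subalgebra_def
  proof
    show "space ?F = space P" by (simp add: history_algebra_def space_measure_of_conv)
    have "sets ?F = sigma_sets (space P) (\<Union>i\<le>n. {S i -` A \<inter> space P | A. A \<in> sets half_line})"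
      unfolding history_algebra_def by (rule sets_measure_of) auto
    also have "\<dots> \<subseteq> sets P"
      using measurable_sets[OF S] by (intro sets.sigma_sets_subset) auto
    finally show "sets ?F \<subseteq> sets P" .
  qed
  interpret F: finite_measure_subalgebra P ?F by standard (rule sub)
  let ?\<mu> = "distr P half_line (S n)"
  have T\<mu>: "?T \<in> measurable (?\<mu> \<Otimes>\<^sub>M (\<nu> \<Otimes>\<^sub>M ?m)) half_line" and T\<nu>: "?T \<in> measurable (half_line \<Otimes>\<^sub>M (\<nu> \<Otimes>\<^sub>M ?m)) half_line"
    using measurable_jacobi_point_map_triple
    by (simp_all add: measurable_cong_sets[OF sets_pair_measure_cong[OF refl sets_pair_measure_cong[OF \<nu>(2) refl]] refl]
       measurable_cong_sets[OF sets_pair_measure_cong[OF sets_distr sets_pair_measure_cong[OF \<nu>(2) refl]] refl])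
  show ?thesis
  proof (rule measure_eqI)
    fix A assume "A \<in> sets (distr P half_line (S (Suc n)))"
    then have A: "A \<in> sets half_line" by simp
    let ?B = "?T -` A \<inter> space (half_line \<Otimes>\<^sub>M (\<nu> \<Otimes>\<^sub>M ?m))"
    have B: "?B \<in> sets (half_line \<Otimes>\<^sub>M (\<nu> \<Otimes>\<^sub>M ?m))" by (rule measurable_sets[OF T\<nu> A])
    have Bm: "(\<lambda>x. emeasure (\<nu> \<Otimes>\<^sub>M ?m) (Pair x -` ?B)) \<in> borel_measurable half_line"
      by (rule nm.measurable_emeasure_Pair[OF B])
    let ?k = "\<lambda>x. measure (\<nu> \<Otimes>\<^sub>M ?m) (Pair x -` ?B)"
    have km: "(\<lambda>\<omega>. ?k (S n \<omega>)) \<in> borel_measurable P"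
      using measurable_compose[OF S Bm] unfolding measure_def by measurable
    let ?I = "indicator (S (Suc n) -` A \<inter> space P) :: _ \<Rightarrow> real"
    have SA: "S (Suc n) -` A \<inter> space P \<in> sets P" by (rule measurable_sets[OF S A])
    have I: "integrable P ?I" using SA by (simp add: integrable_indicator_iff P.emeasure_eq_measure)
    have "P.prob (S (Suc n) -` A \<inter> space P) = (\<integral>\<omega>. ?I \<omega> \<partial>P)"
      using SA by simp
    also have "\<dots> = (\<integral>\<omega>. real_cond_exp P ?F ?I \<omega> \<partial>P)" using F.real_cond_exp_int(2)[OF I] by simp
    also have "\<dots> = (\<integral>\<omega>. ?k (S n \<omega>) \<partial>P)"
    proof (rule integral_cong_AE)
      have "AE \<omega> in P. real_cond_exp P ?F ?I \<omega> = measure (?K (S n \<omega>)) A"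
        using walk A by (simp add: jacobi_random_walk_def markov_chain_def)
      then show "AE \<omega> in P. real_cond_exp P ?F ?I \<omega> = ?k (S n \<omega>)"
        using AE_space by eventually_elim (simp add: measure_def jacobi_conv_return[OF S_nonneg A])
    qed (use km in \<open>auto intro: borel_measurable_cond_exp2\<close>)
    finally have "emeasure P (S (Suc n) -` A \<inter> space P) = ennreal (\<integral>\<omega>. ?k (S n \<omega>) \<partial>P)"
      by (simp add: P.emeasure_eq_measure)
    also have "\<dots> = (\<integral>\<^sup>+\<omega>. ennreal (?k (S n \<omega>)) \<partial>P)"
      by (rule nn_integral_eq_integral[symmetric], rule P.integrable_const_bound[where B = 1]) (use km in auto)
    also have "\<dots> = (\<integral>\<^sup>+\<omega>. emeasure (\<nu> \<Otimes>\<^sub>M ?m) (Pair (S n \<omega>) -` ?B) \<partial>P)"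
      by (simp add: nm.emeasure_eq_measure)
    also have "\<dots> = (\<integral>\<^sup>+x. emeasure (\<nu> \<Otimes>\<^sub>M ?m) (Pair x -` ?B) \<partial>?\<mu>)"
      by (rule nn_integral_distr[symmetric, OF S]) (use Bm in simp)
    also have "\<dots> = emeasure (?\<mu> \<Otimes>\<^sub>M (\<nu> \<Otimes>\<^sub>M ?m)) ?B"
      by (rule nm.emeasure_pair_measure_alt[symmetric])
         (use B in \<open>simp add: sets_pair_measure_cong[OF sets_distr refl]\<close>)
    also have "\<dots> = emeasure (distr (?\<mu> \<Otimes>\<^sub>M (\<nu> \<Otimes>\<^sub>M ?m)) half_line ?T) A"
      by (subst emeasure_distr[OF T\<mu> A]) (simp add: space_pair_measure)
    finally show "emeasure (distr P half_line (S (Suc n))) A = emeasure (distr (?\<mu> \<Otimes>\<^sub>M (\<nu> \<Otimes>\<^sub>M ?m)) half_line ?T) A"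
      by (simp add: emeasure_distr[OF S A])
  qed simp
qed

text \<open>
  The product formula makes the Jacobi function multiplicative along the walk. In other words, the
  horocyclic coordinate of the walk is distributed like a sum of independent increments.
\<close>
lemma integral_jacobi_char_walk:
  shows "(LINT \<omega>|P. jacobi_char \<alpha> \<beta> \<theta> (S n \<omega>)) = (LINT t|\<nu>. jacobi_char \<alpha> \<beta> \<theta> t) ^ n"
proof (induction n)
  case 0
  interpret m: prob_space "jacobi_measure \<alpha> \<beta>" by (rule prob_space_jacobi_measure)
  have S: "S 0 \<in> measurable P half_line"
    using walk by (simp add: jacobi_random_walk_def markov_chain_def)
  have [measurable]: "S 0 \<in> borel_measurable P"
    by (rule measurable_compose[OF S measurable_restrict_space1]) simp
  note [measurable] = borel_measurable_jacobi_char
  have one: "jacobi_char \<alpha> \<beta> \<theta> 0 = 1"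
    by (simp add: jacobi_char_def horo_def horo_sq_def m.prob_space)
  have "AE \<omega> in P. S 0 \<omega> = 0"
    using walk by (simp add: jacobi_random_walk_def markov_chain_def)
  then have "(LINT \<omega>|P. jacobi_char \<alpha> \<beta> \<theta> (S 0 \<omega>)) = (LINT \<omega>|P. 1)"
    by (intro integral_cong_AE) (auto simp: one elim!: eventually_mono)
  then show ?case by (simp add: P.prob_space)
next
  case (Suc n)
  let ?m = "jacobi_measure \<alpha> \<beta>" and ?\<Phi> = "jacobi_char \<alpha> \<beta> \<theta>"
  let ?T = "\<lambda>y. jacobi_point_map (fst y) (fst (snd y)) (snd (snd y))"
  interpret m: prob_space ?m by (rule prob_space_jacobi_measure)
  have S: "S k \<in> measurable P half_line" for k
    using walk by (simp add: jacobi_random_walk_def markov_chain_def)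
  let ?\<mu> = "distr P half_line (S n)"
  interpret \<mu>: prob_space ?\<mu> by (rule P.prob_space_distr[OF S])
  interpret nm: pair_prob_space \<nu> ?m ..
  interpret mnm: pair_prob_space ?\<mu> "\<nu> \<Otimes>\<^sub>M ?m" ..
  have sp: "space \<nu> = {0..}" "space ?\<mu> = {0..}"
    using sets_eq_imp_space_eq[OF \<nu>(2)] by (simp_all add: space_half_line)
  have \<Phi>h: "?\<Phi> \<in> borel_measurable half_line"
    by (rule measurable_restrict_space1[OF borel_measurable_jacobi_char])
  have \<Phi>\<nu>: "?\<Phi> \<in> borel_measurable \<nu>" using \<Phi>h by (simp add: measurable_cong_sets[OF \<nu>(2) refl])
  have T: "?T \<in> measurable (?\<mu> \<Otimes>\<^sub>M (\<nu> \<Otimes>\<^sub>M ?m)) half_line"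
    using measurable_jacobi_point_map_triple
    by (simp add: measurable_cong_sets[OF sets_pair_measure_cong[OF sets_distr sets_pair_measure_cong[OF \<nu>(2) refl]] refl])
  have \<Phi>T: "(\<lambda>y. ?\<Phi> (?T y)) \<in> borel_measurable (?\<mu> \<Otimes>\<^sub>M (\<nu> \<Otimes>\<^sub>M ?m))"
    by (rule measurable_compose[OF T \<Phi>h])
  have "(LINT \<omega>|P. ?\<Phi> (S (Suc n) \<omega>)) = (LINT x|distr P half_line (S (Suc n)). ?\<Phi> x)"
    by (rule integral_distr[symmetric, OF S \<Phi>h])
  also have "\<dots> = (LINT y|(?\<mu> \<Otimes>\<^sub>M (\<nu> \<Otimes>\<^sub>M ?m)). ?\<Phi> (?T y))"
    unfolding distr_jacobi_random_walk_Suc by (rule integral_distr[OF T \<Phi>h])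
  also have "\<dots> = (LINT s|?\<mu>. LINT z|(\<nu> \<Otimes>\<^sub>M ?m). ?\<Phi> (?T (s, z)))"
    by (rule mnm.integral_fst'[symmetric], rule mnm.integrable_const_bound[where B = 1])
       (use \<Phi>T norm_jacobi_char_le in auto)
  also have "\<dots> = (LINT s|?\<mu>. LINT t|\<nu>. LINT w|?m. ?\<Phi> (jacobi_point_map s t w))"
  proof (rule Bochner_Integration.integral_cong[OF refl])
    fix s assume s: "s \<in> space ?\<mu>"
    have "(\<lambda>z. ?\<Phi> (?T (s, z))) \<in> borel_measurable (\<nu> \<Otimes>\<^sub>M ?m)"
      by (rule measurable_compose[OF measurable_Pair1'[OF s] \<Phi>T])
    then have "integrable (\<nu> \<Otimes>\<^sub>M ?m) (\<lambda>z. ?\<Phi> (?T (s, z)))"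
      by (intro nm.integrable_const_bound[where B = 1]) (use norm_jacobi_char_le in auto)
    from nm.integral_fst'[OF this]
    show "(LINT z|(\<nu> \<Otimes>\<^sub>M ?m). ?\<Phi> (?T (s, z))) = (LINT t|\<nu>. LINT w|?m. ?\<Phi> (jacobi_point_map s t w))" by simp
  qed
  also have "\<dots> = (LINT s|?\<mu>. LINT t|\<nu>. ?\<Phi> s * ?\<Phi> t)"
    using sp by (intro Bochner_Integration.integral_cong refl jacobi_char_product[symmetric]) auto
  also have "\<dots> = (LINT s|?\<mu>. ?\<Phi> s) * (LINT t|\<nu>. ?\<Phi> t)" by simp
  also have "(LINT s|?\<mu>. ?\<Phi> s) = (LINT \<omega>|P. ?\<Phi> (S n \<omega>))"
    by (rule integral_distr[OF S \<Phi>h])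
  finally show ?case using Suc by simp
qed

definition centred_law :: "real measure" where
  "centred_law = distr increment_space borel (\<lambda>z. increment z - mom1)"

text \<open>
  The walk together with an independent disc point, from which the horocyclic coordinate is read off.
\<close>
definition walk_space :: "('a \<times> real \<times> real) measure" where
  "walk_space = P \<Otimes>\<^sub>M jacobi_measure \<alpha> \<beta>"

definition normalized_walk :: "nat \<Rightarrow> 'a \<Rightarrow> real" where
  "normalized_walk n \<omega> = (S n \<omega> - real n * mom1) / sqrt (real n)"

definition normalized_horo :: "nat \<Rightarrow> 'a \<times> real \<times> real \<Rightarrow> real" where
  "normalized_horo n z = (horo (S n (fst z)) (snd z) - real n * mom1) / sqrt (real n)"

lemma prob_space_walk: "prob_space walk_space"
  unfolding walk_space_def by (rule prob_space_pair[OF prob_space_P prob_space_jacobi_measure])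

sublocale W: prob_space walk_space
  by (rule prob_space_walk)

lemma normalized_walk_measurable [measurable]: "normalized_walk n \<in> borel_measurable P"
  unfolding normalized_walk_def[abs_def] by measurable

lemma normalized_horo_measurable [measurable]: "normalized_horo n \<in> borel_measurable walk_space"
  unfolding normalized_horo_def[abs_def] walk_space_def
  by (intro borel_measurable_divide borel_measurable_diff borel_measurable_horo) measurable

lemma integral_iexp_normalized_horo:
  "(LINT z|walk_space. iexp (\<theta> * normalized_horo n z)) = char centred_law (\<theta> / sqrt (real n)) ^ n"
proof -
  let ?m = "jacobi_measure \<alpha> \<beta>"
  interpret m: prob_space ?m by (rule prob_space_jacobi_measure)
  interpret Pm: pair_prob_space P ?m ..
  define u where "u = \<theta> / sqrt (real n)"
  have c: "char centred_law u = iexp (- (u * mom1)) * (LINT t|\<nu>. jacobi_char \<alpha> \<beta> u t)"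
  proof -
    have "char centred_law u = (LINT z|increment_space. iexp (u * (increment z - mom1)))"
      unfolding char_def centred_law_def by (rule integral_distr) measurable
    also have "\<dots> = (LINT z|increment_space. iexp (- (u * mom1)) * iexp (u * increment z))"
      by (simp add: exp_add[symmetric] algebra_simps)
    also have "\<dots> = iexp (- (u * mom1)) * (LINT z|increment_space. iexp (u * increment z))" by simp
    finally show ?thesis by (simp only: integral_iexp_increment)
  qed
  have hm: "(\<lambda>z. horo (S n (fst z)) (snd z)) \<in> borel_measurable (P \<Otimes>\<^sub>M ?m)"
    by (intro borel_measurable_horo) measurable
  have "(LINT z|walk_space. iexp (\<theta> * normalized_horo n z)) =
     (LINT z|walk_space. iexp (- (u * mom1)) ^ n * iexp (u * horo (S n (fst z)) (snd z)))"
  proof (rule Bochner_Integration.integral_cong[OF refl])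
    fix z
    have "\<theta> * normalized_horo n z = real n * (- (u * mom1)) + u * horo (S n (fst z)) (snd z)"
      by (simp add: normalized_horo_def u_def diff_divide_distrib right_diff_distrib mult_ac)
    then show "iexp (\<theta> * normalized_horo n z) = iexp (- (u * mom1)) ^ n * iexp (u * horo (S n (fst z)) (snd z))"
      by (simp only: exp_of_nat_mult[symmetric] exp_add[symmetric]) (simp add: algebra_simps)
  qed
  also have "\<dots> = iexp (- (u * mom1)) ^ n * (LINT z|(P \<Otimes>\<^sub>M ?m). iexp (u * horo (S n (fst z)) (snd z)))"
    by (simp add: walk_space_def)
  also have "(LINT z|(P \<Otimes>\<^sub>M ?m). iexp (u * horo (S n (fst z)) (snd z))) = (LINT \<omega>|P. jacobi_char \<alpha> \<beta> u (S n \<omega>))"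
  proof -
    have "integrable (P \<Otimes>\<^sub>M ?m) (\<lambda>z. iexp (u * horo (S n (fst z)) (snd z)))"
      by (rule Pm.integrable_iexp) (use hm in measurable)
    from Pm.integral_fst'[OF this, symmetric] show ?thesis by (simp add: jacobi_char_def)
  qed
  also have "\<dots> = (LINT t|\<nu>. jacobi_char \<alpha> \<beta> u t) ^ n"
    by (rule integral_jacobi_char_walk)
  finally show ?thesis unfolding u_def[symmetric] c by (simp add: power_mult_distrib)
qed

text \<open>
  The bound is uniform in the position of the walk, since a large defect forces the disc point to be
  close to -1.
\<close>
lemma horo_deficit_tail:
  obtains C where "0 \<le> C" "\<And>n w. 0 < w \<Longrightarrow>
    measure walk_space {z \<in> space walk_space. w < S n (fst z) - horo (S n (fst z)) (snd z)} \<le> C / w\<^sup>2"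
proof -
  let ?m = "jacobi_measure \<alpha> \<beta>"
  interpret m: prob_space ?m by (rule prob_space_jacobi_measure)
  interpret Pm: pair_prob_space P ?m ..
  obtain C where C: "0 \<le> C" "\<And>w. 0 < w \<Longrightarrow>
    m.prob {p \<in> space ?m. fst p * cos (snd p) < 2 * exp (- w) - 1} \<le> C / w\<^sup>2"
    by (rule measure_cos_near_minus_one_le) (rule that; assumption)
  show thesis
  proof (rule that[OF C(1)])
    fix n :: nat and w :: real assume w: "0 < w"
    let ?A = "{p \<in> space ?m. fst p * cos (snd p) < 2 * exp (- w) - 1}"
    have A: "?A \<in> sets ?m" by measurable
    have "measure walk_space {z \<in> space walk_space. w < S n (fst z) - horo (S n (fst z)) (snd z)}
      \<le> measure walk_space (space P \<times> ?A)"
      unfolding walk_space_def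
    proof (rule Pm.finite_measure_mono)
      show "{z \<in> space (P \<Otimes>\<^sub>M ?m). w < S n (fst z) - horo (S n (fst z)) (snd z)} \<subseteq> space P \<times> ?A"
      proof safe
        fix \<omega> r \<phi> assume z: "(\<omega>, (r, \<phi>)) \<in> space (P \<Otimes>\<^sub>M ?m)"
          and l: "w < S n (fst (\<omega>, (r, \<phi>))) - horo (S n (fst (\<omega>, (r, \<phi>)))) (snd (\<omega>, (r, \<phi>)))"
        then show "\<omega> \<in> space P" "(r, \<phi>) \<in> space ?m" by (auto simp: space_pair_measure)
        then have "0 \<le> S n \<omega>" "(r, \<phi>) \<in> {0..1} \<times> {0..pi}" using S_nonneg by (auto simp: space_jacobi_measure)
        then show "fst (r, \<phi>) * cos (snd (r, \<phi>)) < 2 * exp (- w) - 1"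
          using horo_ge_of_cos_gt[of "(r, \<phi>)" "S n \<omega>" w] w l by (auto simp: not_le[symmetric])
      qed
    qed (use A in auto)
    also have "\<dots> = m.prob ?A"
      unfolding walk_space_def measure_def
      by (subst m.emeasure_pair_measure_Times) (use A in \<open>simp_all add: P.emeasure_space_1\<close>)
    also have "\<dots> \<le> C / w\<^sup>2" by (rule C(2)[OF w])
    finally show "measure walk_space {z \<in> space walk_space. w < S n (fst z) - horo (S n (fst z)) (snd z)} \<le> C / w\<^sup>2" .
  qed
qed

lemma normalized_walk_horo_diff:
  assumes "z \<in> space walk_space"
  shows "normalized_walk n (fst z) - normalized_horo n z = (S n (fst z) - horo (S n (fst z)) (snd z)) / sqrt (real n)"
    "0 \<le> S n (fst z) - horo (S n (fst z)) (snd z)"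
proof -
  show "normalized_walk n (fst z) - normalized_horo n z = (S n (fst z) - horo (S n (fst z)) (snd z)) / sqrt (real n)"
    by (simp add: normalized_walk_def normalized_horo_def diff_divide_distrib)
  have "0 \<le> S n (fst z)" "snd z \<in> {0..1} \<times> {0..pi}"
    using assms S_nonneg by (auto simp: walk_space_def space_pair_measure space_jacobi_measure)
  then show "0 \<le> S n (fst z) - horo (S n (fst z)) (snd z)" using horo_bounds(2) by fastforce
qed

lemma distr_walk_fst: "distr walk_space borel (\<lambda>z. f (fst z)) = distr P borel f"
  if [measurable]: "f \<in> borel_measurable P" for f
proof -
  interpret m: prob_space "jacobi_measure \<alpha> \<beta>" by (rule prob_space_jacobi_measure)
  have "distr P borel f = distr (distr walk_space P fst) borel f"
    by (simp add: walk_space_def m.distr_pair_fst)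
  also have "\<dots> = distr walk_space borel (f \<circ> fst)"
    by (rule distr_distr) (simp_all add: walk_space_def)
  finally show ?thesis by (simp add: comp_def)
qed

end

section \<open>The central limit theorem and its rate\<close>
locale jacobi_walk_clt = jacobi_walk +
  assumes sq: "integrable \<nu> (\<lambda>t. t ^ 2)" and ne: "\<nu> \<noteq> return half_line 0"
begin

definition stddev :: real where "stddev = sqrt (mom2 - mom1\<^sup>2)"

lemma stddev_pos: "0 < stddev" and stddev_sq: "stddev\<^sup>2 = mom2 - mom1\<^sup>2"
  using variance_increment_pos[OF sq ne] by (simp_all add: stddev_def)

lemma
  shows real_distribution_centred_law: "real_distribution centred_law"
    and centred_law_1: "integrable centred_law (\<lambda>x. x)" "(LINT x|centred_law. x) = 0"
    and centred_law_2: "integrable centred_law (\<lambda>x. x\<^sup>2)" "(LINT x|centred_law. x\<^sup>2) = stddev\<^sup>2"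
proof -
  have i1: "integrable increment_space increment" and i2: "integrable increment_space (\<lambda>z. (increment z)\<^sup>2)"
    using integrable_increment_power[OF integrable_first_moment[OF sq]] integrable_increment_power[OF sq] by simp_all
  have e1: "I.expectation increment = mom1" and e2: "I.expectation (\<lambda>z. (increment z)\<^sup>2) = mom2"
    using integral_increment_power[OF integrable_first_moment[OF sq]] integral_increment_power[OF sq] by simp_all
  show "real_distribution centred_law" unfolding centred_law_def by (rule I.real_distribution_distr) measurable
  show "integrable centred_law (\<lambda>x. x)" "(LINT x|centred_law. x) = 0"
    unfolding centred_law_def using i1 e1
    by (simp_all add: integrable_distr_eq integral_distr I.prob_space)
  show "integrable centred_law (\<lambda>x. x\<^sup>2)" "(LINT x|centred_law. x\<^sup>2) = stddev\<^sup>2"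
    unfolding centred_law_def stddev_sq using i1 i2 I.variance_eq[OF i1 i2] e1 e2
    by (simp_all add: integrable_distr_eq integral_distr power2_diff)
qed

lemma centred_law_3:
  assumes "integrable \<nu> (\<lambda>t. t ^ 3)"
  shows "integrable centred_law (\<lambda>x. \<bar>x\<bar> ^ 3)"
proof -
  have i: "integrable increment_space (\<lambda>z. increment z ^ k)" if "k \<in> {1, 2, 3}" for k
    using that integrable_increment_power[OF integrable_first_moment[OF sq]] integrable_increment_power[OF sq]
      integrable_increment_power[OF assms] by auto
  have "integrable increment_space (\<lambda>z. (increment z - mom1) ^ 3)"
  proof -
    have "(increment z - mom1) ^ 3 = increment z ^ 3 - 3 * mom1 * increment z ^ 2 + 3 * mom1\<^sup>2 * increment z ^ 1 - mom1 ^ 3" for z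
      by (simp add: power3_eq_cube power2_eq_square algebra_simps)
    then show ?thesis
      by (simp only:) (intro Bochner_Integration.integrable_add Bochner_Integration.integrable_diff integrable_mult_right i; simp)
  qed
  then have "integrable increment_space (\<lambda>z. \<bar>(increment z - mom1) ^ 3\<bar>)" by (rule integrable_abs)
  then show ?thesis unfolding centred_law_def by (simp add: integrable_distr_eq power_abs)
qed

text \<open>
  The walk and its horocyclic coordinate differ by at most \<open>w\<close> outside an event of probability
  \<open>O(w^(-2))\<close>. After division by \<open>sqrt n\<close>, with \<open>w = n powr (1/4)\<close>, the characteristic functions have
  the same limit.
\<close>
lemma weak_conv_normalized_walk:
  "weak_conv_m (\<lambda>n. distr P borel (normalized_walk n)) (density lborel (normal_density 0 stddev))"
proof (rule levy_continuity)
  interpret C: real_distribution centred_law by (rule real_distribution_centred_law)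
  show "real_distribution (distr P borel (normalized_walk n))" for n
    by (rule P.real_distribution_distr) measurable
  show "real_distribution (density lborel (normal_density 0 stddev))"
    by (rule real_distribution_normal[OF stddev_pos])
  fix \<theta> :: real
  obtain C where C: "0 \<le> C" "\<And>n w. 0 < w \<Longrightarrow>
    W.prob {z \<in> space walk_space. w < S n (fst z) - horo (S n (fst z)) (snd z)} \<le> C / w\<^sup>2"
    by (rule horo_deficit_tail) (rule that; assumption)
  have lim: "(\<lambda>n. char centred_law (\<theta> / sqrt (real n)) ^ n) \<longlonglongrightarrow> complex_of_real (exp (- (stddev\<^sup>2 * \<theta>\<^sup>2 / 2)))"
    by (rule C.char_power_tendsto[OF centred_law_1 centred_law_2])
  have bound: "cmod (char (distr P borel (normalized_walk n)) \<theta> - char centred_law (\<theta> / sqrt (real n)) ^ n)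
     \<le> \<bar>\<theta>\<bar> * real n powr (-1/4) + 2 * C * real n powr (-1/2)" if n: "n \<ge> 1" for n
  proof -
    define w where "w = real n powr (1/4)"
    have w: "0 < w" using n by (simp add: w_def)
    let ?D = "\<lambda>z. S n (fst z) - horo (S n (fst z)) (snd z)"
    let ?A = "{z \<in> space walk_space. w < ?D z}"
    have wm[measurable]: "(\<lambda>z. normalized_walk n (fst z)) \<in> borel_measurable walk_space"
      unfolding walk_space_def by measurable
    have Dm: "?D \<in> borel_measurable walk_space"
      unfolding walk_space_def
      by (intro borel_measurable_diff borel_measurable_horo) measurable
    have A: "?A \<in> sets walk_space" using Dm by measurable
    have ie: "integrable walk_space (\<lambda>z. iexp (\<theta> * f z))" if "f \<in> borel_measurable walk_space" for f
      using that by (intro W.integrable_iexp) simp_all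
    have "char (distr P borel (normalized_walk n)) \<theta> = (LINT z|walk_space. iexp (\<theta> * normalized_walk n (fst z)))"
      unfolding distr_walk_fst[OF normalized_walk_measurable, symmetric] char_def
      by (rule integral_distr) measurable
    then have diff: "char (distr P borel (normalized_walk n)) \<theta> - char centred_law (\<theta> / sqrt (real n)) ^ n
       = (LINT z|walk_space. iexp (\<theta> * normalized_walk n (fst z)) - iexp (\<theta> * normalized_horo n z))"
      unfolding integral_iexp_normalized_horo[symmetric]
      by (simp only: Bochner_Integration.integral_diff[OF ie[OF wm] ie[OF normalized_horo_measurable]])
    have "cmod (char (distr P borel (normalized_walk n)) \<theta> - char centred_law (\<theta> / sqrt (real n)) ^ n)
      \<le> (LINT z|walk_space. \<bar>\<theta>\<bar> * w / sqrt (real n) + 2 * indicator ?A z)"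
      unfolding diff
    proof (rule order_trans[OF integral_norm_bound integral_mono_AE])
      show "integrable walk_space (\<lambda>z. cmod (iexp (\<theta> * normalized_walk n (fst z)) - iexp (\<theta> * normalized_horo n z)))"
        by (intro integrable_norm Bochner_Integration.integrable_diff ie) measurable
      show "integrable walk_space (\<lambda>z. \<bar>\<theta>\<bar> * w / sqrt (real n) + 2 * indicator ?A z)"
        using A by (auto simp: integrable_indicator_iff W.emeasure_eq_measure)
      show "AE z in walk_space. cmod (iexp (\<theta> * normalized_walk n (fst z)) - iexp (\<theta> * normalized_horo n z))
         \<le> \<bar>\<theta>\<bar> * w / sqrt (real n) + 2 * indicator ?A z"
      proof (rule AE_I2)
        fix z assume z: "z \<in> space walk_space"
        let ?a = "\<theta> * normalized_walk n (fst z)" and ?b = "\<theta> * normalized_horo n z"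
        show "cmod (iexp ?a - iexp ?b) \<le> \<bar>\<theta>\<bar> * w / sqrt (real n) + 2 * indicator ?A z"
        proof (cases "z \<in> ?A")
          case True
          have "cmod (iexp ?a - iexp ?b) \<le> 1 + 1"
            by (rule order_trans[OF norm_triangle_ineq4]) (simp only: norm_exp_i_times order_refl)
          moreover have "0 \<le> \<bar>\<theta>\<bar> * w / sqrt (real n)" using w by simp
          ultimately show ?thesis using True by simp
        next
          case False
          have "iexp ?a - iexp ?b = iexp ?b * (iexp (?a - ?b) - 1)"
            by (simp add: algebra_simps exp_diff exp_add)
          then have "cmod (iexp ?a - iexp ?b) = cmod (iexp (?a - ?b) - 1)"
            by (simp only: norm_mult norm_exp_i_times)
          also have "\<dots> \<le> \<bar>?a - ?b\<bar>" using iexp_approx1[of "?a - ?b" 0] by simp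
          also have "\<dots> = \<bar>\<theta>\<bar> * (?D z / sqrt (real n))"
            unfolding right_diff_distrib[symmetric] normalized_walk_horo_diff(1)[OF z] abs_mult
            using normalized_walk_horo_diff(2)[OF z, of n] by simp
          also have "\<dots> \<le> \<bar>\<theta>\<bar> * (w / sqrt (real n))"
            using False z by (intro mult_left_mono divide_right_mono) auto
          finally show ?thesis using False by simp
        qed
      qed
    qed
    also have "\<dots> = \<bar>\<theta>\<bar> * w / sqrt (real n) + 2 * W.prob ?A"
      using A by (subst Bochner_Integration.integral_add) (auto simp: W.prob_space integrable_indicator_iff W.emeasure_eq_measure)
    also have "\<dots> \<le> \<bar>\<theta>\<bar> * (w / sqrt (real n)) + 2 * (C / w\<^sup>2)" using C(2)[OF w, of n] by simp
    also have "\<dots> = \<bar>\<theta>\<bar> * real n powr (-1/4) + 2 * C * real n powr (-1/2)"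
    proof -
      have "w / sqrt (real n) = real n powr (1/4) / real n powr (1/2)" using n by (simp add: w_def powr_half_sqrt)
      also have "\<dots> = real n powr (1/4 - 1/2)" by (rule powr_diff[symmetric])
      finally have 1: "w / sqrt (real n) = real n powr (-1/4)" by simp
      have "w\<^sup>2 = real n powr (1/2)" using n by (simp add: w_def powr_power)
      then have 2: "1 / w\<^sup>2 = real n powr (-1/2)"
        using powr_minus_divide[of "real n" "1/2"] by simp
      have "2 * (C / w\<^sup>2) = 2 * C * (1 / w\<^sup>2)" by simp
      then show ?thesis unfolding 1 2 by simp
    qed
    finally show ?thesis .
  qed
  have "(\<lambda>n. real n powr (-1/4)) \<longlonglongrightarrow> 0" "(\<lambda>n. real n powr (-1/2)) \<longlonglongrightarrow> 0"
    by (intro tendsto_neg_powr filterlim_real_sequentially; simp)+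
  then have null: "(\<lambda>n. \<bar>\<theta>\<bar> * real n powr (-1/4) + 2 * C * real n powr (-1/2)) \<longlonglongrightarrow> 0"
    by (intro tendsto_add_zero tendsto_mult_right_zero)
  have "(\<lambda>n. char (distr P borel (normalized_walk n)) \<theta> - char centred_law (\<theta> / sqrt (real n)) ^ n) \<longlonglongrightarrow> 0"
    by (rule Lim_null_comparison[OF eventually_sequentiallyI[of 1] null]) (rule bound)
  from Lim_transform[OF lim this]
  show "(\<lambda>n. char (distr P borel (normalized_walk n)) \<theta>) \<longlonglongrightarrow> char (density lborel (normal_density 0 stddev)) \<theta>"
    unfolding char_normal[OF stddev_pos] .
qed

text \<open>
  If the mean were not positive, then \<open>S_n - n M1 \<ge> 0\<close> for all \<open>n\<close>, while the normal limit charges the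
  negative half line.
\<close>
lemma mom1_pos: "0 < mom1"
proof (rule ccontr)
  assume "\<not> 0 < mom1"
  then have le: "mom1 \<le> 0" by simp
  let ?G = "density lborel (normal_density 0 stddev)"
  interpret G: real_distribution ?G by (rule real_distribution_normal[OF stddev_pos])
  have "isCont (cdf ?G) (-1)" by (simp add: G.isCont_cdf measure_singleton_normal)
  then have lim: "(\<lambda>n. cdf (distr P borel (normalized_walk n)) (-1)) \<longlonglongrightarrow> cdf ?G (-1)"
    using weak_conv_normalized_walk by (simp add: weak_conv_m_def weak_conv_def)
  have "cdf (distr P borel (normalized_walk n)) (-1) = 0" for n
  proof -
    have "normalized_walk n \<omega> \<ge> 0" if "\<omega> \<in> space P" for \<omega>
      unfolding normalized_walk_def
      using S_nonneg[OF that, of n] mult_nonneg_nonpos[OF of_nat_0_le_iff le, of n]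
      by (intro divide_nonneg_nonneg real_sqrt_ge_zero of_nat_0_le_iff) linarith
    then have "normalized_walk n -` {..-1} \<inter> space P = {}" by fastforce
    then show ?thesis by (simp add: cdf_def measure_distr)
  qed
  then have G0: "cdf ?G (-1) = 0" using lim by (simp add: LIMSEQ_const_iff)
  then have "emeasure ?G {..-1} = 0" by (simp add: cdf_def G.emeasure_eq_measure)
  then have "{..-1} \<in> null_sets ?G" by (simp add: null_sets_def)
  then have "AE x in lborel. x \<in> {..-1} \<longrightarrow> ennreal (normal_density 0 stddev x) = 0"
    by (subst (asm) null_sets_density_iff) auto
  then have "AE x in lborel. x \<notin> {..- 1 :: real}"
  proof (rule eventually_mono)
    fix x :: real
    have "ennreal (normal_density 0 stddev x) \<noteq> 0"
      using normal_density_pos[OF stddev_pos, of 0 x] by (simp add: ennreal_eq_0_iff not_le)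
    then show "x \<notin> {..-1}" if "x \<in> {..-1} \<longrightarrow> ennreal (normal_density 0 stddev x) = 0"
      using that by blast
  qed
  then have "emeasure lborel {..- 1 :: real} = 0"
    by (subst (asm) AE_iff_null_sets[symmetric]) auto
  moreover have "emeasure lborel {-2..- 1 :: real} \<le> emeasure lborel {..- 1 :: real}"
    by (rule emeasure_mono) auto
  ultimately show False by simp
qed

text \<open>
  \<open>Y\<close> is the normalized walk, and \<open>Y'\<close> its horocyclic counterpart plus \<open>e\<close> times an independent
  standard normal variable. The characteristic function of \<open>Y'\<close> is close to the normal one. If
  \<open>|Y - Y'| > 2 d\<close>, then the defect exceeds \<open>d sqrt n = n powr (1/6)\<close>, which has probability
  \<open>O(n powr (-1/3))\<close> by the quadratic tail bound, or the normal variable exceeds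
  \<open>d / e = n powr (1/12)\<close>, which has the same order by the fourth moment.
\<close>
lemma cdf_normalized_walk_rate:
  assumes cube: "integrable \<nu> (\<lambda>t. t ^ 3)"
  obtains K where "\<And>n x. n \<ge> (1::nat) \<Longrightarrow>
    \<bar>cdf (distr P borel (normalized_walk n)) x - cdf (density lborel (normal_density 0 stddev)) x\<bar> \<le> K * real n powr (-1/3)"
proof -
  let ?N = std_normal_distribution and ?G = "density lborel (normal_density 0 stddev)"
  interpret N: real_distribution ?N by (rule real_dist_normal_dist)
  interpret WN: pair_prob_space walk_space ?N ..
  interpret C: real_distribution centred_law by (rule real_distribution_centred_law)
  obtain B b where b: "\<And>n. n \<ge> 1 \<Longrightarrow> integrable lborel (b n)"
    "\<And>n. n \<ge> 1 \<Longrightarrow> (LINT t|lborel. b n t) \<le> B * real n powr (-1/3)"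
    "\<And>n t. n \<ge> (1::nat) \<Longrightarrow> cmod (char centred_law (t / sqrt (real n)) ^ n *
        complex_of_real (exp (- ((real n powr (-5/12))\<^sup>2 * t\<^sup>2 / 2))) - complex_of_real (exp (- (stddev\<^sup>2 * t\<^sup>2 / 2)))) \<le> \<bar>t\<bar> * b n t"
    by (rule C.char_power_smoothed_bound[OF centred_law_1 centred_law_2 stddev_pos centred_law_3[OF cube]])
       (rule that; assumption)
  obtain C where C: "0 \<le> C" "\<And>n w. 0 < w \<Longrightarrow>
    W.prob {z \<in> space walk_space. w < S n (fst z) - horo (S n (fst z)) (snd z)} \<le> C / w\<^sup>2"
    by (rule horo_deficit_tail) (rule that; assumption)
  define F4 where "F4 = N.expectation (\<lambda>x. x ^ 4)"
  show thesis
  proof (rule that[of "B / pi + 2 / stddev + (C + F4)"])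
    fix n :: nat and x :: real assume n: "n \<ge> 1"
    define e where "e = real n powr (-5/12)"
    define d where "d = real n powr (-1/3)"
    have rn: "real n > 0" using n by simp
    have e0: "0 < e" and d0: "0 < d" using rn by (simp_all add: e_def d_def)
    let ?\<Omega> = "walk_space \<Otimes>\<^sub>M ?N"
    define Y where "Y y = normalized_walk n (fst (fst y))" for y :: "('a \<times> real \<times> real) \<times> real"
    define Y' where "Y' y = normalized_horo n (fst y) + e * snd y" for y
    let ?D = "\<lambda>z. S n (fst z) - horo (S n (fst z)) (snd z)"
    have wm[measurable]: "(\<lambda>z. normalized_walk n (fst z)) \<in> borel_measurable walk_space"
      unfolding walk_space_def by measurable
    have Dm[measurable]: "?D \<in> borel_measurable walk_space"
      unfolding walk_space_def
      by (intro borel_measurable_diff borel_measurable_horo) measurable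
    have snd_m[measurable]: "snd \<in> borel_measurable ?\<Omega>"
      by (rule measurable_compose[OF measurable_snd, of "\<lambda>x. x"]) simp
    have Ym[measurable]: "Y \<in> borel_measurable ?\<Omega>" and Y'm[measurable]: "Y' \<in> borel_measurable ?\<Omega>"
      unfolding Y_def[abs_def] Y'_def[abs_def]
      by (rule measurable_compose[OF measurable_fst wm])
         (intro borel_measurable_add borel_measurable_times measurable_compose[OF measurable_fst normalized_horo_measurable] snd_m borel_measurable_const)
    have dY: "distr ?\<Omega> borel Y = distr P borel (normalized_walk n)"
    proof -
      have "distr ?\<Omega> borel Y = distr (distr ?\<Omega> walk_space fst) borel (\<lambda>z. normalized_walk n (fst z))"
        by (subst distr_distr) (simp_all add: Y_def[abs_def] comp_def)
      then show ?thesis by (simp add: N.distr_pair_fst distr_walk_fst)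
    qed
    have charY': "char (distr ?\<Omega> borel Y') t = char centred_law (t / sqrt (real n)) ^ n * complex_of_real (exp (- (e\<^sup>2 * t\<^sup>2 / 2)))" for t
    proof -
      have "char (distr ?\<Omega> borel Y') t = (LINT y|?\<Omega>. iexp (t * Y' y))"
        unfolding char_def by (rule integral_distr) measurable
      also have "\<dots> = (LINT z|walk_space. LINT g|?N. iexp (t * Y' (z, g)))"
        by (rule WN.integral_fst'[symmetric], rule WN.integrable_iexp) measurable
      also have "\<dots> = (LINT z|walk_space. LINT g|?N. iexp (t * normalized_horo n z) * iexp ((t * e) * g))"
        by (simp add: Y'_def exp_add[symmetric] algebra_simps)
      also have "\<dots> = (LINT z|walk_space. iexp (t * normalized_horo n z)) * char ?N (t * e)"
        by (simp add: char_def)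
      also have "char ?N (t * e) = complex_of_real (exp (- (e\<^sup>2 * t\<^sup>2 / 2)))"
        by (simp add: char_std_normal_distribution power_mult_distrib mult_ac)
      finally show ?thesis by (simp only: integral_iexp_normalized_horo)
    qed
    \<comment> \<open>Inversion needs a law without atoms; given the walk and the disc point, Y' is normal.\<close>
    have atoms: "measure (distr ?\<Omega> borel Y') {a} = 0" for a
    proof -
      have "emeasure (distr ?\<Omega> borel Y') {a} = emeasure ?\<Omega> (Y' -` {a} \<inter> space ?\<Omega>)"
        by (rule emeasure_distr) (use Y'm in auto)
      also have "\<dots> = (\<integral>\<^sup>+z. emeasure ?N (Pair z -` (Y' -` {a} \<inter> space ?\<Omega>)) \<partial>walk_space)"
        by (rule N.emeasure_pair_measure_alt) (use measurable_sets[OF Y'm, of "{a}"] in simp)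
      also have "\<dots> = (\<integral>\<^sup>+z. 0 \<partial>walk_space)"
      proof (rule nn_integral_cong)
        fix z assume "z \<in> space walk_space"
        have "emeasure ?N (Pair z -` (Y' -` {a} \<inter> space ?\<Omega>)) \<le> emeasure ?N {(a - normalized_horo n z) / e}"
          by (rule emeasure_mono) (use e0 in \<open>auto simp: Y'_def field_simps\<close>)
        also have "\<dots> = 0" using measure_singleton_normal[of 1] by (simp add: N.emeasure_eq_measure)
        finally show "emeasure ?N (Pair z -` (Y' -` {a} \<inter> space ?\<Omega>)) = 0" by simp
      qed
      finally show ?thesis by (simp add: measure_def)
    qed
    have close: "\<bar>cdf (distr ?\<Omega> borel Y') y - cdf ?G y\<bar> \<le> B / pi * d" for y
    proof -
      have "\<bar>cdf (distr ?\<Omega> borel Y') y - cdf ?G y\<bar> \<le> (LINT t|lborel. b n t) / pi"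
      proof (rule cdf_diff_le_integral_char)
        show "real_distribution (distr ?\<Omega> borel Y')" by (rule WN.real_distribution_distr) measurable
        show "real_distribution ?G" by (rule real_distribution_normal[OF stddev_pos])
        show "cmod (char (distr ?\<Omega> borel Y') t - char ?G t) \<le> \<bar>t\<bar> * b n t" for t
          unfolding charY' char_normal[OF stddev_pos] e_def by (rule b(3)[OF n])
      qed (rule atoms measure_singleton_normal b(1)[OF n])+
      also have "\<dots> \<le> B * d / pi" using b(2)[OF n] by (intro divide_right_mono) (auto simp: d_def)
      finally show ?thesis by simp
    qed
    have tail: "WN.prob {y \<in> space ?\<Omega>. 2 * d < \<bar>Y y - Y' y\<bar>} \<le> (C + F4) * d"
    proof -
      let ?w = "real n powr (1/6)" and ?v = "real n powr (1/12)"
      let ?A = "{z \<in> space walk_space. ?w < ?D z}" and ?Z = "{g \<in> space ?N. ?v ^ 4 \<le> g ^ 4}"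
      have dw: "d * sqrt (real n) = ?w"
      proof -
        have "d * sqrt (real n) = real n powr (-1/3) * real n powr (1/2)" using rn by (simp add: d_def powr_half_sqrt)
        also have "\<dots> = real n powr (-1/3 + 1/2)" by (rule powr_add[symmetric])
        finally show ?thesis by simp
      qed
      have ev: "e * ?v = d"
      proof -
        have "e * ?v = real n powr (-5/12 + 1/12)" unfolding e_def by (rule powr_add[symmetric])
        then show ?thesis by (simp add: d_def)
      qed
      have A: "?A \<in> sets walk_space" by measurable
      have Z: "?Z \<in> sets ?N" by measurable
      have "WN.prob {y \<in> space ?\<Omega>. 2 * d < \<bar>Y y - Y' y\<bar>} \<le> WN.prob (?A \<times> space ?N \<union> space walk_space \<times> ?Z)"
      proof (rule WN.finite_measure_mono)
        show "{y \<in> space ?\<Omega>. 2 * d < \<bar>Y y - Y' y\<bar>} \<subseteq> ?A \<times> space ?N \<union> space walk_space \<times> ?Z"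
        proof
          fix y assume y: "y \<in> {y \<in> space ?\<Omega>. 2 * d < \<bar>Y y - Y' y\<bar>}"
          obtain z g where zg: "y = (z, g)" by (cases y)
          have z: "z \<in> space walk_space" "g \<in> space ?N" using y zg by (auto simp: space_pair_measure)
          have "Y y - Y' y = ?D z / sqrt (real n) - e * g"
            using normalized_walk_horo_diff(1)[OF z(1), of n] by (simp add: Y_def Y'_def zg)
          then have "2 * d < \<bar>?D z / sqrt (real n) - e * g\<bar>" using y by simp
          also have "\<dots> \<le> ?D z / sqrt (real n) + e * \<bar>g\<bar>"
            using normalized_walk_horo_diff(2)[OF z(1), of n] e0
            by (intro order_trans[OF abs_triangle_ineq4]) (simp add: abs_mult)
          finally have "d < ?D z / sqrt (real n) \<or> d < e * \<bar>g\<bar>" by linarith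
          then show "y \<in> ?A \<times> space ?N \<union> space walk_space \<times> ?Z"
          proof
            assume "d < ?D z / sqrt (real n)"
            then have "?w < ?D z" using rn unfolding dw[symmetric] by (simp add: pos_less_divide_eq)
            then show ?thesis using z zg by simp
          next
            assume "d < e * \<bar>g\<bar>"
            then have "?v \<le> \<bar>g\<bar>" using e0 unfolding ev[symmetric] by simp
            then have "?v ^ 4 \<le> \<bar>g\<bar> ^ 4" by (intro power_mono) auto
            then show ?thesis using z zg by (simp add: power_even_abs)
          qed
        qed
      qed (use A Z in auto)
      also have "\<dots> \<le> WN.prob (?A \<times> space ?N) + WN.prob (space walk_space \<times> ?Z)"
        by (rule measure_Un_le) (use A Z in auto)
      also have "WN.prob (?A \<times> space ?N) = W.prob ?A"
        unfolding measure_def by (subst N.emeasure_pair_measure_Times) (use A N.emeasure_space_1 in simp_all)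
      also have "WN.prob (space walk_space \<times> ?Z) = N.prob ?Z"
        unfolding measure_def by (subst N.emeasure_pair_measure_Times) (use Z in \<open>simp_all add: W.emeasure_space_1\<close>)
      also have "W.prob ?A + N.prob ?Z \<le> C / ?w\<^sup>2 + F4 / ?v ^ 4"
      proof (rule add_mono)
        show "W.prob ?A \<le> C / ?w\<^sup>2" by (rule C(2)) (use rn in simp)
        show "N.prob ?Z \<le> F4 / ?v ^ 4"
          unfolding F4_def
        proof (rule integral_Markov_inequality_measure[OF integrable_std_normal_distribution_moment, where A = "{}"])
          show "AE g in ?N. 0 \<le> g ^ 4" by (intro AE_I2) simp
        qed (use rn in simp_all)
      qed
      also have "\<dots> = (C + F4) * d"
      proof -
        have "?w\<^sup>2 = real n powr (1/3)" "?v ^ 4 = real n powr (1/3)" using rn by (simp_all add: powr_power)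
        moreover have "d = 1 / real n powr (1/3)"
          unfolding d_def using powr_minus_divide[of "real n" "1/3"] by simp
        ultimately show ?thesis by (simp add: add_divide_distrib)
      qed
      finally show ?thesis .
    qed
    have "\<bar>cdf (distr ?\<Omega> borel Y) x - cdf ?G x\<bar> \<le> B / pi * d + (1 / stddev) * (2 * d) + (C + F4) * d"
      by (rule WN.cdf_perturbation[OF Ym Y'm close cdf_normal_lipschitz[OF stddev_pos] _ tail]) (use d0 in simp_all)
    also have "\<dots> = (B / pi + 2 / stddev + (C + F4)) * d" by (simp add: algebra_simps)
    finally show "\<bar>cdf (distr P borel (normalized_walk n)) x - cdf ?G x\<bar> \<le> (B / pi + 2 / stddev + (C + F4)) * real n powr (-1/3)"
      unfolding dY d_def .
  qed
qed

end

theorem theorem4p2: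
  fixes \<alpha> \<beta> :: real and \<nu> :: "real measure"
    and P :: "'a measure" and S :: "nat \<Rightarrow> 'a \<Rightarrow> real"
  assumes "-1/2 \<le> \<beta>" and "\<beta> \<le> \<alpha>" and "-1/2 < \<alpha>"
    and "prob_space \<nu>" and "sets \<nu> = sets half_line"
    and "\<nu> \<noteq> return half_line 0"
    and "integrable \<nu> (\<lambda>t. t ^ 2)"
    and "jacobi_random_walk \<alpha> \<beta> \<nu> P S"
  shows "let M1 = jacobi_modified_moment \<alpha> \<beta> \<nu> 1;
             M2 = jacobi_modified_moment \<alpha> \<beta> \<nu> 2;
             \<mu> = (\<lambda>n. distr P borel (\<lambda>\<omega>. (S n \<omega> - real n * M1) / sqrt (real n)));
             G = density lborel (normal_density 0 (sqrt (M2 - M1\<^sup>2)))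
         in integrable \<nu> (jacobi_moment_fun \<alpha> \<beta> 1) \<and> 0 < M1 \<and>
            integrable \<nu> (jacobi_moment_fun \<alpha> \<beta> 2) \<and> 0 < M2 \<and>
            weak_conv_m \<mu> G \<and>
            (integrable \<nu> (\<lambda>t. t ^ 3) \<longrightarrow>
              (\<lambda>n. SUP x. \<bar>cdf (\<mu> n) x - cdf G x\<bar>) \<in> O(\<lambda>n. real n powr (-1/3)))"
proof -
  interpret \<nu>: prob_space \<nu> by fact
  interpret jacobi_walk_clt \<alpha> \<beta> \<nu> P S
    by unfold_locales (fact assms)+
  let ?M1 = "jacobi_modified_moment \<alpha> \<beta> \<nu> 1" and ?M2 = "jacobi_modified_moment \<alpha> \<beta> \<nu> 2"
  let ?\<mu> = "\<lambda>n. distr P borel (\<lambda>\<omega>. (S n \<omega> - real n * ?M1) / sqrt (real n))"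
  let ?G = "density lborel (normal_density 0 (sqrt (?M2 - ?M1\<^sup>2)))"
  have \<mu>: "distr P borel (normalized_walk n) = ?\<mu> n" for n
    by (simp add: normalized_walk_def[abs_def])
  have G: "density lborel (normal_density 0 stddev) = ?G"
    by (simp add: stddev_def)
  have M1: "0 < ?M1" by (rule mom1_pos)
  have "?M1\<^sup>2 < ?M2" by (rule variance_increment_pos[OF sq ne])
  then have M2: "0 < ?M2" using zero_le_power2[of ?M1] by linarith
  have rate: "(\<lambda>n. SUP x. \<bar>cdf (?\<mu> n) x - cdf ?G x\<bar>) \<in> O(\<lambda>n. real n powr (-1/3))"
    if cube: "integrable \<nu> (\<lambda>t. t ^ 3)"
  proof -
    obtain K where K: "\<And>n x. n \<ge> (1::nat) \<Longrightarrow> \<bar>cdf (?\<mu> n) x - cdf ?G x\<bar> \<le> K * real n powr (-1/3)"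
      using cdf_normalized_walk_rate[OF cube] unfolding \<mu> G by metis
    show ?thesis
    proof (rule bigoI[of _ K], rule eventually_sequentiallyI[of 1])
      fix n :: nat assume n: "1 \<le> n"
      let ?s = "SUP x. \<bar>cdf (?\<mu> n) x - cdf ?G x\<bar>"
      have "bdd_above (range (\<lambda>x. \<bar>cdf (?\<mu> n) x - cdf ?G x\<bar>))"
        using K[OF n] by (intro bdd_aboveI2)
      then have "\<bar>cdf (?\<mu> n) 0 - cdf ?G 0\<bar> \<le> ?s" by (rule cSUP_upper[OF UNIV_I])
      then have "0 \<le> ?s" by linarith
      moreover have "?s \<le> K * real n powr (-1/3)" by (rule cSUP_least) (use K[OF n] in auto)
      ultimately show "norm ?s \<le> K * norm (real n powr (-1/3))" by simp
    qed
  qed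
  show ?thesis
    unfolding Let_def
    using integrable_jacobi_moment_fun[OF integrable_first_moment[OF sq]]
      integrable_jacobi_moment_fun[OF sq] M1 M2
      weak_conv_normalized_walk rate
    unfolding \<mu> G by simp
qed

end
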